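(* Let $G$ be an abelian group and let $UT(d_1,\dots,d_m)$ be an upper block-triangular matrix algebra over an algebraically closed field $\mathbb{K}$ of characteristic zero, endowed with a $G$-grading. Then there exist a decomposition $d_1=p_1t,\dots,d_m=p_mt$ (with $t,p_1,\dots,p_m$ positive integers), a subgroup $H\subseteq G$, and an $n$-tuple $(g_1,\dots,g_n)\in G^n$, where $n=p_1+\cdots+p_m$, such that $UT(d_1,\dots,d_m)$ is isomorphic as a $G$-graded algebra to $UT(p_1,\dots,p_m)\otimes M_t(\mathbb{K})$, where $M_t(\mathbb{K})$ is an $H$-graded algebra with a fine grading with support $H$ and $UT(p_1,\dots,p_m)$ has the elementary grading defined by $(g_1,\dots,g_n)$.
   Context: A $G$-grading on an algebra $A$ is a vector space decomposition $A=\bigoplus_{g\in G}A_g$ with $A_gA_h\subseteq A_{gh}$; $\mathrm{supp}\,A=\{g\in G: A_g\neq0\}$. An isomorphism of graded algebras is an algebra isomorphism $f$ with $f(A_g)\subseteq B_g$ for all $g$. $UT(d_1,\dots,d_m)$ ($d_i$ positive integers, $N=d_1+\cdots+d_m$) is the subalgebra of $M_N(\mathbb{K})$ of block matrices $(A_{ij})_{1\le i,j\le m}$, with $A_{ij}$ of size $d_i\times d_j$ and $A_{ij}=0$ for $i>j$. The elementary grading defined by a tuple $(g_1,\dots,g_n)$ on $UT(p_1,\dots,p_m)$, $n=p_1+\cdots+p_m$, is the one in which each matrix unit $e_{ij}$ of the algebra is homogeneous of degree $g_ig_j^{-1}$. For a $G$-graded algebra $B$ (an algebra graded by a subgroup $H$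 is regarded as $G$-graded), $UT(p_1,\dots,p_m)\otimes B$ has the $G$-grading whose component of degree $g$ is spanned by the elements $e_{ij}\otimes b$ with $b\in B$ homogeneous and $g_i(\deg_G b)g_j^{-1}=g$. A grading on $M_t(\mathbb{K})$ is called fine if every homogeneous component has dimension at most one; here this is equivalent to its being a division grading, i.e. every nonzero homogeneous element is invertible. *)

theory Defs
  imports "HOL-Algebra.Algebra" "Jordan_Normal_Form.VS_Connect"
begin

section \<open>Gradings by a group\<close>

text \<open>
  A \<open>'k\<close>-algebra is a record of type \<^typ>\<open>('k, 'a) module\<close>; its field of scalars is
  \<^const>\<open>class_ring\<close>, and its product and unit are the ring operations of the record.
\<close>

definition is_grading ::
  "('g, 'c) monoid_scheme \<Rightarrow> ('k :: field, 'a) module \<Rightarrow> ('g \<Rightarrow> 'a set) \<Rightarrow> bool"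
where
  "is_grading G A \<A> \<longleftrightarrow>
     (\<forall>g\<in>carrier G. VectorSpace.subspace class_ring (\<A> g) A) \<and>
     (\<forall>x\<in>carrier A. \<exists>!f. f \<in> (\<Pi>\<^sub>E g\<in>carrier G. \<A> g) \<and>
        finite {g \<in> carrier G. f g \<noteq> \<zero>\<^bsub>A\<^esub>} \<and>
        x = (\<Oplus>\<^bsub>A\<^esub>g\<in>{g \<in> carrier G. f g \<noteq> \<zero>\<^bsub>A\<^esub>}. f g)) \<and>
     (\<forall>g\<in>carrier G. \<forall>h\<in>carrier G. \<forall>x\<in>\<A> g. \<forall>y\<in>\<A> h. x \<otimes>\<^bsub>A\<^esub> y \<in> \<A> (g \<otimes>\<^bsub>G\<^esub> h))"

definition grading_support ::
  "('g, 'c) monoid_scheme \<Rightarrow> ('k :: field, 'a) module \<Rightarrow> ('g \<Rightarrow> 'a set) \<Rightarrow> 'g set"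
where
  "grading_support G A \<A> = {g \<in> carrier G. \<A> g \<noteq> {\<zero>\<^bsub>A\<^esub>}}"

text \<open>\<^const>\<open>vectorspace.dim\<close> is meaningful only together with \<^const>\<open>vectorspace.fin_dim\<close>.\<close>

definition is_fine_grading ::
  "('g, 'c) monoid_scheme \<Rightarrow> ('k :: field, 'a) module \<Rightarrow> ('g \<Rightarrow> 'a set) \<Rightarrow> bool"
where
  "is_fine_grading G A \<A> \<longleftrightarrow> is_grading G A \<A> \<and>
     (\<forall>g\<in>carrier G. vectorspace.fin_dim class_ring (A\<lparr>carrier := \<A> g\<rparr>) \<and>
                    vectorspace.dim class_ring (A\<lparr>carrier := \<A> g\<rparr>) \<le> 1)"

definition graded_iso ::
  "('g, 'c) monoid_scheme \<Rightarrow> ('k :: field, 'a) module \<Rightarrow> ('g \<Rightarrow> 'a set) \<Rightarrow>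
   ('k, 'b) module \<Rightarrow> ('g \<Rightarrow> 'b set) \<Rightarrow> ('a \<Rightarrow> 'b) \<Rightarrow> bool"
where
  "graded_iso G A \<A> B \<B> f \<longleftrightarrow>
     f \<in> Ring.ring_hom A B \<and> f \<in> LinearCombinations.module_hom class_ring A B \<and>
     bij_betw f (carrier A) (carrier B) \<and>
     (\<forall>g\<in>carrier G. f ` \<A> g \<subseteq> \<B> g)"


section \<open>Upper block-triangular matrix algebras\<close>

abbreviation full_mat_alg :: "nat \<Rightarrow> ('k :: field, 'k mat) module" where
  "full_mat_alg n \<equiv> module_mat TYPE('k) n n"

text \<open>
  Rows, columns and blocks are counted from 0: block row \<open>k\<close> of a matrix in \<open>UT(ds)\<close> consists of
  the rows \<open>sum_list (take k ds) + a\<close> with \<open>a < ds ! k\<close>.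
\<close>

definition UT :: "nat list \<Rightarrow> 'k :: field mat set" where
  "UT ds = {A \<in> carrier_mat (sum_list ds) (sum_list ds).
     \<forall>k<length ds. \<forall>l<length ds. \<forall>a<ds ! k. \<forall>b<ds ! l.
       l < k \<longrightarrow> A $$ (sum_list (take k ds) + a, sum_list (take l ds) + b) = 0}"

definition UT_alg :: "nat list \<Rightarrow> ('k :: field, 'k mat) module" where
  "UT_alg ds = (full_mat_alg (sum_list ds))\<lparr>carrier := UT ds\<rparr>"

definition matrix_unit :: "nat \<Rightarrow> nat \<Rightarrow> nat \<Rightarrow> 'k :: field mat" where
  "matrix_unit n i j = mat n n (\<lambda>(k, l). if k = i \<and> l = j then 1 else 0)"


section \<open>Tensor products\<close>

text \<open>
  The tensor product of \<open>M\<^sub>n\<close> and \<open>M\<^sub>t\<close> is realised as \<open>M\<^sub>n\<^sub>t\<close>, with the Kronecker product as the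
  pure tensors; the tensor product of subspaces is the span of the Kronecker products
  of their elements. The lemmas below (bilinearity, multiplicativity, and the fact that the matrix
  units of \<open>M\<^sub>n\<close> and \<open>M\<^sub>t\<close> give exactly the matrix units of \<open>M\<^sub>n\<^sub>t\<close>) justify this.
\<close>

definition kron :: "'k :: field mat \<Rightarrow> 'k mat \<Rightarrow> 'k mat" where
  "kron A B = mat (dim_row A * dim_row B) (dim_col A * dim_col B)
     (\<lambda>(i, j). A $$ (i div dim_row B, j div dim_col B) * B $$ (i mod dim_row B, j mod dim_col B))"

lemma mult_add_less_mult: "(i :: nat) < n \<Longrightarrow> k < t \<Longrightarrow> i * t + k < n * t"
  using mult_le_mono1[of "Suc i" n t] by simp

lemma kron_add_left:
  assumes "A \<in> carrier_mat n n" "A' \<in> carrier_mat n n" "B \<in> carrier_mat t t"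
  shows "kron (A + A') B = kron A B + kron A' B"
  using assms by (intro eq_matI) (auto simp: kron_def less_mult_imp_div_less distrib_right)

lemma kron_add_right:
  assumes "A \<in> carrier_mat n n" "B \<in> carrier_mat t t" "B' \<in> carrier_mat t t"
  shows "kron A (B + B') = kron A B + kron A B'"
proof (cases "t = 0")
  case False
  then show ?thesis
    using assms by (intro eq_matI) (auto simp: kron_def distrib_left)
qed (use assms in \<open>auto simp: kron_def intro!: eq_matI\<close>)

lemma kron_smult_left: "kron (c \<cdot>\<^sub>m A) B = c \<cdot>\<^sub>m kron A B"
  by (intro eq_matI) (auto simp: kron_def less_mult_imp_div_less)

lemma kron_smult_right: "kron A (c \<cdot>\<^sub>m B) = c \<cdot>\<^sub>m kron A B"
proof (intro eq_matI)
  fix i j assume "i < dim_row (c \<cdot>\<^sub>m kron A B)" "j < dim_col (c \<cdot>\<^sub>m kron A B)"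
  then have "i < dim_row A * dim_row B" "j < dim_col A * dim_col B" by (auto simp: kron_def)
  moreover from this have "0 < dim_row B" "0 < dim_col B" by (auto intro!: Nat.gr0I)
  ultimately show "kron A (c \<cdot>\<^sub>m B) $$ (i, j) = (c \<cdot>\<^sub>m kron A B) $$ (i, j)"
    by (simp add: kron_def)
qed (auto simp: kron_def)

lemma kron_matrix_unit:
  assumes "i < n" "j < n" "k < t" "l < t"
  shows "kron (matrix_unit n i j) (matrix_unit t k l) = matrix_unit (n * t) (i * t + k) (j * t + l)"
proof -
  have "0 < t" using assms by simp
  have *: "r = i * t + k \<longleftrightarrow> r div t = i \<and> r mod t = k" if "k < t" for r i k :: nat
    using that div_mult_mod_eq[of r t] by auto
  show ?thesis
    using assms \<open>0 < t\<close>
    by (intro eq_matI) (auto simp: kron_def matrix_unit_def less_mult_imp_div_less *)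
qed

lemma kron_mult:
  assumes "A \<in> carrier_mat n n" "A' \<in> carrier_mat n n" "B \<in> carrier_mat t t" "B' \<in> carrier_mat t t"
  shows "kron A B * kron A' B' = kron (A * A') (B * B')"
proof (intro eq_matI)
  fix i j assume "i < dim_row (kron (A * A') (B * B'))" "j < dim_col (kron (A * A') (B * B'))"
  then have ij: "i < n * t" "j < n * t" using assms by (auto simp: kron_def)
  then have t: "0 < t" by (auto intro!: Nat.gr0I)
  have bij: "bij_betw (\<lambda>(a, b). a * t + b) ({0..<n} \<times> {0..<t}) {0..<n * t}"
    by (rule bij_betwI[where g = "\<lambda>r. (r div t, r mod t)"])
       (use t in \<open>auto simp: less_mult_imp_div_less mult_add_less_mult\<close>)
  have "(kron A B * kron A' B') $$ (i, j) =
      (\<Sum>r = 0..<n * t. A $$ (i div t, r div t) * B $$ (i mod t, r mod t) *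
         (A' $$ (r div t, j div t) * B' $$ (r mod t, j mod t)))"
    using assms ij by (simp add: kron_def scalar_prod_def)
  also have "\<dots> = (\<Sum>(a, b)\<in>{0..<n} \<times> {0..<t}. (A $$ (i div t, a) * A' $$ (a, j div t)) *
         (B $$ (i mod t, b) * B' $$ (b, j mod t)))"
    by (subst sum.reindex_bij_betw[OF bij, symmetric]) (auto intro!: sum.cong)
  also have "\<dots> = (\<Sum>a = 0..<n. A $$ (i div t, a) * A' $$ (a, j div t)) *
         (\<Sum>b = 0..<t. B $$ (i mod t, b) * B' $$ (b, j mod t))"
    by (simp add: sum_product sum.cartesian_product)
  also have "\<dots> = kron (A * A') (B * B') $$ (i, j)"
    using assms ij t by (simp add: kron_def scalar_prod_def less_mult_imp_div_less)
  finally show "(kron A B * kron A' B') $$ (i, j) = kron (A * A') (B * B') $$ (i, j)" .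
qed (use assms in \<open>auto simp: kron_def\<close>)

abbreviation mat_span :: "nat \<Rightarrow> 'k :: field mat set \<Rightarrow> 'k mat set" where
  "mat_span n S \<equiv> LinearCombinations.module.span class_ring (full_mat_alg n) S"

definition UT_tensor :: "nat list \<Rightarrow> nat \<Rightarrow> ('k :: field, 'k mat) module" where
  "UT_tensor ps t = (full_mat_alg (sum_list ps * t))
     \<lparr>carrier := mat_span (sum_list ps * t) {kron A B |A B. A \<in> UT ps \<and> B \<in> carrier_mat t t}\<rparr>"

text \<open>
  The grading of \<open>UT(ps) \<otimes> M\<^sub>t\<close> obtained from the elementary grading of \<open>UT(ps)\<close> given by the tuple
  \<open>gs\<close>, in which the matrix unit \<open>e\<^sub>i\<^sub>j\<close> has degree \<open>g\<^sub>i g\<^sub>j\<^sup>-\<^sup>1\<close>, and from the grading \<open>\<B>\<close> of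
  \<open>M\<^sub>t\<close> by the subgroup \<open>H\<close>. Components \<open>\<B> h\<close> with \<open>h\<close> outside \<open>H\<close> are not used: as a grading by \<open>G\<close>,
  they are zero.
\<close>

definition UT_tensor_grading ::
  "('g, 'c) monoid_scheme \<Rightarrow> nat list \<Rightarrow> 'g list \<Rightarrow> nat \<Rightarrow> 'g set \<Rightarrow> ('g \<Rightarrow> 'k :: field mat set) \<Rightarrow>
   'g \<Rightarrow> 'k mat set"
where
  "UT_tensor_grading G ps gs t H \<B> g = mat_span (sum_list ps * t)
     {kron (matrix_unit (sum_list ps) i j) b |i j h b.
        i < sum_list ps \<and> j < sum_list ps \<and> matrix_unit (sum_list ps) i j \<in> (UT ps :: 'k mat set) \<and>
        h \<in> H \<and> b \<in> \<B> h \<and> gs ! i \<otimes>\<^bsub>G\<^esub> h \<otimes>\<^bsub>G\<^esub> inv\<^bsub>G\<^esub> (gs ! j) = g}"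

end

theory Submission
  imports Defs "Jordan_Normal_Form.Char_Poly"
begin

text \<open>
  In characteristic zero the trace of left multiplication on the algebra kills every homogeneous element
  of nontrivial degree. The radical is the kernel of the resulting trace form, hence graded; so are
  its annihilator, the last block column, and the flag of ideals that the radical defines.
  Among the non-nilpotent homogeneous elements of degree one in the last block column choose one of
  minimal rank \<open>t\<close> and factor it as \<open>Q P\<close> with \<open>Q\<close> of size \<open>N \<times> t\<close>. Then the sets \<open>P A\<^sub>g Q\<close> grade \<open>M\<^sub>t\<close>, by
  minimality of \<open>t\<close> as a graded division algebra, and the sets \<open>A\<^sub>g Q\<close> make the \<open>N \<times> t\<close> matrices a graded
  right module over it. A homogeneous basis of this module adapted to the flag, written as the block
  columns of a matrix \<open>V\<close>, yields the isomorphism \<open>a \<mapsto> V\<^sup>-\<^sup>1 a V\<close>.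
\<close>

section \<open>Finite sums and subspaces of matrices\<close>

text \<open>The algebra is not semisimple, so the graded Wedderburn theorem does not apply to it
  directly. The last block column is singled out because its entries are unrestricted: a matrix
  \<open>P\<close> supported on those columns makes \<open>Y * P\<close> an element of the algebra
  for every \<open>N \<times> t\<close> matrix \<open>Y\<close>, and this is how arbitrary
  \<open>N \<times> t\<close> matrices acquire degrees. Minimality of \<open>t\<close> does the work
  of Schur's lemma: a singular nonzero homogeneous \<open>P * a * Q\<close> would produce, through
  the trace, a non-nilpotent element of degree one that factors through a smaller dimension.
  Characteristic zero enters through the weights in the trace, positive integers that must not
  vanish in the field. Algebraic closure makes the degree one component of the division algebra
  consist of scalars. A homogeneous basis alone would give a conjugation that may leave the
  block-triangular shape; adaptation to the flag puts both \<open>V\<close> and its inverse into the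
  algebra. The group may be infinite, so every argument runs over finite sets of degrees.\<close>

definition msum :: "nat \<Rightarrow> nat \<Rightarrow> 'i set \<Rightarrow> ('i \<Rightarrow> 'k :: field mat) \<Rightarrow> 'k mat" where
  "msum nr nc I a = mat nr nc (\<lambda>(i, j). \<Sum>x\<in>I. a x $$ (i, j))"

lemma msum_carrier [simp]: "msum nr nc I a \<in> carrier_mat nr nc"
  by (simp add: msum_def)

lemma msum_dims [simp]: "dim_row (msum nr nc I a) = nr" "dim_col (msum nr nc I a) = nc"
  by (simp_all add: msum_def)

lemma msum_index [simp]:
  "i < nr \<Longrightarrow> j < nc \<Longrightarrow> msum nr nc I a $$ (i, j) = (\<Sum>x\<in>I. a x $$ (i, j))"
  by (simp add: msum_def)

lemma msum_empty [simp]: "msum nr nc {} a = 0\<^sub>m nr nc"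
  by (rule eq_matI) auto

lemma msum_insert:
  assumes "finite I" "x \<notin> I" "a x \<in> carrier_mat nr nc"
  shows "msum nr nc (insert x I) a = a x + msum nr nc I a"
  using assms by (intro eq_matI) auto

lemma msum_cong: "(\<And>x. x \<in> I \<Longrightarrow> a x = b x) \<Longrightarrow> msum nr nc I a = msum nr nc I b"
  by (rule eq_matI) auto

lemma msum_mono_neutral:
  assumes "finite J" "I \<subseteq> J" "\<And>x. x \<in> J - I \<Longrightarrow> a x = 0\<^sub>m nr nc"
  shows "msum nr nc J a = msum nr nc I a"
  using assms by (intro eq_matI) (auto intro!: sum.mono_neutral_right)

text \<open>Additivity of \<open>f\<close> is asked only on a set \<open>C\<close> closed under
  addition, since projections are controlled only on the graded space; the induction therefore
  carries membership in \<open>C\<close> along.\<close>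

lemma msum_map:
  assumes "finite I" "\<And>i. i \<in> I \<Longrightarrow> a i \<in> C" "C \<subseteq> carrier_mat nr nc"
    and zero: "0\<^sub>m nr nc \<in> C" "f (0\<^sub>m nr nc) = 0\<^sub>m nr' nc'"
    and closed: "\<And>x y. x \<in> C \<Longrightarrow> y \<in> C \<Longrightarrow> x + y \<in> C"
    and maps: "\<And>x. x \<in> C \<Longrightarrow> f x \<in> carrier_mat nr' nc'"
    and add: "\<And>x y. x \<in> C \<Longrightarrow> y \<in> C \<Longrightarrow> f (x + y) = f x + f y"
  shows "f (msum nr nc I a) = msum nr' nc' I (\<lambda>i. f (a i))"
proof -
  have "msum nr nc I a \<in> C \<and> f (msum nr nc I a) = msum nr' nc' I (\<lambda>i. f (a i))"
    using assms(1,2)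
  proof (induction I)
    case (insert x I)
    then have "a x \<in> carrier_mat nr nc" "f (a x) \<in> carrier_mat nr' nc'"
      using assms(3) maps by auto
    then show ?case using insert closed add by (auto simp: msum_insert)
  qed (use zero in auto)
  then show ?thesis ..
qed

lemma mult_msum:
  assumes "finite I" "\<And>i. i \<in> I \<Longrightarrow> a i \<in> carrier_mat nr nc" "A \<in> carrier_mat n nr"
  shows "A * msum nr nc I a = msum n nc I (\<lambda>i. A * a i)"
  using assms by (intro msum_map[where C = "carrier_mat nr nc"]) (auto simp: mult_add_distrib_mat)

lemma msum_mult:
  assumes "finite I" "\<And>i. i \<in> I \<Longrightarrow> a i \<in> carrier_mat nr nc" "A \<in> carrier_mat nc n"
  shows "msum nr nc I a * A = msum nr n I (\<lambda>i. a i * A)"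
  using assms
  by (intro msum_map[where C = "carrier_mat nr nc" and f = "\<lambda>x. x * A"])
     (auto simp: add_mult_distrib_mat)

lemma add_mat_index:
  assumes "A \<in> carrier_mat nr nc" "B \<in> carrier_mat nr nc" "i < nr" "j < nc"
  shows "(A + B) $$ (i, j) = A $$ (i, j) + B $$ (i, j)"
  using assms by auto

lemma smult_mat_index:
  assumes "A \<in> carrier_mat nr nc" "i < nr" "j < nc"
  shows "(c \<cdot>\<^sub>m A) $$ (i, j) = c * A $$ (i, j)"
  using assms by auto

text \<open>Premises about dimensions instead of carriers can be discharged by the simplifier, which
  then reassociates long products of rectangular matrices to the right.\<close>

lemma mult_assoc_dim:
  "dim_col A = dim_row B \<Longrightarrow> dim_col B = dim_row D \<Longrightarrow> A * B * D = A * (B * (D :: 'k :: field mat))"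
  by (rule assoc_mult_mat[of A "dim_row A" "dim_row B" B "dim_row D" D "dim_col D"]) auto

lemma det_nonzero_inverse:
  assumes "(M :: 'k :: field mat) \<in> carrier_mat n n" "det M \<noteq> 0"
  obtains M' where "M' \<in> carrier_mat n n" "M * M' = 1\<^sub>m n" "M' * M = 1\<^sub>m n"
  using det_non_zero_imp_unit[OF assms] by (auto simp: Units_def ring_mat_def)

section \<open>Linear subspaces of rectangular matrices\<close>

definition mat_subspace :: "nat \<Rightarrow> nat \<Rightarrow> 'k :: field mat set \<Rightarrow> bool" where
  "mat_subspace nr nc S \<longleftrightarrow> S \<subseteq> carrier_mat nr nc \<and> 0\<^sub>m nr nc \<in> S \<and>
     (\<forall>x\<in>S. \<forall>y\<in>S. x + y \<in> S) \<and> (\<forall>c. \<forall>x\<in>S. c \<cdot>\<^sub>m x \<in> S)"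

lemma mat_subspaceD:
  assumes "mat_subspace nr nc S"
  shows "x \<in> S \<Longrightarrow> x \<in> carrier_mat nr nc" "0\<^sub>m nr nc \<in> S" "x \<in> S \<Longrightarrow> y \<in> S \<Longrightarrow> x + y \<in> S"
    "x \<in> S \<Longrightarrow> c \<cdot>\<^sub>m x \<in> S"
  using assms unfolding mat_subspace_def by auto

lemma mat_subspaceI:
  assumes "\<And>x. x \<in> S \<Longrightarrow> x \<in> carrier_mat nr nc" "0\<^sub>m nr nc \<in> S"
    "\<And>x y. x \<in> S \<Longrightarrow> y \<in> S \<Longrightarrow> x + y \<in> S" "\<And>c x. x \<in> S \<Longrightarrow> c \<cdot>\<^sub>m x \<in> S"
  shows "mat_subspace nr nc S"
  using assms unfolding mat_subspace_def by auto

lemma mat_subspace_carrier: "mat_subspace nr nc (carrier_mat nr nc)"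
  by (auto simp: mat_subspace_def)

lemma mat_subspace_msum:
  assumes "mat_subspace nr nc S" "finite I" "\<And>i. i \<in> I \<Longrightarrow> a i \<in> S"
  shows "msum nr nc I a \<in> S"
  using assms(2,3)
proof (induction I)
  case empty
  then show ?case using assms(1) by (simp add: mat_subspaceD(2))
next
  case (insert x I)
  then show ?case
    using mat_subspaceD[OF assms(1)] by (simp add: msum_insert)
qed

text \<open>One encoding for all subspaces cut out by vanishing entries: the algebra, its radical,
  its last block column, its ideals of upper rows, and the flag inside the
  \<open>N \<times> t\<close> matrices.\<close>

definition pattern_mat :: "nat \<Rightarrow> nat \<Rightarrow> (nat \<Rightarrow> nat \<Rightarrow> bool) \<Rightarrow> 'k :: field mat set" where
  "pattern_mat nr nc R =
     {a \<in> carrier_mat nr nc. \<forall>i<nr. \<forall>j<nc. \<not> R i j \<longrightarrow> a $$ (i, j) = 0}"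

lemma mat_subspace_pattern: "mat_subspace nr nc (pattern_mat nr nc R)"
  by (rule mat_subspaceI) (auto simp: pattern_mat_def)

lemma pattern_matD:
  assumes "a \<in> pattern_mat nr nc R"
  shows "a \<in> carrier_mat nr nc" "i < nr \<Longrightarrow> j < nc \<Longrightarrow> \<not> R i j \<Longrightarrow> a $$ (i, j) = 0"
  using assms by (auto simp: pattern_mat_def)

lemma pattern_matI:
  assumes "a \<in> carrier_mat nr nc" "\<And>i j. i < nr \<Longrightarrow> j < nc \<Longrightarrow> \<not> R i j \<Longrightarrow> a $$ (i, j) = 0"
  shows "a \<in> pattern_mat nr nc R"
  using assms by (auto simp: pattern_mat_def)

lemma times_mat_index:
  assumes "A \<in> carrier_mat n m" "B \<in> carrier_mat m l" "i < n" "j < l"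
  shows "(A * B) $$ (i, j) = (\<Sum>k<m. A $$ (i, k) * B $$ (k, j))"
  using assms by (auto simp: scalar_prod_def atLeast0LessThan)

lemma matrix_unit_carrier [simp]: "matrix_unit n i j \<in> carrier_mat n n"
  by (simp add: matrix_unit_def)

lemma matrix_unit_index [simp]:
  "k < n \<Longrightarrow> l < n \<Longrightarrow> matrix_unit n i j $$ (k, l) = (if k = i \<and> l = j then 1 else 0)"
  by (simp add: matrix_unit_def)

lemma matrix_unit_mult_index:
  assumes "a \<in> carrier_mat n m" "i < n" "j < n" "k < n" "l < m"
  shows "(matrix_unit n i j * a) $$ (k, l) = (if k = i then a $$ (j, l) else 0)"
proof -
  have "(matrix_unit n i j * a) $$ (k, l) = (\<Sum>p<n. (if p = j then (if k = i then a $$ (p, l) else 0) else 0))"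
    unfolding times_mat_index[OF matrix_unit_carrier assms(1) assms(4,5)]
    using assms by (intro sum.cong) auto
  then show ?thesis using assms(3) by simp
qed

lemma mult_matrix_unit_index:
  assumes "a \<in> carrier_mat m n" "i < n" "j < n" "k < m" "l < n"
  shows "(a * matrix_unit n i j) $$ (k, l) = (if l = j then a $$ (k, i) else 0)"
proof -
  have "(a * matrix_unit n i j) $$ (k, l) = (\<Sum>p<n. (if p = i then (if l = j then a $$ (k, p) else 0) else 0))"
    unfolding times_mat_index[OF assms(1) matrix_unit_carrier assms(4,5)]
    using assms by (intro sum.cong) auto
  then show ?thesis using assms(2) by simp
qed

section \<open>Trace, loss of rank and nilpotent matrices\<close>

definition mtrace :: "'k :: field mat \<Rightarrow> 'k" where
  "mtrace a = (\<Sum>i<dim_row a. a $$ (i, i))"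

lemma mtrace_mult_comm:
  assumes "A \<in> carrier_mat n m" "B \<in> carrier_mat m n"
  shows "mtrace (A * B) = mtrace (B * A)"
proof -
  have "mtrace (A * B) = (\<Sum>i<n. \<Sum>k<m. A $$ (i, k) * B $$ (k, i))"
    using assms by (simp add: mtrace_def times_mat_index[OF assms] del: index_mult_mat(1))
  also have "\<dots> = (\<Sum>k<m. \<Sum>i<n. B $$ (k, i) * A $$ (i, k))"
    by (subst sum.swap) (simp add: mult.commute)
  also have "\<dots> = mtrace (B * A)"
    using assms by (simp add: mtrace_def times_mat_index[OF assms(2,1)] del: index_mult_mat(1))
  finally show ?thesis .
qed

lemma mtrace_msum:
  "mtrace (msum n n I a) = (\<Sum>x\<in>I. \<Sum>i<n. a x $$ (i, i))"
  by (simp add: mtrace_def sum.swap[of _ I])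

text \<open>A kernel vector with nonzero entry at \<open>k\<close> expresses column \<open>k\<close>
  through the others. \<open>A\<close> is \<open>M\<close> without that column and \<open>B\<close>
  restores it; \<open>insert_index k\<close> enumerates the indices other than
  \<open>k\<close>.\<close>

lemma singular_factorization:
  fixes M :: "'k :: field mat"
  assumes M: "M \<in> carrier_mat (Suc n) (Suc n)" and "det M = 0"
  shows "\<exists>A B. A \<in> carrier_mat (Suc n) n \<and> B \<in> carrier_mat n (Suc n) \<and> M = A * B"
proof -
  obtain v where v: "v \<in> carrier_vec (Suc n)" "v \<noteq> 0\<^sub>v (Suc n)" "M *\<^sub>v v = 0\<^sub>v (Suc n)"
    using det_0_iff_vec_prod_zero_field[OF M] assms(2) by auto
  then obtain k where k: "k < Suc n" "v $ k \<noteq> 0" by (metis eq_vecI carrier_vecD index_zero_vec)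
  define A where "A = mat (Suc n) n (\<lambda>(i, j). M $$ (i, insert_index k j))"
  define B where "B = mat n (Suc n) (\<lambda>(i, j). if j = k then - (v $ insert_index k i) / v $ k
      else if j = insert_index k i then 1 else 0)"
  have split: "(\<Sum>j<Suc n. f j) = f k + (\<Sum>j<n. f (insert_index k j))" for f :: "nat \<Rightarrow> 'k"
  proof -
    have "(\<Sum>j<Suc n. f j) = f k + (\<Sum>j\<in>{..<Suc n} - {k}. f j)"
      using k by (subst sum.remove[of _ k]) auto
    also have "{..<Suc n} - {k} = insert_index k ` {..<n}"
      using insert_index_image[OF k(1)] by (simp add: atLeast0LessThan)
    also have "(\<Sum>j\<in>insert_index k ` {..<n}. f j) = (\<Sum>j<n. f (insert_index k j))"
      by (subst sum.reindex) (auto simp: insert_index_inj_on)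
    finally show ?thesis .
  qed
  have "M = A * B"
  proof (rule eq_matI)
    fix i j assume "i < dim_row (A * B)" "j < dim_col (A * B)"
    then have ij: "i < Suc n" "j < Suc n" by (auto simp: A_def B_def)
    have AB: "(A * B) $$ (i, j) = (\<Sum>l<n. M $$ (i, insert_index k l) * B $$ (l, j))"
      using ij by (subst times_mat_index[of A "Suc n" n B "Suc n"]) (auto simp: A_def B_def)
    show "M $$ (i, j) = (A * B) $$ (i, j)"
    proof (cases "j = k")
      case True
      have "0 = (M *\<^sub>v v) $ i" using v ij by simp
      also have "\<dots> = (\<Sum>l<Suc n. M $$ (i, l) * v $ l)"
        using M ij v(1) by (auto simp: scalar_prod_def atLeast0LessThan simp del: sum.lessThan_Suc intro!: sum.cong)
      also have "\<dots> = M $$ (i, k) * v $ k + (\<Sum>l<n. M $$ (i, insert_index k l) * v $ insert_index k l)"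
        by (rule split)
      finally have "M $$ (i, k) = - (\<Sum>l<n. M $$ (i, insert_index k l) * v $ insert_index k l) / v $ k"
        using k by (simp add: field_simps add_eq_0_iff)
      also have "\<dots> = (\<Sum>l<n. M $$ (i, insert_index k l) * B $$ (l, k))"
        using k by (simp add: B_def sum_divide_distrib sum_negf)
      finally show ?thesis using AB True by simp
    next
      case False
      then obtain l where l: "l < n" "j = insert_index k l"
        using ij insert_index_image[OF k(1)] by (auto simp: image_iff atLeast0LessThan set_eq_iff)
      have "(\<Sum>p<n. M $$ (i, insert_index k p) * B $$ (p, j)) =
          (\<Sum>p<n. if p = l then M $$ (i, j) else 0)"
        using l ij False insert_index_inj_on[of k UNIV]
        by (intro sum.cong) (auto simp: B_def inj_eq)
      then show ?thesis using AB l by simp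
    qed
  qed (use M in \<open>auto simp: A_def B_def\<close>)
  then show ?thesis by (intro exI[of _ A] exI[of _ B]) (auto simp: A_def B_def)
qed

text \<open>Moving the brackets shows that \<open>B * A\<close> is nilpotent when
  \<open>A * B\<close> is, at the cost of one more factor.\<close>

lemma pow_mat_mult_cycle:
  assumes "A \<in> carrier_mat n m" "B \<in> carrier_mat m n"
  shows "(B * A) ^\<^sub>m Suc k = B * ((A * B) ^\<^sub>m k * A)"
proof (induction k)
  case (Suc k)
  have c: "(A * B) ^\<^sub>m k \<in> carrier_mat n n" using assms by (intro pow_carrier_mat) auto
  have "(B * A) ^\<^sub>m Suc (Suc k) = B * ((A * B) ^\<^sub>m k * A) * (B * A)"
    using Suc by simp
  also have "\<dots> = B * ((A * B) ^\<^sub>m k * A * (B * A))"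
    using assms c by (intro assoc_mult_mat) auto
  also have "(A * B) ^\<^sub>m k * A * (B * A) = (A * B) ^\<^sub>m k * (A * (B * A))"
    using assms c by (intro assoc_mult_mat[of _ n n _ m _ m]) auto
  also have "A * (B * A) = A * B * A"
    using assms by (intro assoc_mult_mat[symmetric]) auto
  also have "(A * B) ^\<^sub>m k * (A * B * A) = (A * B) ^\<^sub>m k * (A * B) * A"
    using assms c by (intro assoc_mult_mat[of _ n n _ n _ m, symmetric]) auto
  finally show ?case by simp
qed (use assms in auto)

lemma det_pow_mat:
  assumes "(A :: 'k :: field mat) \<in> carrier_mat n n"
  shows "det (A ^\<^sub>m k) = det A ^ k"
proof (induction k)
  case (Suc k)
  then show ?case using assms det_mult[OF pow_carrier_mat[OF assms, of k] assms] by simp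
qed (use assms in auto)

text \<open>Induction on the size: a nilpotent matrix is singular, hence a product \<open>A B\<close> through one
  dimension less, and \<open>B A\<close> is again nilpotent with the same trace.\<close>

lemma mtrace_nilpotent:
  fixes z :: "'k :: field mat"
  assumes "z \<in> carrier_mat n n" "z ^\<^sub>m k = 0\<^sub>m n n"
  shows "mtrace z = 0"
  using assms
proof (induction n arbitrary: z k)
  case 0
  then show ?case by (auto simp: mtrace_def)
next
  case (Suc n)
  have "det z ^ k = 0" using Suc.prems det_pow_mat[OF Suc.prems(1), of k] by simp
  then have "det z = 0" by simp
  then obtain A B where AB: "A \<in> carrier_mat (Suc n) n" "B \<in> carrier_mat n (Suc n)" "z = A * B"
    using singular_factorization Suc.prems(1) by blast
  have "(B * A) ^\<^sub>m Suc k = B * (0\<^sub>m (Suc n) (Suc n) * A)"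
    using pow_mat_mult_cycle[OF AB(1,2), of k] Suc.prems(2) AB(3) by simp
  also have "\<dots> = 0\<^sub>m n n" using AB by simp
  finally have "mtrace (B * A) = 0" using AB by (intro Suc.IH[of _ "Suc k"]) auto
  then show ?case using AB mtrace_mult_comm by metis
qed

section \<open>Graded spaces of matrices\<close>

text \<open>A direct sum decomposition alone, with no product and with rectangular sizes: it is
  instantiated by the algebra, by the \<open>N \<times> t\<close> matrices and by the
  \<open>t \<times> t\<close> matrices. Independence concerns finite families, because the index set
  may be infinite.\<close>

locale graded_mats =
  fixes nr nc :: nat and C :: "'k :: field mat set" and I :: "'g set" and S :: "'g \<Rightarrow> 'k mat set"
  assumes whole: "mat_subspace nr nc C"
    and comp: "g \<in> I \<Longrightarrow> mat_subspace nr nc (S g)"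
    and comp_sub: "g \<in> I \<Longrightarrow> S g \<subseteq> C"
    and decomp: "x \<in> C \<Longrightarrow> \<exists>F a. finite F \<and> F \<subseteq> I \<and> (\<forall>g\<in>F. a g \<in> S g) \<and> x = msum nr nc F a"
    and indep: "finite F \<Longrightarrow> F \<subseteq> I \<Longrightarrow> (\<And>g. g \<in> F \<Longrightarrow> a g \<in> S g) \<Longrightarrow>
      msum nr nc F a = 0\<^sub>m nr nc \<Longrightarrow> g \<in> F \<Longrightarrow> a g = 0\<^sub>m nr nc"

text \<open>The whole finitely supported family of components is chosen at once;
  \<open>proj_unique\<close> shows that it is forced. As a constant outside the locale it can refer
  to two graded spaces in one statement, as in \<open>proj_map\<close>.\<close>

definition gproj ::
  "nat \<Rightarrow> nat \<Rightarrow> 'g set \<Rightarrow> ('g \<Rightarrow> 'k :: field mat set) \<Rightarrow> 'k mat \<Rightarrow> 'g \<Rightarrow> 'k mat" where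
  "gproj nr nc I S x = (SOME a. \<exists>F. finite F \<and> F \<subseteq> I \<and> (\<forall>g\<in>I. a g \<in> S g) \<and>
     (\<forall>g. g \<notin> F \<longrightarrow> a g = 0\<^sub>m nr nc) \<and> x = msum nr nc F a)"

context graded_mats
begin

lemma C_carrier: "x \<in> C \<Longrightarrow> x \<in> carrier_mat nr nc"
  using mat_subspaceD[OF whole] by auto

lemma S_carrier: "g \<in> I \<Longrightarrow> x \<in> S g \<Longrightarrow> x \<in> carrier_mat nr nc"
  using mat_subspaceD[OF comp] by auto

lemma S_in_C: "g \<in> I \<Longrightarrow> x \<in> S g \<Longrightarrow> x \<in> C"
  using comp_sub by auto

abbreviation \<pi> where "\<pi> \<equiv> gproj nr nc I S"

lemma proj_props:
  assumes "x \<in> C"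
  shows "\<exists>F. finite F \<and> F \<subseteq> I \<and> (\<forall>g\<in>I. \<pi> x g \<in> S g) \<and>
     (\<forall>g. g \<notin> F \<longrightarrow> \<pi> x g = 0\<^sub>m nr nc) \<and> x = msum nr nc F (\<pi> x)"
proof -
  obtain F a where Fa: "finite F" "F \<subseteq> I" "\<forall>g\<in>F. a g \<in> S g" "x = msum nr nc F a"
    using decomp[OF assms] by auto
  define b where "b g = (if g \<in> F then a g else 0\<^sub>m nr nc)" for g
  have "x = msum nr nc F b" unfolding Fa(4) by (rule msum_cong) (simp add: b_def)
  then have "\<exists>b F. finite F \<and> F \<subseteq> I \<and> (\<forall>g\<in>I. b g \<in> S g) \<and>
     (\<forall>g. g \<notin> F \<longrightarrow> b g = 0\<^sub>m nr nc) \<and> x = msum nr nc F b"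
    using Fa mat_subspaceD(2)[OF comp] by (intro exI[of _ b] exI[of _ F]) (auto simp: b_def)
  then show ?thesis unfolding gproj_def by (rule someI_ex)
qed

lemma proj_in: "x \<in> C \<Longrightarrow> g \<in> I \<Longrightarrow> \<pi> x g \<in> S g"
  using proj_props by blast

lemma proj_in_C: "x \<in> C \<Longrightarrow> g \<in> I \<Longrightarrow> \<pi> x g \<in> C"
  using proj_in S_in_C by blast

lemma proj_carrier: "x \<in> C \<Longrightarrow> g \<in> I \<Longrightarrow> \<pi> x g \<in> carrier_mat nr nc"
  using proj_in_C C_carrier by blast

lemma proj_sum:
  assumes "x \<in> C"
  obtains F where "finite F" "F \<subseteq> I" "x = msum nr nc F (\<pi> x)" "\<And>g. g \<notin> F \<Longrightarrow> \<pi> x g = 0\<^sub>m nr nc"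
  using proj_props[OF assms] by blast

lemma proj_sum_superset:
  assumes "x \<in> C" "finite F" "\<And>g. g \<in> I \<Longrightarrow> g \<notin> F \<Longrightarrow> \<pi> x g = 0\<^sub>m nr nc"
  shows "x = msum nr nc F (\<pi> x)"
proof -
  obtain E where E: "finite E" "E \<subseteq> I" "x = msum nr nc E (\<pi> x)" "\<And>g. g \<notin> E \<Longrightarrow> \<pi> x g = 0\<^sub>m nr nc"
    using proj_sum[OF assms(1)] by blast
  have "msum nr nc (E \<union> F) (\<pi> x) = msum nr nc E (\<pi> x)"
    using E assms by (intro msum_mono_neutral) auto
  moreover have "msum nr nc (E \<union> F) (\<pi> x) = msum nr nc F (\<pi> x)"
    using E assms by (intro msum_mono_neutral) auto
  ultimately show ?thesis using E(3) by simp
qed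

text \<open>Two decompositions of one matrix differ by a homogeneous family with sum zero, which
  \<open>indep\<close> annihilates.\<close>

lemma proj_unique:
  assumes F: "finite F" "F \<subseteq> I" "\<And>g. g \<in> F \<Longrightarrow> a g \<in> S g" and g: "g \<in> I"
  shows "\<pi> (msum nr nc F a) g = (if g \<in> F then a g else 0\<^sub>m nr nc)"
proof -
  define x where "x = msum nr nc F a"
  have x: "x \<in> C"
    unfolding x_def using F comp_sub by (intro mat_subspace_msum whole) auto
  obtain E where E: "finite E" "E \<subseteq> I" "x = msum nr nc E (\<pi> x)" "\<And>g. g \<notin> E \<Longrightarrow> \<pi> x g = 0\<^sub>m nr nc"
    using proj_sum[OF x] by blast
  define b where "b g = (if g \<in> F then a g else 0\<^sub>m nr nc)" for g
  \<comment> \<open>\<open>g\<close> is added so that this degree is compared even if it lies in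
    neither support.\<close>
  define K where "K = insert g (E \<union> F)"
  have K: "finite K" "K \<subseteq> I" using E F g by (auto simp: K_def)
  have b: "b h \<in> S h" if "h \<in> K" for h
    using F(3) mat_subspaceD(2)[OF comp] K that by (auto simp: b_def)
  have p: "\<pi> x h \<in> S h" if "h \<in> K" for h using proj_in[OF x] that K by blast
  have "x = msum nr nc K (\<pi> x)"
    using E(4) K by (intro proj_sum_superset x) (auto simp: K_def)
  moreover have "x = msum nr nc K b"
  proof -
    have "msum nr nc K b = msum nr nc F b"
      using K by (intro msum_mono_neutral) (auto simp: b_def K_def)
    also have "\<dots> = x" unfolding x_def by (rule msum_cong) (simp add: b_def)
    finally show ?thesis ..
  qed
  ultimately have eq: "(\<Sum>h\<in>K. \<pi> x h $$ (i, j)) = (\<Sum>h\<in>K. b h $$ (i, j))" if "i < nr" "j < nc" for i j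
    using msum_index[OF that, of K] by metis
  have "\<pi> x g + (-1) \<cdot>\<^sub>m b g = 0\<^sub>m nr nc"
  proof (rule indep[OF K, of "\<lambda>h. \<pi> x h + (-1) \<cdot>\<^sub>m b h"])
    show "msum nr nc K (\<lambda>h. \<pi> x h + - 1 \<cdot>\<^sub>m b h) = 0\<^sub>m nr nc"
    proof (rule eq_matI)
      fix i j assume ij: "i < dim_row (0\<^sub>m nr nc :: 'k mat)" "j < dim_col (0\<^sub>m nr nc :: 'k mat)"
      have "(\<Sum>h\<in>K. (\<pi> x h + - 1 \<cdot>\<^sub>m b h) $$ (i, j)) = (\<Sum>h\<in>K. \<pi> x h $$ (i, j) - b h $$ (i, j))"
      proof (rule sum.cong)
        fix h assume "h \<in> K"
        then have "b h \<in> carrier_mat nr nc" using b S_carrier K by blast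
        then show "(\<pi> x h + - 1 \<cdot>\<^sub>m b h) $$ (i, j) = \<pi> x h $$ (i, j) - b h $$ (i, j)"
          using ij by simp
      qed simp
      then show "msum nr nc K (\<lambda>h. \<pi> x h + - 1 \<cdot>\<^sub>m b h) $$ (i, j) = 0\<^sub>m nr nc $$ (i, j)"
        using ij eq by (simp add: sum_subtractf)
    qed auto
    show "g \<in> K" by (simp add: K_def)
    fix h assume "h \<in> K"
    then show "\<pi> x h + - 1 \<cdot>\<^sub>m b h \<in> S h"
      using p b mat_subspaceD[OF comp] K by blast
  qed
  moreover have "\<pi> x g \<in> carrier_mat nr nc" "b g \<in> carrier_mat nr nc"
    using p b S_carrier K by (auto simp: K_def)
  ultimately have "\<pi> x g $$ (i, j) = b g $$ (i, j)" if "i < nr" "j < nc" for i j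
  proof -
    have "(\<pi> x g + (-1) \<cdot>\<^sub>m b g) $$ (i, j) = 0" using \<open>\<pi> x g + (-1) \<cdot>\<^sub>m b g = 0\<^sub>m nr nc\<close> that by simp
    then show ?thesis using that \<open>\<pi> x g \<in> carrier_mat nr nc\<close> \<open>b g \<in> carrier_mat nr nc\<close> by auto
  qed
  then have "\<pi> x g = b g"
    using \<open>\<pi> x g \<in> carrier_mat nr nc\<close> \<open>b g \<in> carrier_mat nr nc\<close> by (intro eq_matI) auto
  then show ?thesis by (simp add: x_def b_def)
qed

lemma proj_homogeneous:
  assumes "h \<in> I" "x \<in> S h" "g \<in> I"
  shows "\<pi> x g = (if g = h then x else 0\<^sub>m nr nc)"
proof -
  have "msum nr nc {h} (\<lambda>_. x) = x"
    using S_carrier[OF assms(1,2)] by (intro eq_matI) auto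
  then show ?thesis using proj_unique[of "{h}" "\<lambda>_. x" g] assms by auto
qed

lemma proj_zero: "g \<in> I \<Longrightarrow> \<pi> (0\<^sub>m nr nc) g = 0\<^sub>m nr nc"
  using proj_unique[of "{}" "\<lambda>_. 0\<^sub>m nr nc" g] by simp

lemma proj_eq_imp_zero:
  assumes "x \<in> C" "\<And>g. g \<in> I \<Longrightarrow> \<pi> x g = 0\<^sub>m nr nc"
  shows "x = 0\<^sub>m nr nc"
  using proj_sum_superset[of x "{}"] assms by simp

lemma proj_homogeneousD:
  assumes "x \<in> C" "h \<in> I" "\<And>g. g \<in> I \<Longrightarrow> g \<noteq> h \<Longrightarrow> \<pi> x g = 0\<^sub>m nr nc"
  shows "x = \<pi> x h" "x \<in> S h"
proof -
  have "x = msum nr nc {h} (\<pi> x)"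
    using assms by (intro proj_sum_superset) auto
  also have "\<dots> = \<pi> x h" using proj_carrier[OF assms(1,2)] by (intro eq_matI) auto
  finally show "x = \<pi> x h" .
  with proj_in[OF assms(1,2)] show "x \<in> S h" by simp
qed

definition graded_subset :: "'k mat set \<Rightarrow> bool" where
  "graded_subset T \<longleftrightarrow> mat_subspace nr nc T \<and> T \<subseteq> C \<and> (\<forall>x\<in>T. \<forall>g\<in>I. \<pi> x g \<in> T)"

end

text \<open>The image of the decomposition of \<open>x\<close> is a decomposition of
  \<open>f x\<close>, and injectivity of \<open>\<sigma>\<close> keeps its degrees apart.
  Multiplication by homogeneous elements on either side and the passage
  \<open>a \<mapsto> a * Q\<close> are all treated by this one lemma.\<close>

lemma proj_map:
  assumes "graded_mats nr nc C I S" "graded_mats nr' nc' C' I S'"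
    and f: "\<And>x. x \<in> C \<Longrightarrow> f x \<in> C'" "\<And>x y. x \<in> C \<Longrightarrow> y \<in> C \<Longrightarrow> f (x + y) = f x + f y"
      "f (0\<^sub>m nr nc) = 0\<^sub>m nr' nc'"
    and \<sigma>: "inj_on \<sigma> I" "\<And>h. h \<in> I \<Longrightarrow> \<sigma> h \<in> I"
    and hom: "\<And>h x. h \<in> I \<Longrightarrow> x \<in> S h \<Longrightarrow> f x \<in> S' (\<sigma> h)"
    and x: "x \<in> C" and g: "g \<in> I"
  shows "gproj nr' nc' I S' (f x) (\<sigma> g) = f (gproj nr nc I S x g)"
proof -
  interpret A: graded_mats nr nc C I S by fact
  interpret B: graded_mats nr' nc' C' I S' by fact
  obtain E where E: "finite E" "E \<subseteq> I" "x = msum nr nc E (A.\<pi> x)" "\<And>g. g \<notin> E \<Longrightarrow> A.\<pi> x g = 0\<^sub>m nr nc"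
    using A.proj_sum[OF x] by blast
  define F where "F = insert g E"
  have F: "finite F" "F \<subseteq> I" "g \<in> F" using E g by (auto simp: F_def)
  have inj: "inj_on \<sigma> F" using \<sigma>(1) F(2) inj_on_subset by blast
  have "f x = f (msum nr nc F (A.\<pi> x))"
    using A.proj_sum_superset[OF x F(1)] E(4) by (auto simp: F_def)
  also have "\<dots> = msum nr' nc' F (\<lambda>h. f (A.\<pi> x h))"
    using F f x A.C_carrier B.C_carrier mat_subspaceD[OF A.whole]
    by (intro msum_map[where C = C]) (auto intro!: A.proj_in_C)
  also have "\<dots> = msum nr' nc' (\<sigma> ` F) (\<lambda>k. f (A.\<pi> x (the_inv_into F \<sigma> k)))"
    using inj by (intro eq_matI) (auto simp: sum.reindex the_inv_into_f_f intro!: sum.cong)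
  finally have *: "f x = msum nr' nc' (\<sigma> ` F) (\<lambda>k. f (A.\<pi> x (the_inv_into F \<sigma> k)))" .
  have "B.\<pi> (f x) (\<sigma> g) = f (A.\<pi> x (the_inv_into F \<sigma> (\<sigma> g)))"
    unfolding * using F \<sigma> inj hom A.proj_in[OF x] g
    by (subst B.proj_unique) (auto simp: the_inv_into_f_f subset_iff)
  then show ?thesis using inj F by (simp add: the_inv_into_f_f)
qed

context graded_mats
begin

lemma proj_additive:
  assumes x: "x \<in> C" and y: "y \<in> C" and g: "g \<in> I"
  shows "\<pi> (x + y) g = \<pi> x g + \<pi> y g"
proof -
  obtain E where E: "finite E" "E \<subseteq> I" "x = msum nr nc E (\<pi> x)" "\<And>g. g \<notin> E \<Longrightarrow> \<pi> x g = 0\<^sub>m nr nc"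
    using proj_sum[OF x] by blast
  obtain E' where E': "finite E'" "E' \<subseteq> I" "y = msum nr nc E' (\<pi> y)" "\<And>g. g \<notin> E' \<Longrightarrow> \<pi> y g = 0\<^sub>m nr nc"
    using proj_sum[OF y] by blast
  define F where "F = insert g (E \<union> E')"
  have F: "finite F" "F \<subseteq> I" "g \<in> F" using E E' g by (auto simp: F_def)
  have cx: "\<pi> x h \<in> carrier_mat nr nc" "\<pi> y h \<in> carrier_mat nr nc" if "h \<in> F" for h
    using proj_carrier F that x y by auto
  have "x = msum nr nc F (\<pi> x)" "y = msum nr nc F (\<pi> y)"
    using E E' x y F by (auto simp: F_def intro!: proj_sum_superset)
  then have "x + y = msum nr nc F (\<pi> x) + msum nr nc F (\<pi> y)" by simp
  also have "\<dots> = msum nr nc F (\<lambda>h. \<pi> x h + \<pi> y h)"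
  proof (rule eq_matI)
    fix i j assume "i < dim_row (msum nr nc F (\<lambda>h. \<pi> x h + \<pi> y h))"
      "j < dim_col (msum nr nc F (\<lambda>h. \<pi> x h + \<pi> y h))"
    then have ij: "i < nr" "j < nc" by auto
    have "(\<Sum>h\<in>F. (\<pi> x h + \<pi> y h) $$ (i, j)) = (\<Sum>h\<in>F. \<pi> x h $$ (i, j) + \<pi> y h $$ (i, j))"
      using ij by (intro sum.cong refl add_mat_index[OF cx]) auto
    then show "(msum nr nc F (\<pi> x) + msum nr nc F (\<pi> y)) $$ (i, j) =
        msum nr nc F (\<lambda>h. \<pi> x h + \<pi> y h) $$ (i, j)"
      using ij by (simp add: sum.distrib)
  qed auto
  finally have eq: "x + y = msum nr nc F (\<lambda>h. \<pi> x h + \<pi> y h)" .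
  show ?thesis
    unfolding eq using F g x y mat_subspaceD(3)[OF comp]
    by (subst proj_unique) (auto simp: subset_iff proj_in)
qed

lemma proj_smult:
  assumes x: "x \<in> C" and g: "g \<in> I"
  shows "\<pi> (c \<cdot>\<^sub>m x) g = c \<cdot>\<^sub>m \<pi> x g"
proof -
  have "gproj nr nc I S ((\<lambda>x. c \<cdot>\<^sub>m x) x) (id g) = (\<lambda>x. c \<cdot>\<^sub>m x) (gproj nr nc I S x g)"
    using mat_subspaceD[OF comp] mat_subspaceD[OF whole] x g C_carrier
    by (intro proj_map[where C = C and C' = C]) (auto intro: graded_mats_axioms simp: add_smult_distrib_left_mat[of _ nr nc])
  then show ?thesis by simp
qed

lemma proj_msum:
  assumes "finite F" "\<And>i. i \<in> F \<Longrightarrow> a i \<in> C" "g \<in> I"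
  shows "\<pi> (msum nr nc F a) g = msum nr nc F (\<lambda>i. \<pi> (a i) g)"
  using assms mat_subspaceD[OF whole] C_carrier
  by (intro msum_map[where C = C and f = "\<lambda>x. \<pi> x g"]) (auto simp: proj_zero proj_additive intro: proj_carrier)

end

section \<open>Graded incidence algebras\<close>

text \<open>Left multiplication by \<open>a\<close> has diagonal coefficient
  \<open>a $$ (i, i)\<close> at each matrix unit in position \<open>(i, j)\<close>, so this entry is
  counted once for every admissible column \<open>j\<close> of row \<open>i\<close>.\<close>

definition trace_weight :: "nat \<Rightarrow> (nat \<Rightarrow> nat \<Rightarrow> bool) \<Rightarrow> nat \<Rightarrow> nat" where
  "trace_weight N R i = card {j. j < N \<and> R i j}"

text \<open>\<open>R\<close> is a preorder, so its pattern is an incidence algebra. The trace form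
  and the radical are treated at this level; block shapes appear only afterwards.\<close>

locale graded_incidence_alg = group G + graded_mats N N "pattern_mat N N R" "carrier G" A
  for G :: "('g, 'c) monoid_scheme" (structure) and N :: nat and R :: "nat \<Rightarrow> nat \<Rightarrow> bool"
    and A :: "'g \<Rightarrow> 'k :: field_char_0 mat set" +
  assumes A_mult: "g \<in> carrier G \<Longrightarrow> h \<in> carrier G \<Longrightarrow> x \<in> A g \<Longrightarrow> y \<in> A h \<Longrightarrow> x * y \<in> A (g \<otimes> h)"
    and R_refl: "R i i"
    and R_trans: "R i j \<Longrightarrow> R j k \<Longrightarrow> R i k"
begin

abbreviation "C \<equiv> pattern_mat N N R :: 'k mat set"

lemma pattern_mult:
  assumes "a \<in> C" "b \<in> C"
  shows "a * b \<in> C"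
proof (rule pattern_matI)
  fix i j assume ij: "i < N" "j < N" "\<not> R i j"
  have "(a * b) $$ (i, j) = (\<Sum>k<N. a $$ (i, k) * b $$ (k, j))"
    using assms pattern_matD ij by (intro times_mat_index) auto
  also have "\<dots> = 0"
  proof (intro sum.neutral ballI)
    fix k assume "k \<in> {..<N}"
    moreover have "\<not> R i k \<or> \<not> R k j" using ij R_trans by blast
    ultimately show "a $$ (i, k) * b $$ (k, j) = 0"
      using ij pattern_matD(2)[OF assms(1), of i k] pattern_matD(2)[OF assms(2), of k j] by auto
  qed
  finally show "(a * b) $$ (i, j) = 0" .
qed (use assms pattern_matD(1)[of a N N R] pattern_matD(1)[of b N N R] in auto)

lemma unit_in_C: "R i j \<Longrightarrow> matrix_unit N i j \<in> C"
  by (rule pattern_matI) auto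

definition pos :: "(nat \<times> nat) set" where
  "pos = {(i, j). i < N \<and> j < N \<and> R i j}"

lemma finite_pos: "finite pos"
  by (rule finite_subset[of _ "{..<N} \<times> {..<N}"]) (auto simp: pos_def)

lemma C_expand:
  assumes "x \<in> C"
  shows "x = msum N N pos (\<lambda>(k, l). x $$ (k, l) \<cdot>\<^sub>m matrix_unit N k l)"
proof (rule eq_matI)
  fix i j assume "i < dim_row (msum N N pos (\<lambda>(k, l). x $$ (k, l) \<cdot>\<^sub>m matrix_unit N k l))"
    "j < dim_col (msum N N pos (\<lambda>(k, l). x $$ (k, l) \<cdot>\<^sub>m matrix_unit N k l))"
  then have ij: "i < N" "j < N" by auto
  have "(\<Sum>p\<in>pos. (case p of (k, l) \<Rightarrow> x $$ (k, l) \<cdot>\<^sub>m matrix_unit N k l) $$ (i, j)) =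
      (\<Sum>p\<in>pos. if p = (i, j) then x $$ (i, j) else 0)"
    using ij by (intro sum.cong refl)
      (auto simp: smult_mat_index[OF matrix_unit_carrier] split: if_splits)
  also have "\<dots> = x $$ (i, j)"
    using assms ij finite_pos by (auto simp: pos_def pattern_matD)
  finally show "x $$ (i, j) = msum N N pos (\<lambda>(k, l). x $$ (k, l) \<cdot>\<^sub>m matrix_unit N k l) $$ (i, j)"
    using ij by simp
qed (use assms pattern_matD(1)[of x] in auto)

section \<open>Traces of operators on the incidence algebra\<close>

definition linear_on_C :: "('k mat \<Rightarrow> 'k mat) \<Rightarrow> bool" where
  "linear_on_C T \<longleftrightarrow> (\<forall>x\<in>C. T x \<in> C) \<and> (\<forall>x\<in>C. \<forall>y\<in>C. T (x + y) = T x + T y) \<and>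
     (\<forall>c. \<forall>x\<in>C. T (c \<cdot>\<^sub>m x) = c \<cdot>\<^sub>m T x)"

lemma linear_on_C_zero:
  assumes "linear_on_C T" shows "T (0\<^sub>m N N) = 0\<^sub>m N N"
proof -
  have 0: "0\<^sub>m N N \<in> C" using mat_subspaceD[OF whole] by auto
  then have *: "T (0 \<cdot>\<^sub>m 0\<^sub>m N N) = 0 \<cdot>\<^sub>m T (0\<^sub>m N N)" "T (0\<^sub>m N N) \<in> carrier_mat N N"
    using assms C_carrier unfolding linear_on_C_def by blast+
  have "0 \<cdot>\<^sub>m 0\<^sub>m N N = (0\<^sub>m N N :: 'k mat)" by auto
  moreover have "0 \<cdot>\<^sub>m T (0\<^sub>m N N) = 0\<^sub>m N N" using *(2) by (intro eq_matI) auto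
  ultimately show ?thesis using *(1) by metis
qed

text \<open>The trace in the basis of matrix units at the positions in \<open>pos\<close>, where a
  coordinate is simply an entry.\<close>

definition op_trace :: "('k mat \<Rightarrow> 'k mat) \<Rightarrow> 'k" where
  "op_trace T = (\<Sum>(i, j)\<in>pos. T (matrix_unit N i j) $$ (i, j))"

text \<open>Expanding the image of a matrix unit under \<open>T\<close> in matrix units gives a
  double sum of products of coefficients. This form is symmetric in \<open>S\<close> and
  \<open>T\<close>, which is the cyclicity of the trace.\<close>

lemma op_trace_comp:
  assumes S: "linear_on_C S" and T: "linear_on_C T"
  shows "op_trace (\<lambda>x. S (T x)) = (\<Sum>p\<in>pos. \<Sum>q\<in>pos.
    T (case_prod (matrix_unit N) p) $$ q * S (case_prod (matrix_unit N) q) $$ p)"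
  unfolding op_trace_def
proof (intro sum.cong refl)
  fix p assume "p \<in> pos"
  obtain i j where p: "p = (i, j)" by force
  with \<open>p \<in> pos\<close> have ij: "i < N" "j < N" "R i j" by (auto simp: pos_def)
  define y where "y = T (matrix_unit N i j)"
  have y: "y \<in> C" using T ij unit_in_C by (auto simp: y_def linear_on_C_def)
  have "S y = S (msum N N pos (\<lambda>(k, l). y $$ (k, l) \<cdot>\<^sub>m matrix_unit N k l))"
    using C_expand[OF y] by simp
  also have "\<dots> = msum N N pos (\<lambda>q. S ((\<lambda>(k, l). y $$ (k, l) \<cdot>\<^sub>m matrix_unit N k l) q))"
    using S C_carrier mat_subspaceD[OF whole] finite_pos unit_in_C linear_on_C_zero[OF S]
    by (intro msum_map[where C = C]) (auto simp: linear_on_C_def pos_def)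
  also have "\<dots> $$ (i, j) = (\<Sum>q\<in>pos. y $$ q * S (case_prod (matrix_unit N) q) $$ (i, j))"
  proof -
    have "S (y $$ q \<cdot>\<^sub>m case_prod (matrix_unit N) q) $$ (i, j) = y $$ q * S (case_prod (matrix_unit N) q) $$ (i, j)"
      if "q \<in> pos" for q
    proof -
      have "case_prod (matrix_unit N) q \<in> C" using that unit_in_C by (auto simp: pos_def)
      moreover from this have "S (case_prod (matrix_unit N) q) \<in> carrier_mat N N"
        using S C_carrier by (auto simp: linear_on_C_def)
      ultimately show ?thesis using S ij by (auto simp: linear_on_C_def)
    qed
    then show ?thesis using ij by (auto intro!: sum.cong simp: case_prod_beta)
  qed
  finally show "(case p of (i, j) \<Rightarrow> S (T (matrix_unit N i j)) $$ (i, j)) =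
      (\<Sum>q\<in>pos. T (case_prod (matrix_unit N) p) $$ q * S (case_prod (matrix_unit N) q) $$ p)"
    by (simp add: p y_def)
qed

lemma op_trace_comm:
  assumes "linear_on_C S" "linear_on_C T"
  shows "op_trace (\<lambda>x. S (T x)) = op_trace (\<lambda>x. T (S x))"
  unfolding op_trace_comp[OF assms] op_trace_comp[OF assms(2,1)]
  by (subst sum.swap) (simp add: mult.commute)

definition \<tau> :: "'k mat \<Rightarrow> 'k" where
  "\<tau> a = (\<Sum>i<N. of_nat (trace_weight N R i) * a $$ (i, i))"

lemma \<tau>_op_trace:
  assumes "a \<in> C"
  shows "op_trace (\<lambda>x. a * x) = \<tau> a"
proof -
  have "op_trace (\<lambda>x. a * x) = (\<Sum>(i, j)\<in>pos. a $$ (i, i))"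
    unfolding op_trace_def
    using assms pattern_matD(1)[OF assms] by (intro sum.cong) (auto simp: pos_def mult_matrix_unit_index simp del: index_mult_mat(1))
  also have "pos = Sigma {..<N} (\<lambda>i. {j. j < N \<and> R i j})" by (auto simp: pos_def)
  also have "(\<Sum>(i, j)\<in>\<dots>. a $$ (i, i)) = \<tau> a"
    by (subst sum.Sigma[symmetric]) (auto simp: \<tau>_def trace_weight_def)
  finally show ?thesis .
qed

lemma linear_mult: "a \<in> C \<Longrightarrow> linear_on_C (\<lambda>x. a * x)"
  using C_carrier pattern_mult
  by (auto simp: linear_on_C_def mult_add_distrib_mat[of _ N N _ N] mult_smult_distrib[of _ N N _ N])

lemma linear_proj: "g \<in> carrier G \<Longrightarrow> linear_on_C (\<lambda>x. \<pi> x g)"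
  by (auto simp: linear_on_C_def proj_additive proj_smult intro: proj_in_C)

lemma linear_comp: "linear_on_C S \<Longrightarrow> linear_on_C T \<Longrightarrow> linear_on_C (\<lambda>x. S (T x))"
  by (auto simp: linear_on_C_def)

text \<open>\<open>\<tau> a\<close> is the trace of left multiplication by \<open>a\<close>, which moves every component to a different one
  if \<open>a\<close> is homogeneous of nontrivial degree.\<close>

lemma \<tau>_homogeneous_zero:
  assumes g: "g \<in> carrier G" "g \<noteq> \<one>" and a: "a \<in> A g"
  shows "\<tau> a = 0"
proof -
  have aC: "a \<in> C" using S_in_C g a by blast
  \<comment> \<open>The basis is finite and each basis element has finitely many components, so
    finitely many degrees suffice to write the identity as a sum of projections, even for infinite
    \<open>G\<close>.\<close>
  have "\<forall>p\<in>pos. \<exists>F. finite F \<and> F \<subseteq> carrier G \<and>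
      (\<forall>h. h \<notin> F \<longrightarrow> \<pi> (case_prod (matrix_unit N) p) h = 0\<^sub>m N N)"
  proof
    fix p assume "p \<in> pos"
    then have "(case_prod (matrix_unit N) p :: 'k mat) \<in> C" using unit_in_C by (auto simp: pos_def)
    from proj_props[OF this] show "\<exists>F. finite F \<and> F \<subseteq> carrier G \<and>
        (\<forall>h. h \<notin> F \<longrightarrow> \<pi> (case_prod (matrix_unit N) p) h = 0\<^sub>m N N)" by (elim exE conjE) blast
  qed
  from bchoice[OF this] obtain Fp where Fp: "\<And>p. p \<in> pos \<Longrightarrow> finite (Fp p)"
      "\<And>p. p \<in> pos \<Longrightarrow> Fp p \<subseteq> carrier G"
      "\<And>p h. p \<in> pos \<Longrightarrow> h \<notin> Fp p \<Longrightarrow> \<pi> (case_prod (matrix_unit N) p) h = 0\<^sub>m N N"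
    by blast
  define F where "F = (\<Union>p\<in>pos. Fp p)"
  have F: "finite F" "F \<subseteq> carrier G" unfolding F_def using Fp(1,2) finite_pos by blast+
  have "op_trace (\<lambda>x. a * x) = (\<Sum>p\<in>pos. \<Sum>h\<in>F. (a * \<pi> (case_prod (matrix_unit N) p) h) $$ p)"
    unfolding op_trace_def
  proof (intro sum.cong refl)
    fix p assume p: "p \<in> pos"
    define e :: "'k mat" where "e = case_prod (matrix_unit N) p"
    have e: "e \<in> C" using p unit_in_C by (auto simp: e_def pos_def)
    have "e = msum N N F (\<pi> e)"
      using Fp(3)[OF p] p by (intro proj_sum_superset e F) (auto simp: F_def e_def)
    then have "a * e = a * msum N N F (\<pi> e)" by simp
    also have "\<dots> = msum N N F (\<lambda>h. a * \<pi> e h)"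
      using F e aC C_carrier proj_carrier by (intro mult_msum) auto
    finally have "(a * e) $$ p = msum N N F (\<lambda>h. a * \<pi> e h) $$ p" by simp
    then show "(case p of (i, j) \<Rightarrow> (a * matrix_unit N i j) $$ (i, j)) =
        (\<Sum>h\<in>F. (a * \<pi> (case_prod (matrix_unit N) p) h) $$ p)"
      using p by (auto simp: e_def pos_def simp del: index_mult_mat(1))
  qed
  also have "\<dots> = (\<Sum>h\<in>F. op_trace (\<lambda>x. a * \<pi> x h))"
    unfolding op_trace_def by (subst sum.swap) (simp add: case_prod_beta)
  also have "\<dots> = 0"
  proof (intro sum.neutral ballI)
    fix h assume "h \<in> F"
    then have h: "h \<in> carrier G" using F by auto
    \<comment> \<open>Projections are idempotent, so by cyclicity one copy can be moved in front;
      there it meets elements of degree \<open>g \<otimes> h \<noteq> h\<close> and gives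
      zero.\<close>
    have "op_trace (\<lambda>x. a * \<pi> x h) = op_trace (\<lambda>x. a * \<pi> (\<pi> x h) h)"
      unfolding op_trace_def using h unit_in_C
      by (intro sum.cong) (auto simp: pos_def proj_homogeneous[OF h proj_in[OF _ h] h])
    also have "\<dots> = op_trace (\<lambda>x. \<pi> (a * \<pi> x h) h)"
      using linear_comp[OF linear_mult[OF aC] linear_proj[OF h]]
      by (rule op_trace_comm[OF _ linear_proj[OF h]])
    also have "\<dots> = 0"
      unfolding op_trace_def
    proof (intro sum.neutral ballI)
      fix p assume p: "p \<in> pos"
      define e :: "'k mat" where "e = case_prod (matrix_unit N) p"
      have e: "e \<in> C" using p unit_in_C by (auto simp: e_def pos_def)
      have "a * \<pi> e h \<in> A (g \<otimes> h)" using A_mult g(1) h a proj_in[OF e h] by blast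
      moreover have "g \<otimes> h \<noteq> h" using g h by simp
      ultimately have "\<pi> (a * \<pi> e h) h = 0\<^sub>m N N"
        using proj_homogeneous[of "g \<otimes> h" "a * \<pi> e h" h] g(1) h by simp
      then show "(case p of (i, j) \<Rightarrow> \<pi> (a * \<pi> (matrix_unit N i j) h) h $$ (i, j)) = 0"
        using p by (auto simp: e_def pos_def)
    qed
    finally show "op_trace (\<lambda>x. a * \<pi> x h) = 0" .
  qed
  finally show ?thesis using \<tau>_op_trace[OF aC] by simp
qed

lemma \<tau>_msum: "finite F \<Longrightarrow> \<tau> (msum N N F a) = (\<Sum>x\<in>F. \<tau> (a x))"
  by (simp add: \<tau>_def sum_distrib_left sum.swap[of _ F])

section \<open>Homogeneity of transporters between graded subspaces\<close>

lemma proj_mult_left: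
  assumes "h \<in> carrier G" "a \<in> A h" "x \<in> C" "g \<in> carrier G"
  shows "\<pi> (a * x) (h \<otimes> g) = a * \<pi> x g"
proof -
  have "a \<in> C" using S_in_C assms by blast
  then show ?thesis
    using assms C_carrier pattern_mult
    by (intro proj_map[where C = C and C' = C and f = "\<lambda>x. a * x" and \<sigma> = "\<lambda>g. h \<otimes> g"])
       (auto intro: graded_mats_axioms A_mult
         simp: inj_on_def mult_add_distrib_mat[of _ N N _ N] right_mult_zero_mat[of _ N N])
qed

lemma proj_mult_right:
  assumes "h \<in> carrier G" "a \<in> A h" "x \<in> C" "g \<in> carrier G"
  shows "\<pi> (x * a) (g \<otimes> h) = \<pi> x g * a"
proof -
  have "a \<in> C" using S_in_C assms by blast
  then show ?thesis
    using assms C_carrier pattern_mult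
    by (intro proj_map[where C = C and C' = C and f = "\<lambda>x. x * a" and \<sigma> = "\<lambda>g. g \<otimes> h"])
       (auto intro: graded_mats_axioms A_mult
         simp: inj_on_def add_mult_distrib_mat[of _ N N _ _ N] left_mult_zero_mat[of _ N N])
qed

text \<open>Since \<open>D\<close> is graded, \<open>y * \<pi> x g\<close> is a sum of products
  \<open>\<pi> y h * \<pi> x g\<close>, and each of these is a component of
  \<open>\<pi> y h * x \<in> T\<close>.\<close>

lemma left_transporter_graded:
  assumes D: "graded_subset D" and T: "graded_subset T"
  shows "graded_subset {x \<in> C. \<forall>y\<in>D. y * x \<in> T}"
proof -
  have DC: "y \<in> C" if "y \<in> D" for y using that D by (auto simp: graded_subset_def)
  have TS: "mat_subspace N N T" using T by (simp add: graded_subset_def)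
  have "\<pi> x g \<in> {x \<in> C. \<forall>y\<in>D. y * x \<in> T}" if x: "x \<in> C" "\<forall>y\<in>D. y * x \<in> T" and g: "g \<in> carrier G" for x g
  proof (safe intro!: proj_in_C x g)
    fix y assume y: "y \<in> D"
    obtain F where F: "finite F" "F \<subseteq> carrier G" "y = msum N N F (\<pi> y)"
      by (rule proj_sum[OF DC[OF y]], rule that)
    have c: "\<pi> y h \<in> carrier_mat N N" if "h \<in> F" for h using proj_carrier DC y F that by blast
    have "y * \<pi> x g = msum N N F (\<pi> y) * \<pi> x g" using F(3) by simp
    also have "\<dots> = msum N N F (\<lambda>h. \<pi> y h * \<pi> x g)"
      using F c proj_carrier x g by (intro msum_mult) auto
    also have "\<dots> \<in> T"
    proof (rule mat_subspace_msum[OF TS F(1)])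
      fix h assume "h \<in> F"
      then have h: "h \<in> carrier G" using F by auto
      then have "\<pi> y h * x \<in> T" using D y x by (auto simp: graded_subset_def)
      then have "\<pi> (\<pi> y h * x) (h \<otimes> g) \<in> T" using T h g by (auto simp: graded_subset_def)
      then show "\<pi> y h * \<pi> x g \<in> T"
        using proj_mult_left[OF h proj_in[OF DC[OF y] h] x(1) g] by simp
    qed
    finally show "y * \<pi> x g \<in> T" .
  qed
  moreover have "mat_subspace N N {x \<in> C. \<forall>y\<in>D. y * x \<in> T}"
    using mat_subspaceD[OF whole] mat_subspaceD[OF TS] DC C_carrier
    by (intro mat_subspaceI)
       (auto simp: mult_add_distrib_mat[of _ N N _ N] mult_smult_distrib[of _ N N _ N]
         right_mult_zero_mat[of _ N N])
  ultimately show ?thesis by (auto simp: graded_subset_def)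
qed

lemma right_transporter_graded:
  assumes D: "graded_subset D" and T: "graded_subset T"
  shows "graded_subset {x \<in> C. \<forall>y\<in>D. x * y \<in> T}"
proof -
  have DC: "y \<in> C" if "y \<in> D" for y using that D by (auto simp: graded_subset_def)
  have TS: "mat_subspace N N T" using T by (simp add: graded_subset_def)
  have "\<pi> x g \<in> {x \<in> C. \<forall>y\<in>D. x * y \<in> T}" if x: "x \<in> C" "\<forall>y\<in>D. x * y \<in> T" and g: "g \<in> carrier G" for x g
  proof (safe intro!: proj_in_C x g)
    fix y assume y: "y \<in> D"
    obtain F where F: "finite F" "F \<subseteq> carrier G" "y = msum N N F (\<pi> y)"
      by (rule proj_sum[OF DC[OF y]], rule that)
    have c: "\<pi> y h \<in> carrier_mat N N" if "h \<in> F" for h using proj_carrier DC y F that by blast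
    have "\<pi> x g * y = \<pi> x g * msum N N F (\<pi> y)" using F(3) by simp
    also have "\<dots> = msum N N F (\<lambda>h. \<pi> x g * \<pi> y h)"
      using F c proj_carrier x g by (intro mult_msum) auto
    also have "\<dots> \<in> T"
    proof (rule mat_subspace_msum[OF TS F(1)])
      fix h assume "h \<in> F"
      then have h: "h \<in> carrier G" using F by auto
      then have "x * \<pi> y h \<in> T" using D y x by (auto simp: graded_subset_def)
      then have "\<pi> (x * \<pi> y h) (g \<otimes> h) \<in> T" using T h g by (auto simp: graded_subset_def)
      then show "\<pi> x g * \<pi> y h \<in> T"
        using proj_mult_right[OF h proj_in[OF DC[OF y] h] x(1) g] by simp
    qed
    finally show "\<pi> x g * y \<in> T" .
  qed
  moreover have "mat_subspace N N {x \<in> C. \<forall>y\<in>D. x * y \<in> T}"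
    using mat_subspaceD[OF whole] mat_subspaceD[OF TS] DC C_carrier
    by (intro mat_subspaceI)
       (auto simp: add_mult_distrib_mat[of _ N N _ _ N] mult_smult_assoc_mat[of _ N N _ N]
         left_mult_zero_mat[of _ N N])
  ultimately show ?thesis by (auto simp: graded_subset_def)
qed

lemma zero_graded: "graded_subset {0\<^sub>m N N}"
  using mat_subspaceD(2)[OF whole] proj_zero
  by (auto simp: graded_subset_def mat_subspace_def)

text \<open>The strict part of the preorder: for block shapes these are the entries strictly above
  the diagonal blocks, hence the Jacobson radical.\<close>

definition radical :: "'k mat set" where
  "radical = pattern_mat N N (\<lambda>i j. R i j \<and> \<not> R j i)"

text \<open>An element of the strict part times any \<open>b\<close> has zero diagonal. Conversely
  the matrix unit at \<open>(j, i)\<close> isolates \<open>a $$ (i, j)\<close>, multiplied by the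
  weight of row \<open>i\<close>; this weight is positive by reflexivity and so nonzero in
  characteristic zero.\<close>

lemma radical_trace_form: "radical = {a \<in> C. \<forall>b\<in>C. \<tau> (a * b) = 0}"
proof (rule Set.set_eqI, rule iffI)
  fix a assume a: "a \<in> radical"
  have aC: "a \<in> C" using a by (auto simp: radical_def pattern_mat_def)
  have "\<tau> (a * b) = 0" if b: "b \<in> C" for b
    unfolding \<tau>_def
  proof (intro sum.neutral ballI)
    fix i assume i: "i \<in> {..<N}"
    have "(a * b) $$ (i, i) = (\<Sum>k<N. a $$ (i, k) * b $$ (k, i))"
      using aC b C_carrier i by (intro times_mat_index) auto
    also have "\<dots> = 0"
      using a b i by (intro sum.neutral) (auto simp: radical_def pattern_mat_def)
    finally show "of_nat (trace_weight N R i) * (a * b) $$ (i, i) = 0" by simp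
  qed
  then show "a \<in> {a \<in> C. \<forall>b\<in>C. \<tau> (a * b) = 0}" using aC by simp
next
  fix a assume "a \<in> {a \<in> C. \<forall>b\<in>C. \<tau> (a * b) = 0}"
  then have a: "a \<in> C" "\<And>b. b \<in> C \<Longrightarrow> \<tau> (a * b) = 0" by auto
  show "a \<in> radical" unfolding radical_def
  proof (rule pattern_matI)
    fix i j assume ij: "i < N" "j < N" "\<not> (R i j \<and> \<not> R j i)"
    show "a $$ (i, j) = 0"
    proof (cases "R i j")
      case True
      then have "\<tau> (a * matrix_unit N j i) = 0" using ij a unit_in_C by blast
      moreover have "\<tau> (a * matrix_unit N j i) =
          (\<Sum>k<N. if k = i then of_nat (trace_weight N R i) * a $$ (i, j) else 0)"
        unfolding \<tau>_def using ij mult_matrix_unit_index[OF C_carrier[OF a(1)], of j i]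
        by (intro sum.cong) auto
      moreover have "trace_weight N R i > 0"
        unfolding trace_weight_def using ij R_refl by (subst card_gt_0_iff) auto
      ultimately show ?thesis using ij by simp
    qed (use ij a pattern_matD(2) in blast)
  qed (use a C_carrier in auto)
qed

text \<open>Under the trace form a homogeneous \<open>y\<close> of degree inverse to
  \<open>g\<close> sees only the component of \<open>a\<close> in degree \<open>g\<close>, because
  traces in nontrivial degrees vanish. So each component is orthogonal to the whole algebra if
  \<open>a\<close> is.\<close>

lemma radical_graded: "graded_subset radical"
proof -
  have "\<pi> a g \<in> radical" if a: "a \<in> radical" and g: "g \<in> carrier G" for a g
  proof -
    have aC: "a \<in> C" using a radical_trace_form by auto
    obtain E where E: "finite E" "E \<subseteq> carrier G" "a = msum N N E (\<pi> a)" "\<And>g. g \<notin> E \<Longrightarrow> \<pi> a g = 0\<^sub>m N N"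
      using proj_sum[OF aC] by blast
    \<comment> \<open>\<open>g\<close> is added because its component may be zero and
      \<open>g\<close> absent from \<open>E\<close>; the sum below singles out the term at
      \<open>g\<close>.\<close>
    define E' where "E' = insert g E"
    have E': "finite E'" "E' \<subseteq> carrier G" "g \<in> E'" using E g by (auto simp: E'_def)
    have aE': "a = msum N N E' (\<pi> a)"
      using E by (intro proj_sum_superset aC) (auto simp: E'_def)
    have hom: "\<tau> (\<pi> a g * y) = 0" if h: "h \<in> carrier G" and y: "y \<in> A h" for h y
    proof (cases "g \<otimes> h = \<one>")
      case True
      have yC: "y \<in> C" using S_in_C h y by blast
      have "a * y = msum N N E' (\<pi> a) * y" using aE' by simp
      also have "\<dots> = msum N N E' (\<lambda>k. \<pi> a k * y)"
        using E' aC yC C_carrier proj_carrier by (intro msum_mult) auto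
      finally have "\<tau> (a * y) = (\<Sum>k\<in>E'. \<tau> (\<pi> a k * y))" using E' by (simp add: \<tau>_msum)
      also have "\<dots> = (\<Sum>k\<in>E'. if k = g then \<tau> (\<pi> a g * y) else 0)"
      proof (intro sum.cong refl)
        fix k assume "k \<in> E'"
        then have k: "k \<in> carrier G" using E' by auto
        have "\<tau> (\<pi> a k * y) = 0" if "k \<noteq> g"
        proof -
          have "k \<otimes> h \<noteq> \<one>" using that True k g h by (metis r_cancel)
          then show ?thesis
            using \<tau>_homogeneous_zero[OF _ _ A_mult[OF k h proj_in[OF aC k] y]] k h by auto
        qed
        then show "\<tau> (\<pi> a k * y) = (if k = g then \<tau> (\<pi> a g * y) else 0)" by simp
      qed
      also have "\<dots> = \<tau> (\<pi> a g * y)" using E' by simp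
      finally show ?thesis using a yC radical_trace_form by auto
    next
      case False
      then show ?thesis
        using \<tau>_homogeneous_zero[OF _ _ A_mult[OF g h proj_in[OF aC g] y]] g h by auto
    qed
    have "\<tau> (\<pi> a g * b) = 0" if b: "b \<in> C" for b
    proof -
      obtain F where F: "finite F" "F \<subseteq> carrier G" "b = msum N N F (\<pi> b)"
        by (rule proj_sum[OF b], rule that)
      have "\<pi> a g * b = \<pi> a g * msum N N F (\<pi> b)" using F(3) by simp
      also have "\<dots> = msum N N F (\<lambda>h. \<pi> a g * \<pi> b h)"
        using F aC b g proj_carrier by (intro mult_msum) auto
      finally have "\<tau> (\<pi> a g * b) = (\<Sum>h\<in>F. \<tau> (\<pi> a g * \<pi> b h))" using F by (simp add: \<tau>_msum)
      also have "\<dots> = 0" using F hom proj_in[OF b] by (intro sum.neutral) auto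
      finally show ?thesis .
    qed
    then show ?thesis using radical_trace_form proj_in_C[OF aC g] by auto
  qed
  then show ?thesis
    unfolding graded_subset_def using radical_trace_form mat_subspace_pattern[of N N]
    by (metis (no_types, lifting) mem_Collect_eq radical_def subsetI)
qed

end

section \<open>Graded block-triangular algebras\<close>

text \<open>Block order phrased by the boundaries \<open>s k\<close> instead of block numbers: it
  says that the standard flag is invariant under the matrix, and it makes reflexivity and
  transitivity immediate.\<close>

definition flag_rel :: "nat \<Rightarrow> (nat \<Rightarrow> nat) \<Rightarrow> nat \<Rightarrow> nat \<Rightarrow> bool" where
  "flag_rel m s i j \<longleftrightarrow> (\<forall>k\<le>m. j < s k \<longrightarrow> i < s k)"

locale graded_flag_alg = graded_incidence_alg G N "flag_rel m s" A
  for G :: "('g, 'c) monoid_scheme" (structure) and N m :: nat and s :: "nat \<Rightarrow> nat"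
    and A :: "'g \<Rightarrow> 'k :: field_char_0 mat set" +
  assumes m_pos: "0 < m" and s_0: "s 0 = 0" and s_m: "s m = N"
    and s_less: "k < m \<Longrightarrow> s k < s (Suc k)"
begin

lemma s_mono: "k \<le> l \<Longrightarrow> l \<le> m \<Longrightarrow> s k \<le> s l"
proof (induction l)
  case (Suc l)
  then show ?case using s_less[of l] by (cases "k = Suc l") auto
qed simp

lemma s_le_N: "k \<le> m \<Longrightarrow> s k \<le> N"
  using s_mono[of k m] s_m by simp

lemma s_last: "s (m - 1) < N"
  using s_less[of "m - 1"] m_pos s_m by simp

lemma s_less_imp: "s k < s l \<Longrightarrow> k \<le> m \<Longrightarrow> k < l"
  using s_mono[of l k] by (rule_tac ccontr) simp

lemma flag_rel_last: "i < N \<Longrightarrow> s (m - 1) \<le> j \<Longrightarrow> flag_rel m s i j"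
  unfolding flag_rel_def
proof (intro allI impI)
  fix k assume *: "i < N" "s (m - 1) \<le> j" "k \<le> m" "j < s k"
  then have "m - 1 < k" by (rule_tac s_less_imp) auto
  then have "k = m" using * by simp
  then show "i < s k" using * s_m by simp
qed

section \<open>The last block column as an annihilator of the radical\<close>

definition last_col :: "'k mat set" where
  "last_col = pattern_mat N N (\<lambda>i j. s (m - 1) \<le> j)"

lemma last_col_subset: "last_col \<subseteq> C"
  using flag_rel_last by (auto simp: last_col_def pattern_mat_def)

text \<open>Rows of radical elements in the last block are zero, which gives one inclusion. For the
  other, a column \<open>j\<close> left of the last block is detected by the matrix unit at
  \<open>(j, N - 1)\<close>, which lies in the radical.\<close>

lemma last_col_transporter: "last_col = {x \<in> C. \<forall>y\<in>radical. x * y \<in> {0\<^sub>m N N}}"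
proof (rule Set.set_eqI, rule iffI)
  fix x assume x: "x \<in> last_col"
  have xC: "x \<in> C" using x last_col_subset by auto
  have "x * y = 0\<^sub>m N N" if y: "y \<in> radical" for y
  proof (rule eq_matI)
    fix i j assume "i < dim_row (0\<^sub>m N N :: 'k mat)" "j < dim_col (0\<^sub>m N N :: 'k mat)"
    then have ij: "i < N" "j < N" by auto
    have "(x * y) $$ (i, j) = (\<Sum>k<N. x $$ (i, k) * y $$ (k, j))"
      using pattern_matD(1) x y ij unfolding last_col_def radical_def by (intro times_mat_index) auto
    also have "\<dots> = 0"
    proof (intro sum.neutral ballI)
      fix k assume k: "k \<in> {..<N}"
      show "x $$ (i, k) * y $$ (k, j) = 0"
      proof (cases "s (m - 1) \<le> k")
        case True
        then have "flag_rel m s j k" using ij flag_rel_last by blast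
        then show ?thesis using y k ij by (auto simp: radical_def pattern_mat_def)
      qed (use x k ij in \<open>auto simp: last_col_def pattern_mat_def\<close>)
    qed
    finally show "(x * y) $$ (i, j) = 0\<^sub>m N N $$ (i, j)" using ij by simp
  qed (use xC y radical_trace_form C_carrier[of x] C_carrier[of y] in auto)
  then show "x \<in> {x \<in> C. \<forall>y\<in>radical. x * y \<in> {0\<^sub>m N N}}" using xC by simp
next
  fix x assume "x \<in> {x \<in> C. \<forall>y\<in>radical. x * y \<in> {0\<^sub>m N N}}"
  then have x: "x \<in> C" "\<And>y. y \<in> radical \<Longrightarrow> x * y = 0\<^sub>m N N" by auto
  show "x \<in> last_col" unfolding last_col_def
  proof (rule pattern_matI)
    fix i j assume ij: "i < N" "j < N" "\<not> s (m - 1) \<le> j"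
    have "flag_rel m s j (N - 1)"
      using ij s_last by (intro flag_rel_last) auto
    moreover have "\<not> flag_rel m s (N - 1) j"
      using ij s_last unfolding flag_rel_def by (auto intro!: exI[of _ "m - 1"])
    ultimately have "matrix_unit N j (N - 1) \<in> radical"
      unfolding radical_def by (intro pattern_matI) auto
    then have "(x * matrix_unit N j (N - 1)) $$ (i, N - 1) = 0" using x(2) ij by simp
    then show "x $$ (i, j) = 0"
      using ij mult_matrix_unit_index[OF C_carrier[OF x(1)], of j "N - 1" i "N - 1"] by simp
  qed (use x C_carrier in auto)
qed

lemma last_col_graded: "graded_subset last_col"
  unfolding last_col_transporter by (rule right_transporter_graded[OF radical_graded zero_graded])

section \<open>The ideals of upper block rows\<close>

definition top_rows :: "nat \<Rightarrow> 'k mat set" where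
  "top_rows k = pattern_mat N N (\<lambda>i j. flag_rel m s i j \<and> i < s k)"

lemma top_rows_subset: "top_rows k \<subseteq> C"
  by (auto simp: top_rows_def pattern_mat_def)

text \<open>This is the left socle series: the radical moves block rows strictly upwards. Conversely
  a row \<open>i \<ge> s (Suc k)\<close> is tested by the radical unit that moves it to row
  \<open>s k\<close>, the first row that must vanish in \<open>top_rows k\<close>.\<close>

lemma top_rows_Suc:
  assumes k: "k < m"
  shows "top_rows (Suc k) = {x \<in> C. \<forall>y\<in>radical. y * x \<in> top_rows k}"
proof (rule Set.set_eqI, rule iffI)
  fix x assume x: "x \<in> top_rows (Suc k)"
  have xC: "x \<in> C" using x top_rows_subset by auto
  have "y * x \<in> top_rows k" if y: "y \<in> radical" for y
    unfolding top_rows_def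
  proof (rule pattern_matI)
    have yC: "y \<in> C" using y radical_trace_form by auto
    then have yx: "y * x \<in> C" using xC pattern_mult by blast
    then show "y * x \<in> carrier_mat N N" by (rule C_carrier)
    fix i j assume ij: "i < N" "j < N" "\<not> (flag_rel m s i j \<and> i < s k)"
    show "(y * x) $$ (i, j) = 0"
    proof (cases "flag_rel m s i j")
      case True
      then have i: "s k \<le> i" using ij by simp
      have "(y * x) $$ (i, j) = (\<Sum>l<N. y $$ (i, l) * x $$ (l, j))"
        using xC yC C_carrier ij by (intro times_mat_index) auto
      also have "\<dots> = 0"
      proof (intro sum.neutral ballI)
        fix l assume l: "l \<in> {..<N}"
        show "y $$ (i, l) * x $$ (l, j) = 0"
        proof (cases "flag_rel m s l i")
          case True
          then show ?thesis using y l ij by (auto simp: radical_def pattern_mat_def)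
        next
          \<comment> \<open>Now \<open>l\<close> lies in a strictly later block than
            \<open>i\<close>, hence beyond \<open>s (Suc k)\<close>, where \<open>x\<close> has only
            zero rows.\<close>
          case False
          then obtain k' where k': "k' \<le> m" "i < s k'" "s k' \<le> l"
            unfolding flag_rel_def by (auto simp: not_less)
          then have "k < k'" using i k by (rule_tac s_less_imp) auto
          then have "s (Suc k) \<le> l" using k' s_mono[of "Suc k" k'] by auto
          then show ?thesis using x l ij by (auto simp: top_rows_def pattern_mat_def)
        qed
      qed
      finally show ?thesis .
    qed (use yx ij pattern_matD(2) in blast)
  qed
  then show "x \<in> {x \<in> C. \<forall>y\<in>radical. y * x \<in> top_rows k}" using xC by simp
next
  fix x assume "x \<in> {x \<in> C. \<forall>y\<in>radical. y * x \<in> top_rows k}"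
  then have x: "x \<in> C" "\<And>y. y \<in> radical \<Longrightarrow> y * x \<in> top_rows k" by auto
  show "x \<in> top_rows (Suc k)" unfolding top_rows_def
  proof (rule pattern_matI)
    fix i j assume ij: "i < N" "j < N" "\<not> (flag_rel m s i j \<and> i < s (Suc k))"
    show "x $$ (i, j) = 0"
    proof (cases "flag_rel m s i j")
      case True
      then have i: "s (Suc k) \<le> i" using ij by simp
      have sk: "s k < s (Suc k)" using s_less k by blast
      have "flag_rel m s (s k) i" using i sk unfolding flag_rel_def by auto
      moreover have "\<not> flag_rel m s i (s k)"
        using i sk k unfolding flag_rel_def by (auto intro!: exI[of _ "Suc k"])
      ultimately have "matrix_unit N (s k) i \<in> radical"
        unfolding radical_def by (intro pattern_matI) auto
      then have "(matrix_unit N (s k) i * x) $$ (s k, j) = 0"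
        using x(2) ij sk i pattern_matD(2)[of "matrix_unit N (s k) i * x"] unfolding top_rows_def by fastforce
      then show ?thesis
        using ij sk i matrix_unit_mult_index[OF C_carrier[OF x(1)], of "s k" i "s k" j] by simp
    qed (use x ij pattern_matD(2) in blast)
  qed (use x C_carrier in auto)
qed

lemma top_rows_graded: "k \<le> m \<Longrightarrow> graded_subset (top_rows k)"
proof (induction k)
  case 0
  have "top_rows 0 = {0\<^sub>m N N}"
    by (auto simp: top_rows_def pattern_mat_def s_0 intro!: eq_matI)
  then show ?case using zero_graded by simp
next
  case (Suc k)
  then show ?case
    using left_transporter_graded[OF radical_graded] by (simp add: top_rows_Suc)
qed

section \<open>Trace and nilpotency in the last block column\<close>

lemma last_col_left_ideal:
  assumes "x \<in> carrier_mat N N" "y \<in> last_col"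
  shows "x * y \<in> last_col"
  unfolding last_col_def
proof (rule pattern_matI)
  fix i j assume ij: "i < N" "j < N" "\<not> s (m - 1) \<le> j"
  have "(x * y) $$ (i, j) = (\<Sum>k<N. x $$ (i, k) * y $$ (k, j))"
    using assms ij by (intro times_mat_index) (auto simp: last_col_def pattern_mat_def)
  also have "\<dots> = 0"
    using assms ij by (intro sum.neutral) (auto simp: last_col_def pattern_mat_def)
  finally show "(x * y) $$ (i, j) = 0" .
qed (use assms in \<open>auto simp: last_col_def pattern_mat_def\<close>)

lemma last_col_right_ideal:
  assumes "x \<in> last_col" "y \<in> C"
  shows "x * y \<in> last_col"
  unfolding last_col_def
proof (rule pattern_matI)
  fix i j assume ij: "i < N" "j < N" "\<not> s (m - 1) \<le> j"
  have "(x * y) $$ (i, j) = (\<Sum>k<N. x $$ (i, k) * y $$ (k, j))"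
    using assms ij C_carrier[OF assms(2)] by (intro times_mat_index) (auto simp: last_col_def pattern_mat_def)
  also have "\<dots> = 0"
  proof (intro sum.neutral ballI)
    fix k assume k: "k \<in> {..<N}"
    show "x $$ (i, k) * y $$ (k, j) = 0"
    proof (cases "s (m - 1) \<le> k")
      case True
      then have "\<not> flag_rel m s k j"
        using ij unfolding flag_rel_def by (auto intro!: exI[of _ "m - 1"])
      then show ?thesis using assms ij k pattern_matD(2)[OF assms(2), of k j] by simp
    qed (use assms ij k in \<open>auto simp: last_col_def pattern_mat_def\<close>)
  qed
  finally show "(x * y) $$ (i, j) = 0" .
qed (use assms C_carrier[of y] in \<open>auto simp: last_col_def pattern_mat_def\<close>)

text \<open>Diagonal entries outside the last block are zero, and a row of the last block admits
  exactly the columns of that block, so all relevant weights equal its width. The ordinary trace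
  thus inherits the vanishing in nontrivial degrees.\<close>

lemma \<tau>_last_col:
  assumes "x \<in> last_col"
  shows "\<tau> x = of_nat (N - s (m - 1)) * mtrace x"
proof -
  have d: "dim_row x = N" using assms by (auto simp: last_col_def pattern_mat_def)
  have "of_nat (trace_weight N (flag_rel m s) i) * x $$ (i, i) = of_nat (N - s (m - 1)) * x $$ (i, i)"
    if i: "i < N" for i
  proof (cases "s (m - 1) \<le> i")
    case True
    have "{j. j < N \<and> flag_rel m s i j} = {s (m - 1)..<N}"
    proof (rule Set.set_eqI, rule iffI)
      fix j assume j: "j \<in> {j. j < N \<and> flag_rel m s i j}"
      then have "\<not> j < s (m - 1)" using True by (auto simp: flag_rel_def dest: spec[of _ "m - 1"])
      then show "j \<in> {s (m - 1)..<N}" using j by simp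
    qed (use flag_rel_last i in auto)
    then show ?thesis by (simp add: trace_weight_def)
  next
    case False
    then show ?thesis using assms i by (auto simp: last_col_def pattern_mat_def)
  qed
  then show ?thesis unfolding \<tau>_def mtrace_def d sum_distrib_left by (intro sum.cong) auto
qed

lemma mtrace_homogeneous_zero:
  assumes "x \<in> last_col" "g \<in> carrier G" "x \<in> A g" "g \<noteq> \<one>"
  shows "mtrace x = 0"
  using \<tau>_homogeneous_zero[OF assms(2,4,3)] \<tau>_last_col[OF assms(1)] s_last by auto

definition nonnil_unit_part :: "'k mat set" where
  "nonnil_unit_part = {z \<in> last_col \<inter> A \<one>. \<forall>k. z ^\<^sub>m k \<noteq> 0\<^sub>m N N}"

lemma nonnil_unit_partI:
  assumes "x \<in> last_col" "x \<in> A \<one>" "mtrace x \<noteq> 0"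
  shows "x \<in> nonnil_unit_part"
  using assms mtrace_nilpotent[of x N] by (auto simp: nonnil_unit_part_def last_col_def pattern_mat_def)

text \<open>Components of nontrivial degree have trace zero, so the trace 1 of the corner matrix
  unit is carried by its component of degree one, which therefore cannot be nilpotent.\<close>

lemma nonnil_unit_part_nonempty: "\<exists>z. z \<in> nonnil_unit_part"
proof -
  define e :: "'k mat" where "e = matrix_unit N (N - 1) (N - 1)"
  have eL: "e \<in> last_col"
    using s_last by (auto simp: e_def last_col_def pattern_mat_def)
  then have eC: "e \<in> C" using last_col_subset by auto
  have "mtrace e = (\<Sum>i<N. if i = N - 1 then 1 else 0)"
    unfolding mtrace_def using s_last by (intro sum.cong) (auto simp: e_def matrix_unit_def)
  then have e1: "mtrace e = 1" using s_last by simp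
  obtain F where F: "finite F" "F \<subseteq> carrier G" "e = msum N N F (\<pi> e)"
    by (rule proj_sum[OF eC], rule that)
  have \<pi>L: "\<pi> e g \<in> last_col" if "g \<in> carrier G" for g
    using last_col_graded eL that by (auto simp: graded_subset_def)
  then have dims: "dim_row (\<pi> e g) = N" if "g \<in> carrier G" for g
    using that by (auto simp: last_col_def pattern_mat_def)
  have "mtrace e = mtrace (msum N N F (\<pi> e))" using F(3) by simp
  also have "\<dots> = (\<Sum>g\<in>F. mtrace (\<pi> e g))"
    unfolding mtrace_msum using F dims by (intro sum.cong) (auto simp: mtrace_def)
  finally have "(\<Sum>g\<in>F. mtrace (\<pi> e g)) \<noteq> 0" using e1 by simp
  then obtain g where g: "g \<in> F" "mtrace (\<pi> e g) \<noteq> 0" by (meson sum.neutral)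
  then have "g = \<one>" using mtrace_homogeneous_zero[OF \<pi>L] proj_in[OF eC] F by blast
  then have "\<pi> e \<one> \<in> nonnil_unit_part"
    using g \<pi>L proj_in[OF eC] by (intro nonnil_unit_partI) auto
  then show ?thesis ..
qed

lemma nonnil_unit_part_square:
  assumes z: "z \<in> nonnil_unit_part"
  shows "z * z \<in> nonnil_unit_part"
proof -
  have zL: "z \<in> last_col" "z \<in> A \<one>" and nn: "\<And>k. z ^\<^sub>m k \<noteq> 0\<^sub>m N N"
    using z by (auto simp: nonnil_unit_part_def)
  have zc: "z \<in> carrier_mat N N" using zL by (auto simp: last_col_def pattern_mat_def)
  have "(z * z) ^\<^sub>m k = z ^\<^sub>m (2 * k)" for k
  proof (induction k)
    case (Suc k)
    then show ?case
      using zc assoc_mult_mat[OF pow_carrier_mat[OF zc] zc zc] by simp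
  qed (use zc in auto)
  then show ?thesis
    using nn last_col_left_ideal[OF zc zL(1)] A_mult[OF one_closed one_closed zL(2,2)]
    by (auto simp: nonnil_unit_part_def)
qed

end

text \<open>A homogeneous element \<open>Q P\<close> of degree one whose rank \<open>t\<close> is minimal among the non-nilpotent ones
  in the last block column.\<close>

locale graded_frame = graded_flag_alg G N m s A
  for G :: "('g, 'c) monoid_scheme" (structure) and N m :: nat and s :: "nat \<Rightarrow> nat"
    and A :: "'g \<Rightarrow> 'k :: field_char_0 mat set" +
  fixes t :: nat and Q P :: "'k mat"
  assumes Q: "Q \<in> carrier_mat N t" and P: "P \<in> carrier_mat t N"
    and QP: "Q * P \<in> nonnil_unit_part"
    and minimal: "E \<in> carrier_mat N r \<Longrightarrow> F \<in> carrier_mat r N \<Longrightarrow> r < t \<Longrightarrow> E * F \<notin> nonnil_unit_part"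

text \<open>Rank enters as the inner dimension of a factorization, so its minimum is a least natural
  number; the factorization of \<open>z\<close> through the identity shows that some value is
  attained.\<close>

lemma (in graded_flag_alg) frame_exists: "\<exists>t Q P. graded_frame G N m s A t Q P"
proof -
  let ?pr = "\<lambda>r. \<exists>E F. E \<in> carrier_mat N r \<and> F \<in> carrier_mat r N \<and> E * F \<in> nonnil_unit_part"
  obtain z where z: "z \<in> nonnil_unit_part" using nonnil_unit_part_nonempty by blast
  then have "z \<in> carrier_mat N N" by (auto simp: nonnil_unit_part_def last_col_def pattern_mat_def)
  then have "?pr N" using z by (intro exI[of _ z] exI[of _ "1\<^sub>m N"]) auto
  then obtain t where t: "?pr t" "\<And>r. r < t \<Longrightarrow> \<not> ?pr r"
    using exists_least_iff[of ?pr] by auto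
  then obtain Q P where "Q \<in> carrier_mat N t" "P \<in> carrier_mat t N" "Q * P \<in> nonnil_unit_part"
    by blast
  then have "graded_frame G N m s A t Q P" using t(2) by unfold_locales auto
  then show ?thesis by blast
qed

context graded_frame
begin

lemma QP_last_col: "Q * P \<in> last_col" and QP_one: "Q * P \<in> A \<one>" and QP_C: "Q * P \<in> C"
  using QP last_col_subset by (auto simp: nonnil_unit_part_def)

lemma dims [simp]: "dim_row Q = N" "dim_col Q = t" "dim_row P = t" "dim_col P = N"
  using Q P by auto

lemma A_dims: "g \<in> carrier G \<Longrightarrow> a \<in> A g \<Longrightarrow> dim_row a = N \<and> dim_col a = N"
  using S_carrier by blast

lemma t_pos: "0 < t"
proof (rule ccontr)
  assume "\<not> 0 < t"
  then have "Q * P = 0\<^sub>m N N" using Q P by (intro eq_matI) (auto simp: scalar_prod_def)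
  then have "(Q * P) ^\<^sub>m 1 = 0\<^sub>m N N" by simp
  then show False using QP unfolding nonnil_unit_part_def by blast
qed

text \<open>A singular \<open>x\<close> factors through a smaller dimension, and then so does
  \<open>Q * x * y\<close>, against minimality. In this form minimal rank yields inverses.\<close>

lemma minimal_invertible:
  assumes x: "x \<in> carrier_mat t t" and y: "y \<in> carrier_mat t N" and w: "Q * x * y \<in> nonnil_unit_part"
  shows "det x \<noteq> 0"
proof
  assume "det x = 0"
  obtain n where n: "t = Suc n" using t_pos by (cases t) auto
  obtain E F where EF: "E \<in> carrier_mat t n" "F \<in> carrier_mat n t" "x = E * F"
    using singular_factorization \<open>det x = 0\<close> x n by blast
  have "Q * x * y = Q * E * (F * y)"
    using EF y by (simp add: mult_assoc_dim)
  then show False using minimal[of "Q * E" n "F * y"] EF y Q w n by auto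
qed

text \<open>The square of \<open>Q * P\<close> is again non-nilpotent and has \<open>P * Q\<close>
  in its middle.\<close>

lemma PQ_invertible: "det (P * Q) \<noteq> 0"
proof (rule minimal_invertible[of _ P])
  have "Q * (P * Q) * P = Q * P * (Q * P)" by (simp add: mult_assoc_dim)
  then show "Q * (P * Q) * P \<in> nonnil_unit_part" using nonnil_unit_part_square[OF QP] by simp
qed (use P Q in auto)

text \<open>The inverse of \<open>P * Q\<close>: it makes \<open>Q * K\<close> a right inverse of
  \<open>P\<close> and \<open>K * P\<close> a left inverse of \<open>Q\<close>.\<close>

definition K where "K = (SOME K. K \<in> carrier_mat t t \<and> P * Q * K = 1\<^sub>m t \<and> K * (P * Q) = 1\<^sub>m t)"

lemma K: "K \<in> carrier_mat t t" "P * Q * K = 1\<^sub>m t" "K * (P * Q) = 1\<^sub>m t"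
proof -
  have "\<exists>K. K \<in> carrier_mat t t \<and> P * Q * K = 1\<^sub>m t \<and> K * (P * Q) = 1\<^sub>m t"
    using det_nonzero_inverse[OF _ PQ_invertible, of t] P Q by (metis mult_carrier_mat)
  from someI_ex[OF this] show "K \<in> carrier_mat t t" "P * Q * K = 1\<^sub>m t" "K * (P * Q) = 1\<^sub>m t"
    unfolding K_def by blast+
qed

lemma K_dims [simp]: "dim_row K = t" "dim_col K = t"
  using K(1) by auto

text \<open>\<open>P\<close> equals \<open>K * P * (Q * P)\<close>, whose last factor lies in the
  last block column. Consequently every \<open>Y * P\<close> lies in the algebra, which is how
  \<open>N \<times> t\<close> matrices are lifted.\<close>

lemma P_last_col: "i < t \<Longrightarrow> j < s (m - 1) \<Longrightarrow> P $$ (i, j) = 0"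
proof -
  assume i: "i < t" and j: "j < s (m - 1)"
  have jN: "j < N" using j s_last by simp
  have "P = K * (P * Q) * P" using K P by simp
  also have "\<dots> = K * P * (Q * P)" by (simp add: mult_assoc_dim)
  finally have "P $$ (i, j) = (K * P * (Q * P)) $$ (i, j)" by simp
  also have "\<dots> = (\<Sum>k<N. (K * P) $$ (i, k) * (Q * P) $$ (k, j))"
    using i jN by (intro times_mat_index[of _ t N _ N]) auto
  also have "\<dots> = 0"
    using QP_last_col j jN by (intro sum.neutral) (auto simp: last_col_def pattern_mat_def simp del: index_mult_mat(1))
  finally show ?thesis .
qed

lemma mult_P_last_col:
  assumes "Y \<in> carrier_mat N t" shows "Y * P \<in> last_col"
  unfolding last_col_def
proof (rule pattern_matI)
  fix i j assume ij: "i < N" "j < N" "\<not> s (m - 1) \<le> j"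
  have "(Y * P) $$ (i, j) = (\<Sum>k<t. Y $$ (i, k) * P $$ (k, j))"
    using assms P ij by (intro times_mat_index) auto
  also have "\<dots> = 0" using ij P_last_col by (intro sum.neutral) auto
  finally show "(Y * P) $$ (i, j) = 0" .
qed (use assms P in auto)

lemma P_left_cancel:
  assumes "Y \<in> carrier_mat n t" "Y * P = 0\<^sub>m n N" shows "Y = 0\<^sub>m n t"
proof -
  have "Y = Y * (P * Q * K)" using K assms by simp
  also have "\<dots> = Y * P * (Q * K)" using assms(1) by (simp add: mult_assoc_dim)
  also have "\<dots> = 0\<^sub>m n t" unfolding assms(2) using Q K by (intro left_mult_zero_mat) auto
  finally show ?thesis .
qed

lemma Q_right_cancel:
  assumes "Y \<in> carrier_mat t n" "Q * Y = 0\<^sub>m N n" shows "Y = 0\<^sub>m t n"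
proof -
  have "Y = K * (P * Q) * Y" using K assms by simp
  also have "\<dots> = K * P * (Q * Y)" using assms(1) by (simp add: mult_assoc_dim)
  also have "\<dots> = 0\<^sub>m t n" unfolding assms(2) using P K by (intro right_mult_zero_mat) auto
  finally show ?thesis .
qed

section \<open>The graded pieces of the module and of the division algebra\<close>

definition W :: "'g \<Rightarrow> 'k mat set" where "W g = (\<lambda>a. a * Q) ` A g"

definition B :: "'g \<Rightarrow> 'k mat set" where "B g = (\<lambda>a. P * a * Q) ` A g"

text \<open>A nonzero \<open>x\<close> has a partner \<open>y\<close> such that \<open>x * y\<close>
  has nonzero trace. After lifting \<open>y\<close> to the algebra, some homogeneous component of
  the lift still gives a nonzero trace; this forces the product into degree one, where it is
  non-nilpotent. It factors through \<open>x\<close>, so minimality makes \<open>x\<close>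
  invertible.\<close>

lemma B_invertible:
  assumes h: "h \<in> carrier G" and x: "x \<in> B h" "x \<noteq> 0\<^sub>m t t"
  shows "det x \<noteq> 0"
proof -
  obtain a where a: "a \<in> A h" "x = P * a * Q" using x by (auto simp: B_def)
  have ac: "a \<in> carrier_mat N N" and ad: "dim_row a = N" "dim_col a = N" using S_carrier[OF h a(1)] by auto
  have aC: "a \<in> C" using S_in_C h a by blast
  have xc: "x \<in> carrier_mat t t" using a ad by auto
  obtain i j where ij: "i < t" "j < t" "x $$ (i, j) \<noteq> 0"
    using x(2) xc by (metis carrier_matD eq_matI index_zero_mat)
  define y :: "'k mat" where "y = matrix_unit t j i"
  \<comment> \<open>A preimage of \<open>y\<close> under \<open>b \<mapsto> P * b * Q\<close>, built
    from the one-sided inverses of \<open>P\<close> and \<open>Q\<close>; ending in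
    \<open>P\<close>, it lies in the last block column.\<close>
  define b where "b = Q * K * y * K * P"
  have yd: "dim_row y = t" "dim_col y = t" by (auto simp: y_def matrix_unit_def)
  have bL: "b \<in> last_col"
    unfolding b_def using Q K(1) yd by (intro mult_P_last_col) auto
  then have bC: "b \<in> C" using last_col_subset by auto
  have bc: "b \<in> carrier_mat N N" using bC C_carrier by blast
  have "P * b * Q = (P * Q * K) * y * (K * (P * Q))"
    unfolding b_def using yd by (simp add: mult_assoc_dim)
  then have y: "P * b * Q = y" using K yd by (simp add: y_def)
  have tr: "mtrace (x * y) \<noteq> 0"
  proof -
    have "mtrace (x * y) = (\<Sum>k<t. if k = i then x $$ (i, j) else 0)"
      unfolding mtrace_def y_def using xc ij
      by (intro sum.cong) (auto simp: mult_matrix_unit_index[OF xc] simp del: index_mult_mat(1))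
    then show ?thesis using ij by simp
  qed
  \<comment> \<open>What stands beside \<open>b\<close> after cyclic rearrangement of the trace of
    \<open>x * y\<close>. The outer factors \<open>Q * P\<close> have degree one, so
    \<open>u\<close> keeps degree \<open>h\<close>.\<close>
  define u where "u = Q * P * a * (Q * P)"
  have uc: "u \<in> carrier_mat N N" using ad by (auto simp: u_def)
  have uL: "u \<in> last_col" unfolding u_def
    by (rule last_col_left_ideal[OF _ QP_last_col], rule carrier_matI) (simp_all add: ad)
  have uA: "u \<in> A h"
  proof -
    have "Q * P * a \<in> A (\<one> \<otimes> h)" by (rule A_mult[OF one_closed h QP_one a(1)])
    then have "Q * P * a * (Q * P) \<in> A (\<one> \<otimes> h \<otimes> \<one>)"
      by (rule A_mult[OF _ one_closed _ QP_one, rotated]) (use h in simp)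
    moreover have "\<one> \<otimes> h \<otimes> \<one> = h" using h by simp
    ultimately show ?thesis unfolding u_def by metis
  qed
  have "mtrace (x * y) = mtrace (P * (a * Q * P * b * Q))"
    unfolding a(2) y[symmetric] using ad bc by (simp add: mult_assoc_dim)
  also have "\<dots> = mtrace (a * Q * P * b * Q * P)"
    using ad bc by (intro mtrace_mult_comm[of _ t N]) auto
  also have "\<dots> = mtrace ((a * Q * P * b) * (Q * P))"
    using ad bc by (simp add: mult_assoc_dim)
  also have "\<dots> = mtrace (Q * P * (a * Q * P * b))"
    using ad bc by (intro mtrace_mult_comm[of _ N N]) auto
  also have "\<dots> = mtrace (u * b)"
    unfolding u_def using ad bc by (simp add: mult_assoc_dim)
  finally have trb: "mtrace (u * b) \<noteq> 0" using tr by simp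
  obtain F where F: "finite F" "F \<subseteq> carrier G" "b = msum N N F (\<pi> b)"
    by (rule proj_sum[OF bC], rule that)
  have \<pi>c: "\<pi> b g \<in> carrier_mat N N" if "g \<in> F" for g using proj_carrier bC F that by blast
  have "u * b = u * msum N N F (\<pi> b)" using F(3) by simp
  also have "\<dots> = msum N N F (\<lambda>g. u * \<pi> b g)"
    using F \<pi>c uc by (intro mult_msum) auto
  finally have "mtrace (u * b) = (\<Sum>g\<in>F. mtrace (u * \<pi> b g))"
    unfolding mtrace_msum[of N, symmetric] using uc by (simp add: mtrace_msum) (simp add: mtrace_def)
  then obtain g where g: "g \<in> F" "mtrace (u * \<pi> b g) \<noteq> 0" using trb by (metis sum.neutral)
  then have gG: "g \<in> carrier G" using F by auto
  have wL: "u * \<pi> b g \<in> last_col" using last_col_right_ideal uL proj_in_C bC gG by blast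
  have wA: "u * \<pi> b g \<in> A (h \<otimes> g)" using A_mult h gG uA proj_in[OF bC gG] by blast
  have "h \<otimes> g = \<one>" using mtrace_homogeneous_zero[OF wL _ wA] h gG g by auto
  then have "u * \<pi> b g \<in> nonnil_unit_part" using wL wA g by (intro nonnil_unit_partI) auto
  moreover have "u * \<pi> b g = Q * x * (P * \<pi> b g)"
    unfolding u_def a(2) using ad \<pi>c[OF g(1)] by (simp add: mult_assoc_dim)
  ultimately show ?thesis
    using minimal_invertible[OF xc, of "P * \<pi> b g"] P \<pi>c[OF g(1)] by auto
qed

end

section \<open>Graded modules over a graded division algebra\<close>

locale graded_module = group G + W: graded_mats N t "carrier_mat N t" "carrier G" W +
  B: graded_mats t t "carrier_mat t t" "carrier G" B
  for G :: "('g, 'c) monoid_scheme" (structure) and N t :: nat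
    and W B :: "'g \<Rightarrow> 'k :: field mat set" +
  assumes t_pos: "0 < t"
    and W_B: "g \<in> carrier G \<Longrightarrow> h \<in> carrier G \<Longrightarrow> x \<in> W g \<Longrightarrow> y \<in> B h \<Longrightarrow> x * y \<in> W (g \<otimes> h)"
    and B_inv: "h \<in> carrier G \<Longrightarrow> x \<in> B h \<Longrightarrow> x \<noteq> 0\<^sub>m t t \<Longrightarrow> det x \<noteq> 0"
begin

definition comb :: "nat \<Rightarrow> (nat \<Rightarrow> 'k mat) \<Rightarrow> (nat \<Rightarrow> 'k mat) \<Rightarrow> 'k mat" where
  "comb r Y c = msum N t {..<r} (\<lambda>i. Y i * c i)"

definition coeffs :: "nat \<Rightarrow> (nat \<Rightarrow> 'k mat) set" where
  "coeffs r = {c. \<forall>i<r. c i \<in> carrier_mat t t}"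

definition spanned :: "nat \<Rightarrow> (nat \<Rightarrow> 'k mat) \<Rightarrow> 'k mat set" where
  "spanned r Y = comb r Y ` coeffs r"

text \<open>Freeness is over all \<open>t \<times> t\<close> matrices, which are the sums of
  homogeneous elements of \<open>B\<close>; coefficients need not be homogeneous.\<close>

definition free_family :: "nat \<Rightarrow> (nat \<Rightarrow> 'k mat) \<Rightarrow> bool" where
  "free_family r Y \<longleftrightarrow> (\<forall>c\<in>coeffs r. comb r Y c = 0\<^sub>m N t \<longrightarrow> (\<forall>i<r. c i = 0\<^sub>m t t))"

definition hom_family :: "nat \<Rightarrow> (nat \<Rightarrow> 'k mat) \<Rightarrow> (nat \<Rightarrow> 'g) \<Rightarrow> bool" where
  "hom_family r Y \<gamma> \<longleftrightarrow> (\<forall>i<r. \<gamma> i \<in> carrier G \<and> Y i \<in> W (\<gamma> i))"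

lemma coeffs_less: "c \<in> coeffs (Suc r) \<Longrightarrow> c \<in> coeffs r"
  by (simp add: coeffs_def)

lemma comb_cong:
  "(\<And>i. i < r \<Longrightarrow> Y i = Y' i) \<Longrightarrow> (\<And>i. i < r \<Longrightarrow> c i = c' i) \<Longrightarrow> comb r Y c = comb r Y' c'"
  unfolding comb_def by (intro msum_cong) auto

lemma comb_Suc:
  assumes "Y r \<in> carrier_mat N t" "c r \<in> carrier_mat t t"
  shows "comb (Suc r) Y c = Y r * c r + comb r Y c"
  unfolding comb_def lessThan_Suc using assms by (intro msum_insert) auto

lemma hom_family_carrier:
  "hom_family r Y \<gamma> \<Longrightarrow> i < r \<Longrightarrow> Y i \<in> carrier_mat N t"
  unfolding hom_family_def using W.S_carrier by blast

lemma hom_familyD: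
  "hom_family r Y \<gamma> \<Longrightarrow> i < r \<Longrightarrow> \<gamma> i \<in> carrier G" "hom_family r Y \<gamma> \<Longrightarrow> i < r \<Longrightarrow> Y i \<in> W (\<gamma> i)"
  unfolding hom_family_def by auto

lemma proj_mult:
  assumes g: "g \<in> carrier G" and y: "y \<in> W g" and c: "c \<in> carrier_mat t t" and h: "h \<in> carrier G"
  shows "W.\<pi> (y * c) h = y * B.\<pi> c (inv g \<otimes> h)"
proof -
  have yc: "y \<in> carrier_mat N t" using W.S_carrier g y by blast
  have "W.\<pi> (y * c) (g \<otimes> (inv g \<otimes> h)) = y * B.\<pi> c (inv g \<otimes> h)"
    by (rule proj_map[OF B.graded_mats_axioms W.graded_mats_axioms, where f = "\<lambda>c. y * c" and \<sigma> = "\<lambda>h. g \<otimes> h"])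
       (use yc c g h W_B[OF g _ y] in \<open>auto simp: mult_add_distrib_mat[OF yc] right_mult_zero_mat[OF yc] inj_on_def\<close>)
  moreover have "g \<otimes> (inv g \<otimes> h) = h" using g h by (simp add: m_assoc[symmetric])
  ultimately show ?thesis by simp
qed

lemma proj_comb:
  assumes "hom_family r Y \<gamma>" "c \<in> coeffs r" "g \<in> carrier G"
  shows "W.\<pi> (comb r Y c) g = comb r Y (\<lambda>i. B.\<pi> (c i) (inv (\<gamma> i) \<otimes> g))"
proof -
  have "W.\<pi> (comb r Y c) g = msum N t {..<r} (\<lambda>i. W.\<pi> (Y i * c i) g)"
    unfolding comb_def using assms hom_family_carrier[OF assms(1)]
    by (intro W.proj_msum) (auto simp: coeffs_def intro!: mult_carrier_mat[of _ N t])
  also have "\<dots> = comb r Y (\<lambda>i. B.\<pi> (c i) (inv (\<gamma> i) \<otimes> g))"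
    unfolding comb_def using assms
    by (intro msum_cong proj_mult) (auto simp: coeffs_def hom_familyD)
  finally show ?thesis .
qed

lemma proj_coeffs:
  assumes "hom_family r Y \<gamma>" "c \<in> coeffs r" "g \<in> carrier G"
  shows "(\<lambda>i. B.\<pi> (c i) (inv (\<gamma> i) \<otimes> g)) \<in> coeffs r"
  using assms by (auto simp: coeffs_def hom_familyD intro!: B.proj_carrier)

lemma comb_mult:
  assumes "\<And>i. i < r \<Longrightarrow> Y i \<in> carrier_mat N t" "c \<in> coeffs r" "d \<in> carrier_mat t t"
  shows "comb r Y c * d = comb r Y (\<lambda>i. c i * d)"
proof -
  have "comb r Y c * d = msum N t {..<r} (\<lambda>i. Y i * c i * d)"
    unfolding comb_def using assms
    by (intro msum_mult) (auto simp: coeffs_def intro!: mult_carrier_mat[of _ N t])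
  also have "\<dots> = comb r Y (\<lambda>i. c i * d)"
    unfolding comb_def using assms
    by (intro msum_cong assoc_mult_mat[of _ N t _ t]) (auto simp: coeffs_def)
  finally show ?thesis .
qed

lemma spanned_mult:
  assumes "\<And>i. i < r \<Longrightarrow> Y i \<in> carrier_mat N t" "x \<in> spanned r Y" "d \<in> carrier_mat t t"
  shows "x * d \<in> spanned r Y"
proof -
  obtain c where c: "c \<in> coeffs r" "x = comb r Y c" using assms(2) by (auto simp: spanned_def)
  then have "x * d = comb r Y (\<lambda>i. c i * d)" using comb_mult[of r Y c d] assms by simp
  moreover have "(\<lambda>i. c i * d) \<in> coeffs r" using c assms(3) by (auto simp: coeffs_def)
  ultimately show ?thesis by (simp add: spanned_def)
qed

lemma comb_add:
  assumes "\<And>i. i < r \<Longrightarrow> Y i \<in> carrier_mat N t" "c \<in> coeffs r" "d \<in> coeffs r"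
  shows "comb r Y c + comb r Y d = comb r Y (\<lambda>i. c i + d i)"
proof -
  have "(\<Sum>k<r. (Y k * c k) $$ (i, j)) + (\<Sum>k<r. (Y k * d k) $$ (i, j)) = (\<Sum>k<r. (Y k * (c k + d k)) $$ (i, j))"
    if "i < N" "j < t" for i j
    unfolding sum.distrib[symmetric]
  proof (intro sum.cong refl)
    fix k assume "k \<in> {..<r}"
    then have "Y k \<in> carrier_mat N t" "c k \<in> carrier_mat t t" "d k \<in> carrier_mat t t"
      using assms by (auto simp: coeffs_def)
    then show "(Y k * c k) $$ (i, j) + (Y k * d k) $$ (i, j) = (Y k * (c k + d k)) $$ (i, j)"
      using that add_mat_index[of "Y k * c k" N t "Y k * d k"]
      by (subst mult_add_distrib_mat[of _ N t]) auto
  qed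
  then show ?thesis unfolding comb_def by (intro eq_matI) auto
qed

lemma spanned_subspace:
  assumes "\<And>i. i < r \<Longrightarrow> Y i \<in> carrier_mat N t"
  shows "mat_subspace N t (spanned r Y)"
proof (rule mat_subspaceI)
  show "x \<in> carrier_mat N t" if "x \<in> spanned r Y" for x
    using that by (auto simp: spanned_def comb_def)
  have "comb r Y (\<lambda>_. 0\<^sub>m t t) = msum N t {..<r} (\<lambda>_. 0\<^sub>m N t)"
    unfolding comb_def using assms by (intro msum_cong right_mult_zero_mat) auto
  also have "\<dots> = 0\<^sub>m N t" by (intro eq_matI) auto
  finally have "0\<^sub>m N t = comb r Y (\<lambda>_. 0\<^sub>m t t)" ..
  then show "0\<^sub>m N t \<in> spanned r Y"
    unfolding spanned_def using image_eqI[of _ "comb r Y" "\<lambda>_. 0\<^sub>m t t" "coeffs r"]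
    by (simp add: coeffs_def)
  show "x + y \<in> spanned r Y" if xy: "x \<in> spanned r Y" "y \<in> spanned r Y" for x y
  proof -
    obtain c d where "c \<in> coeffs r" "x = comb r Y c" "d \<in> coeffs r" "y = comb r Y d"
      using xy by (auto simp: spanned_def)
    then have "x + y = comb r Y (\<lambda>i. c i + d i)" "(\<lambda>i. c i + d i) \<in> coeffs r"
      using comb_add[of r Y c d] assms by (auto simp: coeffs_def)
    then show ?thesis by (simp add: spanned_def)
  qed
  show "a \<cdot>\<^sub>m x \<in> spanned r Y" if x: "x \<in> spanned r Y" for a x
  proof -
    have xc: "x \<in> carrier_mat N t" using x by (auto simp: spanned_def comb_def)
    have "a \<cdot>\<^sub>m x = x * (a \<cdot>\<^sub>m 1\<^sub>m t)" using mult_smult_distrib[OF xc one_carrier_mat, of a] right_mult_one_mat[OF xc] by simp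
    then show ?thesis using spanned_mult[of r Y x "a \<cdot>\<^sub>m 1\<^sub>m t"] assms x by simp
  qed
qed

text \<open>If \<open>x\<close> has a nonzero coefficient in a relation, some component of that
  coefficient is nonzero. Projecting the relation to the matching degree makes the coefficient
  homogeneous, hence invertible, and \<open>x\<close> would be in the span.\<close>

lemma free_family_extend:
  assumes hom: "hom_family r Y \<gamma>" and free: "free_family r Y"
    and g: "g \<in> carrier G" and x: "x \<in> W g" "x \<notin> spanned r Y"
  shows "hom_family (Suc r) (Y(r := x)) (\<gamma>(r := g))" "free_family (Suc r) (Y(r := x))"
proof -
  let ?Y = "Y(r := x)" and ?\<gamma> = "\<gamma>(r := g)"
  show hom': "hom_family (Suc r) ?Y ?\<gamma>"
    using hom g x by (auto simp: hom_family_def less_Suc_eq)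
  have xc: "x \<in> carrier_mat N t" using W.S_carrier g x by blast
  have Yc: "\<And>i. i < r \<Longrightarrow> Y i \<in> carrier_mat N t" using hom_family_carrier[OF hom] .
  have comb_eq: "comb r ?Y c = comb r Y c" for c by (rule comb_cong) auto
  show "free_family (Suc r) ?Y"
    unfolding free_family_def
  proof (intro ballI impI)
    fix c assume c: "c \<in> coeffs (Suc r)" and z: "comb (Suc r) ?Y c = 0\<^sub>m N t"
    have cr: "c \<in> coeffs r" "c r \<in> carrier_mat t t" using c coeffs_less by (auto simp: coeffs_def)
    have "c r = 0\<^sub>m t t"
    proof (rule ccontr)
      assume "c r \<noteq> 0\<^sub>m t t"
      then obtain h where h: "h \<in> carrier G" "B.\<pi> (c r) h \<noteq> 0\<^sub>m t t"
        using B.proj_eq_imp_zero cr(2) by blast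
      define d where "d = B.\<pi> (c r) h"
      have d: "d \<in> B h" "d \<in> carrier_mat t t" "d \<noteq> 0\<^sub>m t t"
        using B.proj_in B.proj_carrier cr(2) h by (auto simp: d_def)
      obtain d' where d': "d' \<in> carrier_mat t t" "d * d' = 1\<^sub>m t"
        using det_nonzero_inverse[OF d(2) B_inv[OF h(1) d(1,3)]] by blast
      \<comment> \<open>In degree \<open>g \<otimes> h\<close> the coefficient of the new element
        becomes exactly \<open>d\<close>.\<close>
      let ?c = "\<lambda>i. B.\<pi> (c i) (inv (?\<gamma> i) \<otimes> (g \<otimes> h))"
      have cc: "?c \<in> coeffs (Suc r)" using proj_coeffs[OF hom' c] g h by simp
      have "inv g \<otimes> (g \<otimes> h) = h" using g h by (simp add: m_assoc[symmetric])
      then have c_r: "?c r = d" by (simp add: d_def)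
      have "0\<^sub>m N t = W.\<pi> (comb (Suc r) ?Y c) (g \<otimes> h)" using z W.proj_zero g h by simp
      also have "\<dots> = comb (Suc r) ?Y ?c" using proj_comb[OF hom' c] g h by simp
      also have "\<dots> = ?Y r * ?c r + comb r ?Y ?c"
        using xc cc by (intro comb_Suc) (auto simp: coeffs_def)
      also have "\<dots> = x * d + comb r Y ?c" unfolding c_r comb_eq by simp
      finally have "x * d + comb r Y ?c = 0\<^sub>m N t" ..
      then have "x * d = (-1) \<cdot>\<^sub>m comb r Y ?c"
      proof -
        assume 0: "x * d + comb r Y ?c = 0\<^sub>m N t"
        have cb: "comb r Y ?c \<in> carrier_mat N t" by (simp add: comb_def)
        have xd: "x * d \<in> carrier_mat N t" using xc d by auto
        show ?thesis
        proof (rule eq_matI)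
          fix i j assume "i < dim_row ((-1) \<cdot>\<^sub>m comb r Y ?c)" "j < dim_col ((-1) \<cdot>\<^sub>m comb r Y ?c)"
          then have ij: "i < N" "j < t" using cb by auto
          have "(x * d + comb r Y ?c) $$ (i, j) = 0" unfolding 0 using ij by simp
          then show "(x * d) $$ (i, j) = ((-1) \<cdot>\<^sub>m comb r Y ?c) $$ (i, j)"
            using add_mat_index[OF xd cb ij] smult_mat_index[OF cb ij]
            by (simp add: eq_neg_iff_add_eq_0 del: index_mult_mat)
        qed (use xd cb in auto)
      qed
      also have "\<dots> \<in> spanned r Y"
      proof (rule mat_subspaceD(4)[OF spanned_subspace])
        show "comb r Y ?c \<in> spanned r Y"
          unfolding spanned_def
        proof (rule imageI)
          show "?c \<in> coeffs r" by (rule coeffs_less[OF cc])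
        qed
      qed (rule Yc)
      finally have "x * d * d' \<in> spanned r Y" using spanned_mult[of r Y "x * d" d'] Yc d'(1) by blast
      moreover have "x * d * d' = x"
        using assoc_mult_mat[OF xc d(2) d'(1)] d' xc by simp
      ultimately show False using x by simp
    qed
    then have "comb (Suc r) ?Y c = comb r Y c"
      using comb_Suc[of ?Y r c] xc cr comb_eq[of c] right_mult_zero_mat[OF xc, of t] left_add_zero_mat[of "comb r Y c" N t]
      by (simp add: comb_def)
    then have "\<forall>i<r. c i = 0\<^sub>m t t" using free cr z by (auto simp: free_family_def)
    then show "\<forall>i<Suc r. c i = 0\<^sub>m t t" using \<open>c r = 0\<^sub>m t t\<close> by (auto simp: less_Suc_eq)
  qed
qed

end

section \<open>Block columns and the size of free families\<close>

lemma wide_matrix_kernel: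
  fixes M :: "'k :: field mat"
  assumes M: "M \<in> carrier_mat n p" and "n < p"
  obtains v where "v \<in> carrier_vec p" "v \<noteq> 0\<^sub>v p" "M *\<^sub>v v = 0\<^sub>v n"
proof -
  \<comment> \<open>Zero rows make the matrix square; the transpose kills the unit vector at the
    first added row \<open>n\<close>, so the determinant vanishes.\<close>
  define M' where "M' = mat p p (\<lambda>(i, j). if i < n then M $$ (i, j) else 0)"
  have M': "M' \<in> carrier_mat p p" by (simp add: M'_def)
  have "transpose_mat M' *\<^sub>v unit_vec p n = 0\<^sub>v p"
  proof (rule eq_vecI)
    fix i assume "i < dim_vec (0\<^sub>v p :: 'k vec)"
    then have i: "i < p" by simp
    have "(transpose_mat M' *\<^sub>v unit_vec p n) $ i = col M' i \<bullet> unit_vec p n"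
      using i M' by simp
    also have "\<dots> = M' $$ (n, i)" using i assms(2) M' by (subst scalar_prod_right_unit) auto
    finally show "(transpose_mat M' *\<^sub>v unit_vec p n) $ i = 0\<^sub>v p $ i" using i assms(2) by (simp add: M'_def)
  qed (use M' in auto)
  moreover have "unit_vec p n \<noteq> (0\<^sub>v p :: 'k vec)" using assms(2) by simp
  ultimately have "det (transpose_mat M') = 0"
    using det_0_iff_vec_prod_zero_field[of "transpose_mat M'" p] M' by (metis transpose_carrier_mat unit_vec_carrier)
  then have "det M' = 0" using det_transpose[OF M'] by simp
  then obtain v where v: "v \<in> carrier_vec p" "v \<noteq> 0\<^sub>v p" "M' *\<^sub>v v = 0\<^sub>v p"
    using det_0_iff_vec_prod_zero_field[OF M'] by auto
  have "M *\<^sub>v v = 0\<^sub>v n"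
  proof (rule eq_vecI)
    fix i assume "i < dim_vec (0\<^sub>v n :: 'k vec)"
    then have i: "i < n" by simp
    have "row M i = row M' i" using M i assms by (intro eq_vecI) (auto simp: M'_def)
    then have "(M *\<^sub>v v) $ i = (M' *\<^sub>v v) $ i" using M i assms by (simp add: M'_def)
    then show "(M *\<^sub>v v) $ i = 0\<^sub>v n $ i" using v i assms by simp
  qed (use M in auto)
  then show ?thesis using that v by blast
qed

lemma sum_blocks: "(\<Sum>k<r * t. f k) = (\<Sum>i<r. \<Sum>a<t. f (i * t + a :: nat))"
proof -
  have "(\<Sum>k<r * t. f k) = (\<Sum>i<r. sum f {i * t..<i * t + t})" by (simp add: sum.nat_group)
  also have "\<dots> = (\<Sum>i<r. \<Sum>a<t. f (i * t + a))"
  proof (rule sum.cong[OF refl])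
    fix i
    show "sum f {i * t..<i * t + t} = (\<Sum>a<t. f (i * t + a))"
      by (rule sum.reindex_bij_witness[of _ "\<lambda>a. i * t + a" "\<lambda>k. k - i * t"]) auto
  qed
  finally show ?thesis .
qed

text \<open>Index \<open>l * t + a\<close> is column \<open>a\<close> of block \<open>l\<close>.
  With \<open>vblock\<close> cutting the other factor into matching row blocks, a combination with
  matrix coefficients becomes a single matrix product.\<close>

definition hcat :: "nat \<Rightarrow> nat \<Rightarrow> nat \<Rightarrow> (nat \<Rightarrow> 'k :: field mat) \<Rightarrow> 'k mat" where
  "hcat N t r Y = mat N (r * t) (\<lambda>(i, j). Y (j div t) $$ (i, j mod t))"

definition vblock :: "nat \<Rightarrow> 'k :: field mat \<Rightarrow> nat \<Rightarrow> 'k mat" where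
  "vblock t M i = mat t (dim_col M) (\<lambda>(a, b). M $$ (i * t + a, b))"

lemma hcat_carrier [simp]: "hcat N t r Y \<in> carrier_mat N (r * t)"
  by (simp add: hcat_def)

lemma hcat_index: "i < N \<Longrightarrow> l < r \<Longrightarrow> a < t \<Longrightarrow> hcat N t r Y $$ (i, l * t + a) = Y l $$ (i, a)"
  by (simp add: hcat_def mult_add_less_mult)

lemma vblock_carrier: "M \<in> carrier_mat n p \<Longrightarrow> vblock t M i \<in> carrier_mat t p"
  by (auto simp: vblock_def)

lemma hcat_mult:
  assumes M: "M \<in> carrier_mat (r * t) p" and Y: "\<And>i. i < r \<Longrightarrow> Y i \<in> carrier_mat N t"
  shows "hcat N t r Y * M = msum N p {..<r} (\<lambda>i. Y i * vblock t M i)"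
proof (rule eq_matI)
  fix i j assume "i < dim_row (msum N p {..<r} (\<lambda>i. Y i * vblock t M i))"
    "j < dim_col (msum N p {..<r} (\<lambda>i. Y i * vblock t M i))"
  then have ij: "i < N" "j < p" by auto
  have "(hcat N t r Y * M) $$ (i, j) = (\<Sum>k<r * t. hcat N t r Y $$ (i, k) * M $$ (k, j))"
    using M ij by (intro times_mat_index) auto
  also have "\<dots> = (\<Sum>l<r. \<Sum>a<t. Y l $$ (i, a) * M $$ (l * t + a, j))"
    unfolding sum_blocks using ij by (intro sum.cong) (auto simp: hcat_index)
  also have "\<dots> = (\<Sum>l<r. (Y l * vblock t M l) $$ (i, j))"
  proof (intro sum.cong refl)
    fix l assume "l \<in> {..<r}"
    then show "(\<Sum>a<t. Y l $$ (i, a) * M $$ (l * t + a, j)) = (Y l * vblock t M l) $$ (i, j)"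
      using ij M by (subst times_mat_index[OF Y vblock_carrier[OF M]]) (auto simp: vblock_def)
  qed
  finally show "(hcat N t r Y * M) $$ (i, j) = msum N p {..<r} (\<lambda>i. Y i * vblock t M i) $$ (i, j)"
    using ij by simp
qed (use M in \<open>auto simp: hcat_def\<close>)

lemma mat_eq_by_vblocks:
  assumes "M \<in> carrier_mat (r * t) p" "M' \<in> carrier_mat (r * t) p"
    and "\<And>i. i < r \<Longrightarrow> vblock t M i = vblock t M' i"
  shows "M = M'"
proof (rule eq_matI)
  fix i j assume "i < dim_row M'" "j < dim_col M'"
  then have ij: "i < r * t" "j < p" using assms by auto
  then have t: "0 < t" by (auto intro!: Nat.gr0I)
  have "vblock t M (i div t) $$ (i mod t, j) = vblock t M' (i div t) $$ (i mod t, j)"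
    using assms(3) ij by (simp add: less_mult_imp_div_less)
  then show "M $$ (i, j) = M' $$ (i, j)"
    using assms(1,2) ij t by (simp add: vblock_def)
qed (use assms in auto)

context graded_module
begin

lemma hcat_comb:
  assumes "M \<in> carrier_mat (r * t) t" "\<And>i. i < r \<Longrightarrow> Y i \<in> carrier_mat N t"
  shows "hcat N t r Y * M = comb r Y (vblock t M)"
  using hcat_mult[OF assms] by (simp add: comb_def)

lemma hcat_inject:
  assumes Y: "\<And>i. i < r \<Longrightarrow> Y i \<in> carrier_mat N t" and free: "free_family r Y"
    and v: "v \<in> carrier_vec (r * t)" "hcat N t r Y *\<^sub>v v = 0\<^sub>v N"
  shows "v = 0\<^sub>v (r * t)"
proof -
  \<comment> \<open>Repeating \<open>v\<close> in \<open>t\<close> columns makes the row blocks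
    square, so that freeness with \<open>t \<times> t\<close> coefficients applies.\<close>
  define M where "M = mat (r * t) t (\<lambda>(i, j). v $ i)"
  have M: "M \<in> carrier_mat (r * t) t" by (simp add: M_def)
  have colM: "col M j = v" if "j < t" for j using v that by (intro eq_vecI) (auto simp: M_def)
  have "hcat N t r Y * M = 0\<^sub>m N t"
  proof (rule eq_matI)
    fix i j assume ij: "i < dim_row (0\<^sub>m N t :: 'k mat)" "j < dim_col (0\<^sub>m N t :: 'k mat)"
    then have "(hcat N t r Y * M) $$ (i, j) = (hcat N t r Y *\<^sub>v v) $ i"
      using M colM by (simp add: hcat_def)
    then show "(hcat N t r Y * M) $$ (i, j) = 0\<^sub>m N t $$ (i, j)" using ij v by simp
  qed (use M in \<open>auto simp: hcat_def\<close>)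
  then have "comb r Y (vblock t M) = 0\<^sub>m N t" using hcat_comb[OF M Y] by simp
  moreover have "vblock t M \<in> coeffs r" using vblock_carrier[OF M] by (auto simp: coeffs_def)
  ultimately have "vblock t M i = 0\<^sub>m t t" if "i < r" for i using free that by (auto simp: free_family_def)
  then have "M = 0\<^sub>m (r * t) t"
    by (intro mat_eq_by_vblocks[OF M]) (auto simp: vblock_def mult_add_less_mult intro!: eq_matI)
  then have "M $$ (i, 0) = 0" if "i < r * t" for i using that t_pos by simp
  then show ?thesis using v t_pos by (intro eq_vecI) (auto simp: M_def)
qed

lemma free_family_bound:
  assumes Y: "\<And>i. i < r \<Longrightarrow> Y i \<in> carrier_mat N t" and free: "free_family r Y"
  shows "r * t \<le> N"
  using wide_matrix_kernel[OF hcat_carrier, of N r t Y] hcat_inject[OF Y free] by (metis not_less)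

text \<open>If some element of \<open>F\<close> is not spanned, then one of its components is not,
  and that component is still in \<open>F\<close> because \<open>F\<close> is graded. Adding it
  keeps the family free, and a free family has at most \<open>N\<close> members.\<close>

lemma complete_family:
  assumes hom: "hom_family r Y \<gamma>" and free: "free_family r Y" and F: "W.graded_subset F"
    and sub: "\<forall>i<r. Y i \<in> F"
  shows "\<exists>r' Y' \<gamma>'. r \<le> r' \<and> (\<forall>i<r. Y' i = Y i \<and> \<gamma>' i = \<gamma> i) \<and> hom_family r' Y' \<gamma>' \<and>
    free_family r' Y' \<and> (\<forall>i<r'. Y' i \<in> F) \<and> F \<subseteq> spanned r' Y'"
  using hom free sub
proof (induction "Suc N - r" arbitrary: r Y \<gamma> rule: less_induct)
  case less
  note Yc = hom_family_carrier[OF less.prems(1)]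
  show ?case
  proof (cases "F \<subseteq> spanned r Y")
    case True
    then show ?thesis using less.prems by blast
  next
    case False
    then obtain y where y: "y \<in> F" "y \<notin> spanned r Y" by blast
    then have yC: "y \<in> carrier_mat N t" using F by (auto simp: W.graded_subset_def)
    obtain E where E: "finite E" "E \<subseteq> carrier G" "y = msum N t E (W.\<pi> y)"
      by (rule W.proj_sum[OF yC], rule that)
    have sp: "mat_subspace N t (spanned r Y)" using spanned_subspace[of r Y] Yc by blast
    have "\<exists>g\<in>E. W.\<pi> y g \<notin> spanned r Y"
      using mat_subspace_msum[OF sp E(1)] E(3) y by metis
    then obtain g where g: "g \<in> E" "W.\<pi> y g \<notin> spanned r Y" by blast
    define x where "x = W.\<pi> y g"
    have gG: "g \<in> carrier G" using g E by blast
    have x: "x \<in> W g" "x \<in> F" "x \<notin> spanned r Y"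
      using W.proj_in[OF yC gG] g F y gG by (auto simp: x_def W.graded_subset_def)
    let ?Y = "Y(r := x)" and ?\<gamma> = "\<gamma>(r := g)"
    note ext = free_family_extend[OF less.prems(1,2) gG x(1,3)]
    have "Suc r * t \<le> N" using free_family_bound[OF hom_family_carrier[OF ext(1)] ext(2)] by simp
    moreover have "Suc r * 1 \<le> Suc r * t" using t_pos by (intro mult_le_mono2) simp
    ultimately have "r < N" by simp
    then have "Suc N - Suc r < Suc N - r" by simp
    moreover have "\<forall>i<Suc r. ?Y i \<in> F" using less.prems(3) x by (auto simp: less_Suc_eq)
    ultimately obtain r' Y' \<gamma>' where *: "Suc r \<le> r'" "\<forall>i<Suc r. Y' i = ?Y i \<and> \<gamma>' i = ?\<gamma> i"
      "hom_family r' Y' \<gamma>'" "free_family r' Y'" "\<forall>i<r'. Y' i \<in> F" "F \<subseteq> spanned r' Y'"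
      using less.hyps[OF _ ext] by blast
    moreover have "\<forall>i<r. Y' i = Y i \<and> \<gamma>' i = \<gamma> i" using *(2) by (metis fun_upd_apply less_Suc_eq nat_neq_iff)
    ultimately show ?thesis using Suc_leD by blast
  qed
qed

text \<open>Completion keeps the earlier members, so one family serves the whole flag: step
  \<open>k\<close> uses its first \<open>\<rho> k\<close> members.\<close>

lemma adapted_basis:
  fixes F :: "nat \<Rightarrow> 'k mat set"
  assumes "\<And>k. k \<le> m \<Longrightarrow> W.graded_subset (F k)" "\<And>k. k < m \<Longrightarrow> F k \<subseteq> F (Suc k)" "F 0 = {0\<^sub>m N t}"
  shows "\<exists>\<rho> Y \<gamma>. \<rho> 0 = 0 \<and> (\<forall>k<m. \<rho> k \<le> \<rho> (Suc k)) \<and> hom_family (\<rho> m) Y \<gamma> \<and>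
    (\<forall>k\<le>m. free_family (\<rho> k) Y \<and> (\<forall>i<\<rho> k. Y i \<in> F k) \<and> F k \<subseteq> spanned (\<rho> k) Y)"
  using assms
proof (induction m)
  case 0
  have "comb 0 Y c = 0\<^sub>m N t" for Y c by (simp add: comb_def)
  then have "F 0 \<subseteq> spanned 0 Y" for Y using 0 by (auto simp: spanned_def coeffs_def)
  then show ?case
    by (intro exI[of _ "\<lambda>_. 0"]) (auto simp: hom_family_def free_family_def)
next
  case (Suc m)
  then obtain \<rho> Y \<gamma> where IH: "\<rho> 0 = 0" "\<forall>k<m. \<rho> k \<le> \<rho> (Suc k)" "hom_family (\<rho> m) Y \<gamma>"
    "\<forall>k\<le>m. free_family (\<rho> k) Y \<and> (\<forall>i<\<rho> k. Y i \<in> F k) \<and> F k \<subseteq> spanned (\<rho> k) Y"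
    by (metis less_SucI le_SucI)
  have mono: "\<rho> k \<le> \<rho> m" if "k \<le> m" for k
    using that by (induction rule: inc_induct) (use IH(2) order_trans in blast)+
  have "\<forall>i<\<rho> m. Y i \<in> F (Suc m)" using IH(4) Suc.prems(2)[of m] by blast
  with complete_family[OF IH(3), of "F (Suc m)"] obtain r' Y' \<gamma>' where *: "\<rho> m \<le> r'"
    "\<forall>i<\<rho> m. Y' i = Y i \<and> \<gamma>' i = \<gamma> i" "hom_family r' Y' \<gamma>'" "free_family r' Y'"
    "\<forall>i<r'. Y' i \<in> F (Suc m)" "F (Suc m) \<subseteq> spanned r' Y'"
    using IH(4) Suc.prems(1) by blast
  define \<rho>' where "\<rho>' = \<rho>(Suc m := r')"
  have eq: "comb (\<rho> k) Y' c = comb (\<rho> k) Y c" if "k \<le> m" for k c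
    using *(2) mono[OF that] by (intro comb_cong) auto
  have "free_family (\<rho>' k) Y' \<and> (\<forall>i<\<rho>' k. Y' i \<in> F k) \<and> F k \<subseteq> spanned (\<rho>' k) Y'" if "k \<le> Suc m" for k
  proof (cases "k = Suc m")
    case True
    then show ?thesis using * by (simp add: \<rho>'_def)
  next
    case False
    then have k: "k \<le> m" using that by simp
    have "spanned (\<rho> k) Y' = spanned (\<rho> k) Y" unfolding spanned_def using eq[OF k] by simp
    moreover have "Y' i = Y i" if "i < \<rho> k" for i using *(2) mono[OF k] that by simp
    ultimately show ?thesis
      using IH(4) k False eq[OF k] by (auto simp: \<rho>'_def free_family_def)
  qed
  moreover have "\<forall>k<Suc m. \<rho>' k \<le> \<rho>' (Suc k)" using IH(2) *(1) by (auto simp: \<rho>'_def less_Suc_eq)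
  ultimately show ?case using IH(1) *(3) by (intro exI[of _ \<rho>'] exI[of _ Y'] exI[of _ \<gamma>']) (auto simp: \<rho>'_def)
qed

end

section \<open>Transport of the grading along multiplication by \<open>P\<close> and
  \<open>Q\<close>\<close>

lemma mat_subspace_image:
  assumes S: "mat_subspace nr nc S" and f: "\<And>x. x \<in> S \<Longrightarrow> f x \<in> carrier_mat nr' nc'"
    "\<And>x y. x \<in> S \<Longrightarrow> y \<in> S \<Longrightarrow> f (x + y) = f x + f y" "\<And>c x. x \<in> S \<Longrightarrow> f (c \<cdot>\<^sub>m x) = c \<cdot>\<^sub>m f x"
    "f (0\<^sub>m nr nc) = 0\<^sub>m nr' nc'"
  shows "mat_subspace nr' nc' (f ` S)"
proof (rule mat_subspaceI)
  show "x + y \<in> f ` S" if "x \<in> f ` S" "y \<in> f ` S" for x y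
    using that f(2) mat_subspaceD(3)[OF S] by (metis (no_types, lifting) image_iff)
  show "c \<cdot>\<^sub>m x \<in> f ` S" if "x \<in> f ` S" for c x
    using that f(3) mat_subspaceD(4)[OF S] by (metis (no_types, lifting) image_iff)
  show "0\<^sub>m nr' nc' \<in> f ` S" using f(4) mat_subspaceD(2)[OF S] by (metis image_eqI)
qed (use f(1) in auto)

lemma mat_subspace_mult_right:
  assumes S: "mat_subspace nr nc S" and Q: "Q \<in> carrier_mat nc n"
  shows "mat_subspace nr n ((\<lambda>a. a * Q) ` S)"
proof (rule mat_subspace_image[OF S])
  fix x y c assume x: "x \<in> S"
  note xc = mat_subspaceD(1)[OF S x]
  show "x * Q \<in> carrier_mat nr n" using xc Q by auto
  show "c \<cdot>\<^sub>m x * Q = c \<cdot>\<^sub>m (x * Q)" by (rule mult_smult_assoc_mat[OF xc Q])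
  assume y: "y \<in> S"
  show "(x + y) * Q = x * Q + y * Q" by (rule add_mult_distrib_mat[OF xc mat_subspaceD(1)[OF S y] Q])
qed (rule left_mult_zero_mat[OF Q])

lemma mat_subspace_mult_left:
  assumes S: "mat_subspace nr nc S" and P: "P \<in> carrier_mat n nr"
  shows "mat_subspace n nc ((\<lambda>a. P * a) ` S)"
proof (rule mat_subspace_image[OF S])
  fix x y c assume x: "x \<in> S"
  note xc = mat_subspaceD(1)[OF S x]
  show "P * x \<in> carrier_mat n nc" using xc P by auto
  show "P * (c \<cdot>\<^sub>m x) = c \<cdot>\<^sub>m (P * x)" by (rule mult_smult_distrib[OF P xc])
  assume y: "y \<in> S"
  show "P * (x + y) = P * x + P * y" by (rule mult_add_distrib_mat[OF P xc mat_subspaceD(1)[OF S y]])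
qed (rule right_mult_zero_mat[OF P])

context graded_frame
begin

lemma W_subspace: "g \<in> carrier G \<Longrightarrow> mat_subspace N t (W g)"
  unfolding W_def by (rule mat_subspace_mult_right[OF comp Q])

lemma B_subspace: "g \<in> carrier G \<Longrightarrow> mat_subspace t t (B g)"
proof -
  assume g: "g \<in> carrier G"
  have "B g = (\<lambda>a. a * Q) ` (\<lambda>a. P * a) ` A g" by (simp add: B_def image_image)
  then show "mat_subspace t t (B g)"
    using mat_subspace_mult_right[OF mat_subspace_mult_left[OF comp[OF g] P] Q] by simp
qed

text \<open>Every \<open>x\<close> is \<open>b * Q\<close> with \<open>b = x * K * P\<close> in the
  algebra, and the decomposition of \<open>b\<close> is pushed forward. For independence, right
  multiplication by \<open>P\<close> is injective and sends \<open>W h\<close> into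
  \<open>A h\<close>, because \<open>Q * P\<close> has degree one.\<close>

lemma W_graded: "graded_mats N t (carrier_mat N t) (carrier G) W"
proof
  fix g assume g: "g \<in> carrier G"
  show "mat_subspace N t (W g)" by (rule W_subspace[OF g])
  then show "W g \<subseteq> carrier_mat N t" by (auto simp: mat_subspace_def)
next
  fix x :: "'k mat" assume x: "x \<in> carrier_mat N t"
  define b where "b = x * K * P"
  have "b \<in> last_col" unfolding b_def using x by (intro mult_P_last_col carrier_matI) auto
  then have bC: "b \<in> C" using last_col_subset by auto
  have "b * Q = x * (K * (P * Q))" unfolding b_def using x by (simp add: mult_assoc_dim)
  then have bQ: "x = b * Q" using K x by simp
  obtain F where F: "finite F" "F \<subseteq> carrier G" "b = msum N N F (\<pi> b)"
    by (rule proj_sum[OF bC], rule that)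
  have "x = msum N N F (\<pi> b) * Q" using F bQ by simp
  also have "\<dots> = msum N t F (\<lambda>g. \<pi> b g * Q)"
    using F bC proj_carrier Q by (intro msum_mult) auto
  finally show "\<exists>F a. finite F \<and> F \<subseteq> carrier G \<and> (\<forall>g\<in>F. a g \<in> W g) \<and> x = msum N t F a"
    using F proj_in[OF bC] by (intro exI[of _ F] exI[of _ "\<lambda>g. \<pi> b g * Q"]) (auto simp: W_def)
next
  fix F a g assume F: "finite F" "F \<subseteq> carrier G" "\<And>g. g \<in> F \<Longrightarrow> a g \<in> W g"
    and z: "msum N t F a = 0\<^sub>m N t" and g: "g \<in> F"
  have ac: "a h \<in> carrier_mat N t" if "h \<in> F" for h
    using mat_subspaceD(1)[OF W_subspace] F(2,3) that by blast
  have aA: "a h * P \<in> A h" if "h \<in> F" for h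
  proof -
    have h: "h \<in> carrier G" using F that by auto
    obtain c where c: "c \<in> A h" "a h = c * Q" using F(3)[of h] \<open>h \<in> F\<close> by (auto simp: W_def)
    have "c * (Q * P) \<in> A (h \<otimes> \<one>)" by (rule A_mult[OF h one_closed c(1) QP_one])
    then show ?thesis using c A_dims[OF h c(1)] h by (simp add: mult_assoc_dim)
  qed
  have "msum N N F (\<lambda>h. a h * P) = msum N t F a * P"
    using F(1) ac P by (intro msum_mult[symmetric]) auto
  also have "\<dots> = 0\<^sub>m N N" unfolding z using P by (intro left_mult_zero_mat) auto
  finally have "a g * P = 0\<^sub>m N N" using indep[OF F(1,2) aA] g by blast
  then show "a g = 0\<^sub>m N t" using P_left_cancel ac g by blast
qed (rule mat_subspace_carrier)

text \<open>The two-sided version: \<open>b = Q * K * x * K * P\<close> lifts \<open>x\<close>, and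
  \<open>a \<mapsto> Q * a * P\<close> is injective and sends \<open>B h\<close> into
  \<open>A h\<close>.\<close>

lemma B_graded: "graded_mats t t (carrier_mat t t) (carrier G) B"
proof
  fix g assume g: "g \<in> carrier G"
  show "mat_subspace t t (B g)" by (rule B_subspace[OF g])
  then show "B g \<subseteq> carrier_mat t t" by (auto simp: mat_subspace_def)
next
  fix x :: "'k mat" assume x: "x \<in> carrier_mat t t"
  define b where "b = Q * K * x * K * P"
  have "b \<in> last_col" unfolding b_def by (rule mult_P_last_col, rule carrier_matI) auto
  then have bC: "b \<in> C" using last_col_subset by auto
  have "P * b * Q = (P * Q * K) * x * (K * (P * Q))" unfolding b_def using x by (simp add: mult_assoc_dim)
  then have bQ: "x = P * b * Q" using K x by simp
  obtain F where F: "finite F" "F \<subseteq> carrier G" "b = msum N N F (\<pi> b)"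
    by (rule proj_sum[OF bC], rule that)
  have c: "\<pi> b g \<in> carrier_mat N N" if "g \<in> F" for g using proj_carrier[OF bC] F(2) that by blast
  have "x = P * msum N N F (\<pi> b) * Q" using F bQ by simp
  also have "P * msum N N F (\<pi> b) = msum t N F (\<lambda>g. P * \<pi> b g)"
    by (rule mult_msum[OF F(1) c P])
  also have "\<dots> * Q = msum t t F (\<lambda>g. P * \<pi> b g * Q)"
    by (rule msum_mult[OF F(1) mult_carrier_mat[OF P c] Q])
  finally show "\<exists>F a. finite F \<and> F \<subseteq> carrier G \<and> (\<forall>g\<in>F. a g \<in> B g) \<and> x = msum t t F a"
    using F proj_in[OF bC] by (intro exI[of _ F] exI[of _ "\<lambda>g. P * \<pi> b g * Q"]) (auto simp: B_def)
next
  fix F a g assume F: "finite F" "F \<subseteq> carrier G" "\<And>g. g \<in> F \<Longrightarrow> a g \<in> B g"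
    and z: "msum t t F a = 0\<^sub>m t t" and g: "g \<in> F"
  have ac: "a h \<in> carrier_mat t t" if "h \<in> F" for h
    using mat_subspaceD(1)[OF B_subspace] F(2,3) that by blast
  have aA: "Q * a h * P \<in> A h" if "h \<in> F" for h
  proof -
    have h: "h \<in> carrier G" using F that by auto
    obtain c where c: "c \<in> A h" "a h = P * c * Q" using F(3)[of h] \<open>h \<in> F\<close> by (auto simp: B_def)
    have "Q * P * c \<in> A (\<one> \<otimes> h)" by (rule A_mult[OF one_closed h QP_one c(1)])
    then have "Q * P * c * (Q * P) \<in> A (\<one> \<otimes> h \<otimes> \<one>)"
      by (rule A_mult[OF _ one_closed _ QP_one, rotated]) (use h in simp)
    moreover have "Q * P * c * (Q * P) = Q * a h * P"
      using c A_dims[OF h c(1)] by (simp add: mult_assoc_dim)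
    ultimately show ?thesis using h by simp
  qed
  have "msum N N F (\<lambda>h. Q * a h * P) = msum N t F (\<lambda>h. Q * a h) * P"
    using F(1) ac P Q by (intro msum_mult[symmetric]) auto
  also have "msum N t F (\<lambda>h. Q * a h) = Q * msum t t F a"
    using F(1) ac Q by (intro mult_msum[symmetric]) auto
  also have "\<dots> * P = 0\<^sub>m N N" unfolding z right_mult_zero_mat[OF Q] using P by (intro left_mult_zero_mat) auto
  finally have "Q * a g * P = 0\<^sub>m N N" using indep[OF F(1,2) aA] g by blast
  then have "Q * a g = 0\<^sub>m N t" using P_left_cancel[of "Q * a g" N] ac[OF g] Q by simp
  then show "a g = 0\<^sub>m t t" using Q_right_cancel ac g by blast
qed (rule mat_subspace_carrier)

sublocale frame: graded_module G N t W B
proof -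
  interpret W: graded_mats N t "carrier_mat N t" "carrier G" W by (rule W_graded)
  interpret B: graded_mats t t "carrier_mat t t" "carrier G" B by (rule B_graded)
  show "graded_module G N t W B"
  proof
    show "0 < t" by (rule t_pos)
    show "det x \<noteq> 0" if "h \<in> carrier G" "x \<in> B h" "x \<noteq> 0\<^sub>m t t" for h x
      using B_invertible that by blast
    show "x * y \<in> W (g \<otimes> h)" if g: "g \<in> carrier G" and h: "h \<in> carrier G" and x: "x \<in> W g" and y: "y \<in> B h" for g h x y
    proof -
      obtain a b where ab: "a \<in> A g" "x = a * Q" "b \<in> A h" "y = P * b * Q"
        using x y by (auto simp: W_def B_def)
      have "a * (Q * P) \<in> A (g \<otimes> \<one>)" by (rule A_mult[OF g one_closed ab(1) QP_one])
      then have "a * (Q * P) * b \<in> A (g \<otimes> h)" using A_mult[OF g h _ ab(3)] g by simp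
      moreover have "x * y = a * (Q * P) * b * Q"
        unfolding ab using A_dims[OF g ab(1)] A_dims[OF h ab(3)] by (simp add: mult_assoc_dim)
      ultimately show ?thesis by (auto simp: W_def)
    qed
  qed
qed

lemma A_W:
  assumes g: "g \<in> carrier G" and h: "h \<in> carrier G" and a: "a \<in> A g" and x: "x \<in> W h"
  shows "a * x \<in> W (g \<otimes> h)"
proof -
  obtain b where b: "b \<in> A h" "x = b * Q" using x by (auto simp: W_def)
  then have "a * x = a * b * Q" using A_dims[OF g a] A_dims[OF h b(1)] by (simp add: mult_assoc_dim)
  then show ?thesis using A_mult[OF g h a b(1)] by (auto simp: W_def)
qed

text \<open>The factor \<open>Q * P\<close> that appears in the middle has degree one, so the
  degrees simply multiply.\<close>

lemma B_B:
  assumes g: "g \<in> carrier G" and h: "h \<in> carrier G" and x: "x \<in> B g" and y: "y \<in> B h"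
  shows "x * y \<in> B (g \<otimes> h)"
proof -
  obtain a b where ab: "a \<in> A g" "x = P * a * Q" "b \<in> A h" "y = P * b * Q"
    using x y by (auto simp: B_def)
  have "a * (Q * P) \<in> A (g \<otimes> \<one>)" by (rule A_mult[OF g one_closed ab(1) QP_one])
  then have "a * (Q * P) * b \<in> A (g \<otimes> h)" using A_mult[OF g h _ ab(3)] g by simp
  moreover have "x * y = P * (a * (Q * P) * b) * Q"
    unfolding ab using A_dims[OF g ab(1)] A_dims[OF h ab(3)] by (simp add: mult_assoc_dim)
  ultimately show ?thesis by (auto simp: B_def)
qed

definition flag :: "nat \<Rightarrow> 'k mat set" where
  "flag k = pattern_mat N t (\<lambda>i j. i < s k)"

text \<open>Right multiplication by \<open>K * P\<close> preserves zero rows and so lifts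
  \<open>flag k\<close> into the graded ideal \<open>top_rows k\<close>; right multiplication by
  \<open>Q\<close> leads back and commutes with the projections.\<close>

lemma flag_graded:
  assumes k: "k \<le> m" shows "frame.W.graded_subset (flag k)"
proof -
  have "frame.W.\<pi> x g \<in> flag k" if x: "x \<in> flag k" and g: "g \<in> carrier G" for x g
  proof -
    have xc: "x \<in> carrier_mat N t" using x by (auto simp: flag_def pattern_mat_def)
    define b where "b = x * (K * P)"
    have "b = x * K * P" unfolding b_def using xc by (simp add: mult_assoc_dim)
    then have "b \<in> last_col" using mult_P_last_col[of "x * K"] xc K by auto
    then have bC: "b \<in> C" using last_col_subset by auto
    have "b * Q = x * (K * (P * Q))" unfolding b_def using xc by (simp add: mult_assoc_dim)
    then have bQ: "x = b * Q" using K xc by simp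
    have rows: "y * z \<in> pattern_mat N q (\<lambda>i j. i < s k)"
      if y: "y \<in> pattern_mat N p (\<lambda>i j. i < s k)" and z: "z \<in> carrier_mat p q" for y z :: "'k mat" and p q
    proof (rule pattern_matI)
      fix i j assume ij: "i < N" "j < q" "\<not> i < s k"
      have "(y * z) $$ (i, j) = (\<Sum>l<p. y $$ (i, l) * z $$ (l, j))"
        using y z ij by (intro times_mat_index) (auto simp: pattern_mat_def)
      also have "\<dots> = 0" using y ij by (intro sum.neutral) (auto simp: pattern_mat_def)
      finally show "(y * z) $$ (i, j) = 0" .
    qed (use y z in \<open>auto simp: pattern_mat_def\<close>)
    have "b \<in> pattern_mat N N (\<lambda>i j. i < s k)"
      unfolding b_def using x K P by (intro rows[of _ t]) (auto simp: flag_def)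
    then have "b \<in> top_rows k" using bC by (auto simp: top_rows_def pattern_mat_def)
    then have "\<pi> b g \<in> top_rows k" using top_rows_graded[OF k] g by (auto simp: graded_subset_def)
    then have "\<pi> b g * Q \<in> flag k"
      unfolding flag_def using Q by (intro rows[of _ N]) (auto simp: top_rows_def pattern_mat_def)
    moreover have "gproj N t (carrier G) W (b * Q) (id g) = \<pi> b g * Q"
      by (rule proj_map[OF graded_mats_axioms W_graded, where f = "\<lambda>a. a * Q"])
         (use Q bC g mult_carrier_mat[OF C_carrier Q] add_mult_distrib_mat[OF C_carrier C_carrier Q]
            left_mult_zero_mat[OF Q, of N] in \<open>simp_all add: W_def\<close>)
    ultimately show ?thesis using bQ by simp
  qed
  then show ?thesis
    using mat_subspace_pattern[of N t "\<lambda>i j. i < s k"]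
    by (auto simp: frame.W.graded_subset_def flag_def pattern_mat_def)
qed

end

section \<open>Gradings and the tensor product in coordinates\<close>

lemma subspace_mat_subspace:
  assumes "VectorSpace.subspace class_ring S (full_mat_alg n\<lparr>carrier := C\<rparr>)" "C \<subseteq> carrier_mat n n"
  shows "mat_subspace n n S" "S \<subseteq> C"
proof -
  have *: "submodule class_ring S (full_mat_alg n\<lparr>carrier := C\<rparr>)"
    using assms(1) by (simp add: VectorSpace.subspace_def)
  show "S \<subseteq> C" using submodule.subset[OF *] by simp
  then show "mat_subspace n n S"
    using assms(2) submodule.m_closed[OF *] submodule.zero_closed[OF *] submodule.smult_closed[OF *]
    by (intro mat_subspaceI) (auto simp: module_mat_simps)
qed

lemma submodule_full_mat:
  assumes "mat_subspace n n (S :: 'k :: field mat set)"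
  shows "submodule class_ring S (full_mat_alg n)"
proof -
  have "Module.module (class_ring :: 'k ring) (full_mat_alg n)"
    using matrix_vs[of n n, where 'a = 'k] by (simp add: vectorspace_def)
  then show ?thesis
    using mat_subspaceD[OF assms] by (auto simp: submodule_def module_mat_simps)
qed

lemma subspace_full_mat:
  assumes "mat_subspace n n (S :: 'k :: field mat set)"
  shows "VectorSpace.subspace class_ring S (full_mat_alg n)"
  using submodule_full_mat[OF assms] matrix_vs[of n n, where 'a = 'k] by (simp add: VectorSpace.subspace_def)

lemma mat_span_props:
  assumes "S \<subseteq> carrier_mat n n"
  shows "S \<subseteq> mat_span n S" "mat_subspace n n (mat_span n (S :: 'k :: field mat set))"
    "mat_subspace n n T \<Longrightarrow> S \<subseteq> T \<Longrightarrow> mat_span n S \<subseteq> T"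
proof -
  interpret module "class_ring :: 'k ring" "full_mat_alg n :: ('k, 'k mat) module"
    using matrix_vs[of n n, where 'a = 'k] by (simp add: vectorspace_def)
  have S: "S \<subseteq> carrier (full_mat_alg n)" using assms by (simp add: module_mat_simps)
  show "S \<subseteq> mat_span n S" by (rule in_own_span[OF S])
  have *: "submodule class_ring (mat_span n S) (full_mat_alg n)" by (rule span_is_submodule[OF S])
  show "mat_subspace n n (mat_span n S)"
    using submodule.subset[OF *] submodule.m_closed[OF *] submodule.zero_closed[OF *] submodule.smult_closed[OF *]
    by (intro mat_subspaceI) (auto simp: module_mat_simps)
  show "mat_span n S \<subseteq> T" if "mat_subspace n n T" "S \<subseteq> T"
    using span_is_subset[OF that(2) submodule_full_mat[OF that(1)]] .
qed

lemma finsum_msum: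
  fixes M :: "('k :: field, 'k mat) module"
  assumes "abelian_monoid M" "carrier M \<subseteq> carrier_mat n n" "\<And>x y. x \<oplus>\<^bsub>M\<^esub> y = x + y" "\<zero>\<^bsub>M\<^esub> = 0\<^sub>m n n"
    and "finite F" "\<And>g. g \<in> F \<Longrightarrow> f g \<in> carrier M"
  shows "finsum M f F = msum n n F f"
proof -
  interpret abelian_monoid M by fact
  show ?thesis
    using assms(5,6)
  proof (induction F)
    case (insert x F)
    then have "finsum M f (insert x F) = f x \<oplus>\<^bsub>M\<^esub> finsum M f F"
      by (intro finsum_insert) auto
    then show ?case
      using insert assms(2,3) by (subst msum_insert) auto
  qed (simp add: assms(4))
qed

text \<open>Independence is uniqueness of the decomposition of the zero matrix: a homogeneous family
  with sum zero, extended by zero to the whole group, must be the zero family.\<close>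

lemma graded_mats_of_grading:
  fixes \<A> :: "'g \<Rightarrow> 'k :: field mat set" and G (structure)
  assumes "group G" and C: "C \<subseteq> carrier_mat n n"
    and grading: "is_grading G (full_mat_alg n\<lparr>carrier := C\<rparr>) \<A>"
  shows "graded_mats n n C (carrier G) \<A>"
proof -
  interpret group G by fact
  let ?M = "full_mat_alg n\<lparr>carrier := C\<rparr> :: ('k, 'k mat) module"
  have sub: "VectorSpace.subspace class_ring (\<A> g) ?M" if "g \<in> carrier G" for g
    using grading that unfolding is_grading_def by blast
  have vs: "vectorspace class_ring ?M" using sub[OF one_closed] by (simp add: VectorSpace.subspace_def)
  have ab: "abelian_monoid ?M"
    using vs by (simp add: vectorspace_def module_def abelian_group_def)
  have finsum: "finsum ?M f F = msum n n F f" if "finite F" "\<And>g. g \<in> F \<Longrightarrow> f g \<in> C" for f F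
    using finsum_msum[OF ab, of n F f] C that by (simp add: module_mat_simps)
  have ms: "mat_subspace n n (\<A> g)" "\<A> g \<subseteq> C" if "g \<in> carrier G" for g
    using subspace_mat_subspace[OF sub[OF that] C] by blast+
  have whole: "mat_subspace n n C"
  proof (rule mat_subspaceI)
    interpret m: Module.module class_ring ?M using vs by (simp add: vectorspace_def)
    show "x \<in> carrier_mat n n" if "x \<in> C" for x using that C by blast
    show "0\<^sub>m n n \<in> C" using m.zero_closed by (simp add: module_mat_simps)
    show "x + y \<in> C" if "x \<in> C" "y \<in> C" for x y
      using m.add.m_closed that by (simp add: module_mat_simps)
    show "c \<cdot>\<^sub>m x \<in> C" if "x \<in> C" for c x
      using m.smult_closed that by (simp add: module_mat_simps)
  qed
  have ex1: "\<exists>!f. f \<in> (\<Pi>\<^sub>E g\<in>carrier G. \<A> g) \<and> finite {g \<in> carrier G. f g \<noteq> 0\<^sub>m n n} \<and>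
        x = finsum ?M f {g \<in> carrier G. f g \<noteq> 0\<^sub>m n n}" if "x \<in> C" for x
    using grading that unfolding is_grading_def by (simp add: module_mat_simps)
  show ?thesis
  proof
    show "\<exists>F a. finite F \<and> F \<subseteq> carrier G \<and> (\<forall>g\<in>F. a g \<in> \<A> g) \<and> x = msum n n F a" if x: "x \<in> C" for x
    proof -
      obtain f where f: "f \<in> (\<Pi>\<^sub>E g\<in>carrier G. \<A> g)" "finite {g \<in> carrier G. f g \<noteq> 0\<^sub>m n n}"
        "x = finsum ?M f {g \<in> carrier G. f g \<noteq> 0\<^sub>m n n}"
        using ex1[OF x] by blast
      have fA: "f g \<in> \<A> g" if "g \<in> carrier G" for g using f(1) that by blast
      have "x = msum n n {g \<in> carrier G. f g \<noteq> 0\<^sub>m n n} f"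
        unfolding f(3) using fA ms(2) by (intro finsum f(2)) blast
      then show ?thesis using f(2) fA by (intro exI[of _ "{g \<in> carrier G. f g \<noteq> 0\<^sub>m n n}"] exI[of _ f]) auto
    qed
  next
    fix F a g
    assume F: "finite F" "F \<subseteq> carrier G" "\<And>g. g \<in> F \<Longrightarrow> a g \<in> \<A> g"
      and z: "msum n n F a = 0\<^sub>m n n" and g: "g \<in> F"
    define f where "f = (\<lambda>g\<in>carrier G. if g \<in> F then a g else 0\<^sub>m n n)"
    define f0 where "f0 = (\<lambda>g\<in>carrier G. 0\<^sub>m n n :: 'k mat)"
    have f0: "f0 \<in> (\<Pi>\<^sub>E g\<in>carrier G. \<A> g)" "{g \<in> carrier G. f0 g \<noteq> 0\<^sub>m n n} = {}"
      using mat_subspaceD(2)[OF ms(1)] by (auto simp: f0_def)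
    have f: "f \<in> (\<Pi>\<^sub>E g\<in>carrier G. \<A> g)" "{g \<in> carrier G. f g \<noteq> 0\<^sub>m n n} \<subseteq> F"
      using mat_subspaceD(2)[OF ms(1)] F by (auto simp: f_def)
    have "finsum ?M f {g \<in> carrier G. f g \<noteq> 0\<^sub>m n n} = msum n n {g \<in> carrier G. f g \<noteq> 0\<^sub>m n n} f"
    proof (rule finsum)
      show "finite {g \<in> carrier G. f g \<noteq> 0\<^sub>m n n}" using f(2) F(1) finite_subset by blast
      show "f g \<in> C" if "g \<in> {g \<in> carrier G. f g \<noteq> 0\<^sub>m n n}" for g
        using f(1) ms(2) that by blast
    qed
    also have "\<dots> = msum n n F f"
      using F f by (intro msum_mono_neutral[symmetric]) auto
    also have "\<dots> = msum n n F a" using F(2) by (intro msum_cong) (auto simp: f_def)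
    finally have sum_f: "finsum ?M f {g \<in> carrier G. f g \<noteq> 0\<^sub>m n n} = 0\<^sub>m n n" using z by simp
    have sum_f0: "finsum ?M f0 {g \<in> carrier G. f0 g \<noteq> 0\<^sub>m n n} = 0\<^sub>m n n"
      unfolding f0(2) using finsum[of "{}" f0] by simp
    have "f = f0"
      using ex1[OF mat_subspaceD(2)[OF whole]] f f0 sum_f sum_f0 finite_subset[OF f(2) F(1)]
      by (metis (no_types, lifting) finite.emptyI)
    then have "f g = f0 g" by simp
    then show "a g = 0\<^sub>m n n" using g F(2) by (auto simp: f_def f0_def)
  qed (use whole ms in auto)
qed

lemma grading_mult:
  assumes "is_grading G (full_mat_alg n\<lparr>carrier := C\<rparr>) \<A>" "g \<in> carrier G" "h \<in> carrier G"
    "x \<in> \<A> g" "y \<in> \<A> h"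
  shows "x * y \<in> \<A> (g \<otimes>\<^bsub>G\<^esub> h)"
  using assms unfolding is_grading_def by (simp add: module_mat_simps)

lemma grading_of_graded_mats:
  fixes \<B> :: "'g \<Rightarrow> 'k :: field mat set" and G (structure)
  assumes gr: "graded_mats t t (carrier_mat t t) (carrier G) \<B>" and H: "H \<subseteq> carrier G"
    and supp: "\<And>g. g \<in> carrier G \<Longrightarrow> g \<notin> H \<Longrightarrow> \<B> g = {0\<^sub>m t t}"
    and mult: "\<And>g h x y. g \<in> H \<Longrightarrow> h \<in> H \<Longrightarrow> x \<in> \<B> g \<Longrightarrow> y \<in> \<B> h \<Longrightarrow> x * y \<in> \<B> (g \<otimes> h)"
  shows "is_grading (G\<lparr>carrier := H\<rparr>) (full_mat_alg t) \<B>"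
proof -
  interpret B: graded_mats t t "carrier_mat t t" "carrier G" \<B> by fact
  let ?M = "full_mat_alg t :: ('k, 'k mat) module"
  have ab: "abelian_monoid ?M"
    using abelian_group_mat[where 'a = 'k] by (simp add: abelian_group_def)
  have finsum: "finsum ?M f F = msum t t F f" if "finite F" "\<And>g. g \<in> F \<Longrightarrow> f g \<in> carrier_mat t t" for f F
    using finsum_msum[OF ab, of t F f] that by (simp add: module_mat_simps)
  have "\<exists>!f. f \<in> (\<Pi>\<^sub>E g\<in>H. \<B> g) \<and> finite {g \<in> H. f g \<noteq> 0\<^sub>m t t} \<and>
        x = finsum ?M f {g \<in> H. f g \<noteq> 0\<^sub>m t t}" if x: "x \<in> carrier_mat t t" for x
  proof (rule ex1I)
    let ?f = "\<lambda>g\<in>H. B.\<pi> x g"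
    obtain F where F: "finite F" "F \<subseteq> carrier G" "x = msum t t F (B.\<pi> x)" "\<And>g. g \<notin> F \<Longrightarrow> B.\<pi> x g = 0\<^sub>m t t"
      by (rule B.proj_sum[OF x], rule that)
    have sub: "{g \<in> H. ?f g \<noteq> 0\<^sub>m t t} \<subseteq> F" using F(4) by auto
    then have fin: "finite {g \<in> H. ?f g \<noteq> 0\<^sub>m t t}" using F(1) finite_subset by blast
    \<comment> \<open>Components in degrees outside \<open>H\<close> vanish, so restricting the
      family to \<open>H\<close> loses nothing of \<open>x\<close>.\<close>
    have out: "B.\<pi> x g = 0\<^sub>m t t" if "g \<in> carrier G" "g \<notin> H" for g
      using B.proj_in[OF x that(1)] supp[OF that] by simp
    have c: "?f g \<in> carrier_mat t t" if "g \<in> {g \<in> H. ?f g \<noteq> 0\<^sub>m t t}" for g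
      using B.proj_carrier[OF x] H that by auto
    have "x = msum t t {g \<in> H. ?f g \<noteq> 0\<^sub>m t t} (B.\<pi> x)"
      using out by (intro B.proj_sum_superset x fin) auto
    also have "\<dots> = msum t t {g \<in> H. ?f g \<noteq> 0\<^sub>m t t} ?f" by (intro msum_cong) auto
    also have "\<dots> = finsum ?M ?f {g \<in> H. ?f g \<noteq> 0\<^sub>m t t}" by (rule finsum[OF fin c, symmetric])
    finally show "?f \<in> (\<Pi>\<^sub>E g\<in>H. \<B> g) \<and> finite {g \<in> H. ?f g \<noteq> 0\<^sub>m t t} \<and>
        x = finsum ?M ?f {g \<in> H. ?f g \<noteq> 0\<^sub>m t t}"
      using fin B.proj_in[OF x] H by auto
  next
    fix f assume f: "f \<in> (\<Pi>\<^sub>E g\<in>H. \<B> g) \<and> finite {g \<in> H. f g \<noteq> 0\<^sub>m t t} \<and>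
        x = finsum ?M f {g \<in> H. f g \<noteq> 0\<^sub>m t t}"
    let ?F = "{g \<in> H. f g \<noteq> 0\<^sub>m t t}"
    have fB: "f g \<in> \<B> g" if "g \<in> H" for g using f that by blast
    have "x = msum t t ?F f"
      using f finsum[of ?F f] fB B.S_carrier H by auto
    then have "B.\<pi> x g = (if g \<in> ?F then f g else 0\<^sub>m t t)" if "g \<in> H" for g
    proof -
      have F: "finite ?F" "?F \<subseteq> carrier G" "\<And>g. g \<in> ?F \<Longrightarrow> f g \<in> \<B> g" using f H fB by auto
      have "B.\<pi> (msum t t ?F f) g = (if g \<in> ?F then f g else 0\<^sub>m t t)"
        using that H by (intro B.proj_unique[OF F]) auto
      then show ?thesis using \<open>x = msum t t ?F f\<close> by simp
    qed
    then have "B.\<pi> x g = f g" if "g \<in> H" for g using that by (cases "f g = 0\<^sub>m t t") auto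
    then show "f = (\<lambda>g\<in>H. B.\<pi> x g)" using f by (intro ext) (auto simp: PiE_def extensional_def)
  qed
  then show ?thesis
    unfolding is_grading_def using H subspace_full_mat[OF B.comp] mult
    by (auto simp: module_mat_simps)
qed

lemma dim_le_1:
  assumes "mat_subspace t t (S :: 'k :: field mat set)" "x \<in> S" "\<And>y. y \<in> S \<Longrightarrow> \<exists>c. y = c \<cdot>\<^sub>m x"
  shows "vectorspace.fin_dim class_ring (full_mat_alg t\<lparr>carrier := S\<rparr>)"
    "vectorspace.dim class_ring (full_mat_alg t\<lparr>carrier := S\<rparr>) \<le> 1"
proof -
  let ?V = "full_mat_alg t\<lparr>carrier := S\<rparr> :: ('k, 'k mat) module"
  interpret V: vectorspace "class_ring :: 'k ring" ?V
    using vectorspace.subspace_is_vs[OF matrix_vs subspace_full_mat[OF assms(1)]] .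
  have x: "{x} \<subseteq> carrier ?V" using assms(2) by simp
  have *: "submodule class_ring (V.span {x}) ?V" by (rule V.span_is_submodule[OF x])
  have "V.span {x} = carrier ?V"
  proof
    show "V.span {x} \<subseteq> carrier ?V" by (rule V.span_is_subset2[OF x])
    show "carrier ?V \<subseteq> V.span {x}"
    proof
      fix y assume "y \<in> carrier ?V"
      then obtain c where c: "y = c \<cdot>\<^sub>m x" using assms(3) by auto
      have "x \<in> V.span {x}" using V.in_own_span[OF x] by blast
      then have "c \<odot>\<^bsub>?V\<^esub> x \<in> V.span {x}" using submodule.smult_closed[OF *] by simp
      then show "y \<in> V.span {x}" by (simp add: c module_mat_simps)
    qed
  qed
  then show "V.fin_dim" "V.dim \<le> 1"
    using V.gen_ge_dim[of "{x}"] x by (auto simp: V.fin_dim_def intro: exI[of _ "{x}"])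
qed

section \<open>Block-triangular matrices as patterns\<close>

definition block_start :: "nat list \<Rightarrow> nat \<Rightarrow> nat" where
  "block_start ds k = sum_list (take k ds)"

lemma block_start_Suc: "k < length ds \<Longrightarrow> block_start ds (Suc k) = block_start ds k + ds ! k"
  by (simp add: block_start_def take_Suc_conv_app_nth)

lemma block_start_0 [simp]: "block_start ds 0 = 0"
  and block_start_length [simp]: "block_start ds (length ds) = sum_list ds"
  by (simp_all add: block_start_def)

lemma block_start_mono: "k \<le> l \<Longrightarrow> l \<le> length ds \<Longrightarrow> block_start ds k \<le> block_start ds l"
  by (induction rule: inc_induct) (auto simp: block_start_Suc)

lemma block_of_index:
  assumes "i < block_start ds m" "m \<le> length ds"
  obtains k where "k < m" "block_start ds k \<le> i" "i < block_start ds k + ds ! k"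
  using assms
proof (induction m arbitrary: thesis)
  case (Suc m)
  show ?case
  proof (cases "i < block_start ds m")
    case True
    then show ?thesis using Suc.IH[of thesis] Suc.prems(1,3) by (metis Suc_leD less_SucI)
  next
    case False
    then show ?thesis using Suc.prems(1)[of m] Suc.prems(2,3) block_start_Suc[of m ds] by simp
  qed
qed simp

text \<open>An entry lies below the diagonal blocks exactly when some block boundary lies beyond its
  column but not beyond its row; locating both indices in their blocks translates one condition into
  the other.\<close>

lemma UT_pattern:
  "UT ds = pattern_mat (sum_list ds) (sum_list ds) (flag_rel (length ds) (block_start ds))"
proof (rule Set.set_eqI, rule iffI)
  fix a :: "'k :: field mat" assume a: "a \<in> UT ds"
  show "a \<in> pattern_mat (sum_list ds) (sum_list ds) (flag_rel (length ds) (block_start ds))"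
  proof (rule pattern_matI)
    fix i j assume ij: "i < sum_list ds" "j < sum_list ds" "\<not> flag_rel (length ds) (block_start ds) i j"
    then obtain k0 where k0: "k0 \<le> length ds" "j < block_start ds k0" "block_start ds k0 \<le> i"
      by (auto simp: flag_rel_def not_less)
    obtain k where k: "k < length ds" "block_start ds k \<le> i" "i < block_start ds k + ds ! k"
      using block_of_index[of i ds "length ds"] ij by auto
    obtain l where l: "l < k0" "block_start ds l \<le> j" "j < block_start ds l + ds ! l"
      using block_of_index[OF k0(2,1)] by blast
    have "k0 \<le> k"
    proof (rule ccontr)
      assume "\<not> k0 \<le> k"
      then have "block_start ds (Suc k) \<le> block_start ds k0" using k0 by (intro block_start_mono) auto
      then show False using k k0 by (simp add: block_start_Suc)
    qed
    then have "l < k" "l < length ds" using l k by auto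
    then have "a $$ (block_start ds k + p, block_start ds l + q) = 0" if "p < ds ! k" "q < ds ! l" for p q
      using a k that unfolding UT_def block_start_def by blast
    from this[of "i - block_start ds k" "j - block_start ds l"] show "a $$ (i, j) = 0"
      using k l by simp
  qed (use a in \<open>auto simp: UT_def\<close>)
next
  fix a :: "'k :: field mat"
  assume a: "a \<in> pattern_mat (sum_list ds) (sum_list ds) (flag_rel (length ds) (block_start ds))"
  have "a $$ (block_start ds k + p, block_start ds l + q) = 0"
    if "k < length ds" "l < length ds" "p < ds ! k" "q < ds ! l" "l < k" for k l p q
  proof (rule pattern_matD(2)[OF a])
    have "block_start ds (Suc k) \<le> sum_list ds" "block_start ds (Suc l) \<le> sum_list ds"
      using block_start_mono[of _ "length ds" ds] that by simp_all
    then show "block_start ds k + p < sum_list ds" "block_start ds l + q < sum_list ds"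
      using that by (simp_all add: block_start_Suc)
    have "block_start ds (Suc l) \<le> block_start ds k" using that by (intro block_start_mono) auto
    then show "\<not> flag_rel (length ds) (block_start ds) (block_start ds k + p) (block_start ds l + q)"
      using that unfolding flag_rel_def by (auto intro!: exI[of _ k] simp: block_start_Suc)
  qed
  then show "a \<in> UT ds" using a unfolding UT_def block_start_def by (auto simp: pattern_mat_def)
qed

lemma matrix_unit_UT:
  assumes "i < sum_list ds" "j < sum_list ds"
  shows "(matrix_unit (sum_list ds) i j :: 'k :: field mat) \<in> UT ds \<longleftrightarrow>
    flag_rel (length ds) (block_start ds) i j"
proof
  assume "(matrix_unit (sum_list ds) i j :: 'k mat) \<in> UT ds"
  then show "flag_rel (length ds) (block_start ds) i j"
    using assms pattern_matD(2)[of "matrix_unit (sum_list ds) i j :: 'k mat" "sum_list ds" "sum_list ds" _ i j]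
    unfolding UT_pattern by fastforce
qed (auto simp: UT_pattern pattern_mat_def)

section \<open>Square blocks and Kronecker products\<close>

definition subblock :: "nat \<Rightarrow> 'k :: field mat \<Rightarrow> nat \<Rightarrow> nat \<Rightarrow> 'k mat" where
  "subblock t M i j = mat t t (\<lambda>(p, q). M $$ (i * t + p, j * t + q))"

lemma subblock_carrier [simp]: "subblock t M i j \<in> carrier_mat t t"
  by (simp add: subblock_def)

lemma kron_index:
  assumes "A \<in> carrier_mat n n" "B \<in> carrier_mat t t" "i < n * t" "j < n * t"
  shows "kron A B $$ (i, j) = A $$ (i div t, j div t) * B $$ (i mod t, j mod t)"
  using assms by (auto simp: kron_def)

lemma kron_carrier: "A \<in> carrier_mat n n \<Longrightarrow> B \<in> carrier_mat t t \<Longrightarrow> kron A B \<in> carrier_mat (n * t) (n * t)"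
  by (auto simp: kron_def)

lemma kron_unit_zero: "kron (matrix_unit n i j) (0\<^sub>m t t) = (0\<^sub>m (n * t) (n * t) :: 'k :: field mat)"
proof (rule eq_matI)
  fix r c assume "r < dim_row (0\<^sub>m (n * t) (n * t) :: 'k mat)" "c < dim_col (0\<^sub>m (n * t) (n * t) :: 'k mat)"
  then have rc: "r < n * t" "c < n * t" by auto
  then have "0 < t" by (auto intro!: Nat.gr0I)
  then show "kron (matrix_unit n i j) (0\<^sub>m t t) $$ (r, c) = (0\<^sub>m (n * t) (n * t) :: 'k mat) $$ (r, c)"
    using rc by (subst kron_index[of _ n]) auto
qed (auto simp: kron_def matrix_unit_def)

lemma kron_expand:
  assumes M: "M \<in> carrier_mat (n * t) (n * t)"
  shows "M = msum (n * t) (n * t) ({..<n} \<times> {..<n}) (\<lambda>(i, j). kron (matrix_unit n i j) (subblock t M i j))"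
    (is "_ = ?R")
proof (rule eq_matI)
  fix r c assume "r < dim_row ?R" "c < dim_col ?R"
  then have rc: "r < n * t" "c < n * t" by auto
  then have t: "0 < t" by (auto intro!: Nat.gr0I)
  have d: "r div t < n" "c div t < n" using rc by (simp_all add: less_mult_imp_div_less)
  have "(case p of (i, j) \<Rightarrow> kron (matrix_unit n i j) (subblock t M i j)) $$ (r, c) =
      (if p = (r div t, c div t) then M $$ (r, c) else 0)" for p
  proof -
    obtain i j where p: "p = (i, j)" by force
    have "kron (matrix_unit n i j) (subblock t M i j) $$ (r, c) =
        matrix_unit n i j $$ (r div t, c div t) * subblock t M i j $$ (r mod t, c mod t)"
      by (rule kron_index[OF matrix_unit_carrier subblock_carrier rc])
    then show ?thesis using d t by (auto simp: p subblock_def)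
  qed
  then have "?R $$ (r, c) = (\<Sum>p\<in>{..<n} \<times> {..<n}. if p = (r div t, c div t) then M $$ (r, c) else 0)"
    using rc by simp
  then show "M $$ (r, c) = ?R $$ (r, c)" using d by simp
qed (use M in auto)

text \<open>Only nonzero blocks have to give generators. In the graded application a zero block may
  sit in a degree outside the support, where no generator is on offer, but it contributes the zero
  matrix.\<close>

lemma in_span_by_blocks:
  fixes M :: "'k :: field mat"
  assumes M: "M \<in> carrier_mat (n * t) (n * t)" and S: "S \<subseteq> carrier_mat (n * t) (n * t)"
    and blocks: "\<And>i j. i < n \<Longrightarrow> j < n \<Longrightarrow> subblock t M i j \<noteq> 0\<^sub>m t t \<Longrightarrow>
      kron (matrix_unit n i j) (subblock t M i j) \<in> S"
  shows "M \<in> mat_span (n * t) S"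
proof -
  note span = mat_span_props[OF S]
  have "(\<lambda>(i, j). kron (matrix_unit n i j) (subblock t M i j)) p \<in> mat_span (n * t) S"
    if p: "p \<in> {..<n} \<times> {..<n}" for p
  proof -
    obtain i j where ij: "p = (i, j)" "i < n" "j < n" using p by auto
    show ?thesis
    proof (cases "subblock t M i j = 0\<^sub>m t t")
      case True
      then show ?thesis using mat_subspaceD(2)[OF span(2)] by (simp add: ij kron_unit_zero)
    next
      case False
      then show ?thesis using blocks[OF ij(2,3)] span(1) by (auto simp: ij(1))
    qed
  qed
  then have "msum (n * t) (n * t) ({..<n} \<times> {..<n})
      (\<lambda>(i, j). kron (matrix_unit n i j) (subblock t M i j)) \<in> mat_span (n * t) S"
    by (intro mat_subspace_msum[OF span(2)]) auto
  then show ?thesis using kron_expand[OF M] by simp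
qed

lemma block_start_map_mult:
  "block_start (map (\<lambda>p. p * t) ps) k = block_start ps k * t"
proof -
  have "sum_list (map (\<lambda>p. p * t) qs) = sum_list qs * t" for qs :: "nat list"
    by (induction qs) (auto simp: distrib_right)
  then show ?thesis by (simp add: block_start_def take_map)
qed

lemma flag_rel_blocks:
  assumes "0 < t"
  shows "flag_rel m (\<lambda>k. s k * t) i j \<longleftrightarrow> flag_rel m s (i div t) (j div t)"
  unfolding flag_rel_def using assms by (simp add: div_less_iff_less_mult)

lemma UT_tensor_carrier:
  fixes ps :: "nat list"
  assumes t: "0 < t"
  shows "carrier (UT_tensor ps t :: ('k :: field, 'k mat) module) = UT (map (\<lambda>p. p * t) ps)"
proof -
  let ?n = "sum_list ps"
  let ?S = "{kron A B |A B. A \<in> (UT ps :: 'k mat set) \<and> B \<in> carrier_mat t t}"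
  let ?U = "UT (map (\<lambda>p. p * t) ps) :: 'k mat set"
  have n: "sum_list (map (\<lambda>p. p * t) ps) = ?n * t"
    using block_start_map_mult[of t ps "length ps"] block_start_length[of "map (\<lambda>p. p * t) ps"] by simp
  have bs: "block_start (map (\<lambda>p. p * t) ps) = (\<lambda>k. block_start ps k * t)"
    by (rule ext) (rule block_start_map_mult)
  have U: "?U = pattern_mat (?n * t) (?n * t) (flag_rel (length ps) (\<lambda>k. block_start ps k * t))"
    unfolding UT_pattern n bs by simp
  have c: "A \<in> carrier_mat ?n ?n" if "A \<in> (UT ps :: 'k mat set)" for A using that by (simp add: UT_def)
  have S: "?S \<subseteq> carrier_mat (?n * t) (?n * t)"
    using c kron_carrier by blast
  have SU: "?S \<subseteq> ?U"
  proof
    fix x assume "x \<in> ?S"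
    then obtain A B where x: "x = kron A B" "A \<in> UT ps" "B \<in> carrier_mat t t" by blast
    show "x \<in> ?U" unfolding U
    proof (rule pattern_matI)
      show "x \<in> carrier_mat (?n * t) (?n * t)" using x c kron_carrier by blast
      fix i j assume ij: "i < ?n * t" "j < ?n * t" "\<not> flag_rel (length ps) (\<lambda>k. block_start ps k * t) i j"
      have "A $$ (i div t, j div t) = 0"
        using x(2) ij t unfolding UT_pattern flag_rel_blocks[OF t]
        by (intro pattern_matD(2)) (auto simp: less_mult_imp_div_less)
      then show "x $$ (i, j) = 0" using x c[OF x(2)] ij by (simp add: kron_index)
    qed
  qed
  have "mat_span (?n * t) ?S \<subseteq> ?U"
    by (rule mat_span_props(3)[OF S _ SU]) (simp add: U mat_subspace_pattern)
  moreover have "?U \<subseteq> mat_span (?n * t) ?S"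
  proof
    fix M assume M: "M \<in> ?U"
    show "M \<in> mat_span (?n * t) ?S"
    proof (rule in_span_by_blocks[OF _ S])
      show "M \<in> carrier_mat (?n * t) (?n * t)" using M pattern_matD(1) unfolding U by blast
      fix i j assume ij: "i < ?n" "j < ?n" "subblock t M i j \<noteq> 0\<^sub>m t t"
      have "flag_rel (length ps) (block_start ps) i j"
      proof (rule ccontr)
        assume nf: "\<not> flag_rel (length ps) (block_start ps) i j"
        have "M $$ (i * t + p, j * t + q) = 0" if "p < t" "q < t" for p q
          using nf that ij t
          by (intro pattern_matD(2)[OF M[unfolded U]]) (auto simp: mult_add_less_mult flag_rel_blocks)
        then have "subblock t M i j = 0\<^sub>m t t" by (intro eq_matI) (auto simp: subblock_def)
        then show False using ij by simp
      qed
      then show "kron (matrix_unit ?n i j) (subblock t M i j) \<in> ?S"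
        using matrix_unit_UT[OF ij(1,2)] by (auto intro!: exI subblock_carrier)
    qed
  qed
  ultimately show ?thesis by (auto simp: UT_tensor_def)
qed

section \<open>The structure theorem\<close>

text \<open>Algebraic closure enters here: the characteristic polynomial has positive degree, so an
  eigenvalue exists.\<close>

lemma char_matrix_singular:
  fixes z :: "'k :: alg_closed_field mat"
  assumes z: "z \<in> carrier_mat t t" and t: "0 < t"
  shows "\<exists>c. det (z + c \<cdot>\<^sub>m 1\<^sub>m t) = 0"
proof -
  obtain e where "poly (char_poly z) e = 0"
    using alg_closed_imp_poly_has_root[of "char_poly z"] degree_monic_char_poly[OF z] t by auto
  then have "det (char_matrix z e) = 0"
    using eigenvalue_root_char_poly[OF z] eigenvalue_det[OF z] by simp
  then show ?thesis using z by (auto simp: char_matrix_def)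
qed

context graded_module
begin

lemma free_family_coeffs_unique:
  assumes hom: "hom_family r Y \<gamma>" and free: "free_family r Y"
    and c: "c \<in> coeffs r" "d \<in> coeffs r" "comb r Y c = comb r Y d" and i: "i < r"
  shows "c i = d i"
proof -
  \<comment> \<open>Subtraction is written as right multiplication by this matrix, so that the
    difference is again a combination with matrix coefficients.\<close>
  let ?m = "(-1) \<cdot>\<^sub>m 1\<^sub>m t :: 'k mat"
  have Yc: "\<And>i. i < r \<Longrightarrow> Y i \<in> carrier_mat N t" using hom_family_carrier[OF hom] .
  have m: "x * ?m = (-1) \<cdot>\<^sub>m x" if "x \<in> carrier_mat n t" for x n
    using mult_smult_distrib[OF that one_carrier_mat, of "-1"] right_mult_one_mat[OF that] by simp
  have dm: "(\<lambda>i. d i * ?m) \<in> coeffs r" using c(2) by (auto simp: coeffs_def)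
  have x: "comb r Y c \<in> carrier_mat N t" by (simp add: comb_def)
  have "comb r Y (\<lambda>i. c i + d i * ?m) = comb r Y c + comb r Y d * ?m"
    using comb_add[of r Y c "\<lambda>i. d i * ?m"] comb_mult[of r Y d ?m] Yc c dm by simp
  also have "\<dots> = 0\<^sub>m N t" unfolding c(3)[symmetric] m[OF x] using x by (intro eq_matI) auto
  finally have "comb r Y (\<lambda>i. c i + d i * ?m) = 0\<^sub>m N t" .
  moreover have "(\<lambda>i. c i + d i * ?m) \<in> coeffs r" using c dm by (auto simp: coeffs_def)
  ultimately have z: "c i + d i * ?m = 0\<^sub>m t t" using free i unfolding free_family_def by blast
  have ci: "c i \<in> carrier_mat t t" "d i \<in> carrier_mat t t" using c i by (auto simp: coeffs_def)
  show ?thesis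
  proof (rule eq_matI)
    fix p q assume "p < dim_row (d i)" "q < dim_col (d i)"
    then have pq: "p < t" "q < t" using ci by auto
    have "(c i + (-1) \<cdot>\<^sub>m d i) $$ (p, q) = 0" using z pq unfolding m[OF ci(2)] by simp
    then show "c i $$ (p, q) = d i $$ (p, q)" using ci pq by simp
  qed (use ci in auto)
qed

text \<open>A homogeneous combination is its own projection, so uniqueness of coefficients equates
  each \<open>c i\<close> with one of its components.\<close>

lemma homogeneous_comb_coeffs:
  assumes hom: "hom_family r Y \<gamma>" and free: "free_family r Y" and c: "c \<in> coeffs r"
    and g: "g \<in> carrier G" and W: "comb r Y c \<in> W g" and i: "i < r"
  shows "c i \<in> B (inv (\<gamma> i) \<otimes> g)"
proof -
  have "comb r Y c = W.\<pi> (comb r Y c) g" using W.proj_homogeneous[OF g W g] by simp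
  also have "\<dots> = comb r Y (\<lambda>i. B.\<pi> (c i) (inv (\<gamma> i) \<otimes> g))" by (rule proj_comb[OF hom c g])
  finally have "c i = B.\<pi> (c i) (inv (\<gamma> i) \<otimes> g)"
    using free_family_coeffs_unique[OF hom free c proj_coeffs[OF hom c g] _ i] by simp
  moreover have "B.\<pi> (c i) (inv (\<gamma> i) \<otimes> g) \<in> B (inv (\<gamma> i) \<otimes> g)"
    using c i g hom_familyD(1)[OF hom i] by (intro B.proj_in) (auto simp: coeffs_def)
  ultimately show ?thesis by simp
qed

end

text \<open>A graded division algebra is a module over itself.\<close>

locale graded_division = graded_module G t t B B
  for G :: "('g, 'c) monoid_scheme" (structure) and t :: nat and B :: "'g \<Rightarrow> 'k :: field mat set"
begin

definition support :: "'g set" where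
  "support = {g \<in> carrier G. B g \<noteq> {0\<^sub>m t t}}"

lemma supportE:
  assumes "g \<in> support"
  obtains x where "g \<in> carrier G" "x \<in> B g" "x \<noteq> 0\<^sub>m t t" "x \<in> carrier_mat t t"
proof -
  have g: "g \<in> carrier G" "B g \<noteq> {0\<^sub>m t t}" using assms by (auto simp: support_def)
  then obtain x where x: "x \<in> B g" "x \<noteq> 0\<^sub>m t t"
    using mat_subspaceD(2)[OF W.comp[OF g(1)]] by blast
  then show ?thesis using that[OF g(1) x] W.S_carrier g by blast
qed

lemma supportI: "g \<in> carrier G \<Longrightarrow> x \<in> B g \<Longrightarrow> x \<noteq> 0\<^sub>m t t \<Longrightarrow> g \<in> support"
  by (auto simp: support_def)

lemma one_neq_zero: "1\<^sub>m t \<noteq> (0\<^sub>m t t :: 'k mat)"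
proof
  assume "1\<^sub>m t = (0\<^sub>m t t :: 'k mat)"
  then have "1\<^sub>m t $$ (0, 0) = (0\<^sub>m t t $$ (0, 0) :: 'k)" by simp
  then show False using t_pos by simp
qed

text \<open>For components \<open>?u h\<close>, \<open>?u g\<close> of the identity with
  \<open>g \<noteq> \<one>\<close>, their product is the part of \<open>?u h\<close> in degree
  \<open>h \<otimes> g\<close>, hence zero. Summing over \<open>h\<close> turns the left factor into
  the identity, so \<open>?u g\<close> vanishes.\<close>

lemma one_in_B: "1\<^sub>m t \<in> B \<one>"
proof -
  let ?u = "W.\<pi> (1\<^sub>m t)"
  have u: "?u g \<in> carrier_mat t t" if "g \<in> carrier G" for g using W.proj_carrier that by simp
  obtain F where F: "finite F" "F \<subseteq> carrier G" "1\<^sub>m t = msum t t F ?u"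
    by (rule W.proj_sum[of "1\<^sub>m t"], simp, rule that)
  show ?thesis
  proof (rule W.proj_homogeneousD(2))
    fix g assume g: "g \<in> carrier G" "g \<noteq> \<one>"
    have "?u h * ?u g = 0\<^sub>m t t" if "h \<in> F" for h
    proof -
      have h: "h \<in> carrier G" using F that by blast
      have uh: "?u h \<in> B h" using W.proj_in h by simp
      have "h \<otimes> g \<noteq> h" using g h by simp
      then have "0\<^sub>m t t = W.\<pi> (?u h * 1\<^sub>m t) (h \<otimes> g)"
        using W.proj_homogeneous[OF h uh, of "h \<otimes> g"] h g u[OF h] by simp
      also have "\<dots> = ?u h * ?u (inv h \<otimes> (h \<otimes> g))"
        using proj_mult[OF h uh one_carrier_mat] h g by simp
      also have "inv h \<otimes> (h \<otimes> g) = g" using h g by (simp add: m_assoc[symmetric])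
      finally show ?thesis by simp
    qed
    then have "msum t t F (\<lambda>h. ?u h * ?u g) = msum t t F (\<lambda>_. 0\<^sub>m t t)" by (rule msum_cong)
    also have "\<dots> = 0\<^sub>m t t" by (intro eq_matI) auto
    also have "msum t t F (\<lambda>h. ?u h * ?u g) = msum t t F ?u * ?u g"
      by (rule msum_mult[symmetric]) (use F u g in auto)
    also have "\<dots> = 1\<^sub>m t * ?u g" using F(3) by simp
    finally show "?u g = 0\<^sub>m t t" using u[OF g(1)] by simp
  qed auto
qed

text \<open>The component of the ordinary inverse in degree \<open>inv h\<close> already is an
  inverse, since only it contributes to degree one of the product with \<open>x\<close>.\<close>

lemma homogeneous_inverse:
  assumes h: "h \<in> carrier G" and x: "x \<in> B h" "x \<noteq> 0\<^sub>m t t"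
  obtains w where "w \<in> B (inv h)" "w \<in> carrier_mat t t" "x * w = 1\<^sub>m t" "w * x = 1\<^sub>m t"
proof -
  have xc: "x \<in> carrier_mat t t" using W.S_carrier h x by blast
  obtain x' where x': "x' \<in> carrier_mat t t" "x * x' = 1\<^sub>m t"
    using det_nonzero_inverse[OF xc B_inv[OF h x]] by blast
  let ?w = "W.\<pi> x' (inv h)"
  have w: "?w \<in> B (inv h)" "?w \<in> carrier_mat t t" using W.proj_in W.proj_carrier x' h by simp_all
  have "x * ?w = W.\<pi> (x * x') \<one>" using proj_mult[OF h x(1) x'(1), of \<one>] h by simp
  also have "\<dots> = 1\<^sub>m t" using x'(2) W.proj_homogeneous[OF one_closed one_in_B one_closed] by simp
  finally have "x * ?w = 1\<^sub>m t" .
  then show ?thesis using that w mat_mult_left_right_inverse[OF xc w(2)] by blast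
qed

lemma support_subgroup: "subgroup support G"
proof (rule subgroupI)
  show "support \<subseteq> carrier G" by (auto simp: support_def)
  show "support \<noteq> {}" using supportI[OF one_closed one_in_B one_neq_zero] by blast
  fix g assume g: "g \<in> support"
  obtain x where x: "g \<in> carrier G" "x \<in> B g" "x \<noteq> 0\<^sub>m t t" "x \<in> carrier_mat t t" using supportE[OF g] .
  obtain w where w: "w \<in> B (inv g)" "w \<in> carrier_mat t t" "x * w = 1\<^sub>m t" "w * x = 1\<^sub>m t"
    using homogeneous_inverse[OF x(1-3)] .
  have "w \<noteq> 0\<^sub>m t t" using w(3) right_mult_zero_mat[OF x(4), of t] one_neq_zero by auto
  then show "inv g \<in> support" using supportI w x by blast
  fix h assume h: "h \<in> support"
  obtain y where y: "h \<in> carrier G" "y \<in> B h" "y \<noteq> 0\<^sub>m t t" "y \<in> carrier_mat t t" using supportE[OF h] .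
  have "x * y \<noteq> 0\<^sub>m t t"
  proof
    assume 0: "x * y = 0\<^sub>m t t"
    have "y = w * x * y" using w y by simp
    also have "\<dots> = w * (x * y)" by (rule assoc_mult_mat[OF w(2) x(4) y(4)])
    finally show False using y(3) 0 right_mult_zero_mat[OF w(2), of t] by simp
  qed
  then show "g \<otimes> h \<in> support" using supportI[OF _ W_B[OF x(1) y(1) x(2) y(2)]] x y by simp
qed

text \<open>Schur's argument: an element of degree one becomes singular after subtracting an
  eigenvalue, and singular homogeneous elements are zero, so that component consists of scalars. An
  invertible element of degree \<open>g\<close> carries this over to \<open>B g\<close>.\<close>

lemma component_dim_le_1:
  assumes eig: "\<And>z :: 'k mat. z \<in> carrier_mat t t \<Longrightarrow> \<exists>c. det (z + c \<cdot>\<^sub>m 1\<^sub>m t) = 0"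
    and g: "g \<in> carrier G"
  shows "vectorspace.fin_dim class_ring (full_mat_alg t\<lparr>carrier := B g\<rparr>) \<and>
    vectorspace.dim class_ring (full_mat_alg t\<lparr>carrier := B g\<rparr>) \<le> 1"
proof -
  have scalar: "\<exists>c. z = c \<cdot>\<^sub>m 1\<^sub>m t" if z: "z \<in> B \<one>" for z
  proof -
    have zc: "z \<in> carrier_mat t t" using W.S_carrier z by blast
    obtain c where c: "det (z + c \<cdot>\<^sub>m 1\<^sub>m t) = 0" using eig zc by blast
    have "z + c \<cdot>\<^sub>m 1\<^sub>m t \<in> B \<one>"
      using mat_subspaceD[OF W.comp[OF one_closed]] z one_in_B by blast
    then have 0: "z + c \<cdot>\<^sub>m 1\<^sub>m t = 0\<^sub>m t t" using B_inv c by blast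
    have "z = (- c) \<cdot>\<^sub>m 1\<^sub>m t"
    proof (rule eq_matI)
      fix i j assume "i < dim_row ((- c) \<cdot>\<^sub>m 1\<^sub>m t)" "j < dim_col ((- c) \<cdot>\<^sub>m 1\<^sub>m t)"
      then have ij: "i < t" "j < t" by auto
      have "(z + c \<cdot>\<^sub>m 1\<^sub>m t) $$ (i, j) = 0" unfolding 0 using ij by simp
      then show "z $$ (i, j) = ((- c) \<cdot>\<^sub>m 1\<^sub>m t) $$ (i, j)" using ij zc by (simp add: eq_neg_iff_add_eq_0)
    qed (use zc in auto)
    then show ?thesis by blast
  qed
  note sub = W.comp[OF g]
  have "\<exists>x\<in>B g. \<forall>y\<in>B g. \<exists>c. y = c \<cdot>\<^sub>m x"
  proof (cases "B g = {0\<^sub>m t t}")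
    case True
    have "0\<^sub>m t t = 1 \<cdot>\<^sub>m (0\<^sub>m t t :: 'k mat)" by auto
    then have "\<exists>c. 0\<^sub>m t t = c \<cdot>\<^sub>m (0\<^sub>m t t :: 'k mat)" by (rule exI)
    then show ?thesis unfolding True by simp
  next
    case False
    then obtain x where x: "x \<in> B g" "x \<noteq> 0\<^sub>m t t" using mat_subspaceD(2)[OF sub] by blast
    have xc: "x \<in> carrier_mat t t" using W.S_carrier g x by blast
    obtain w where w: "w \<in> B (inv g)" "w \<in> carrier_mat t t" "x * w = 1\<^sub>m t" "w * x = 1\<^sub>m t"
      using homogeneous_inverse[OF g x] .
    have "\<exists>c. y = c \<cdot>\<^sub>m x" if y: "y \<in> B g" for y
    proof -
      have yc: "y \<in> carrier_mat t t" using W.S_carrier g y by blast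
      have "y * w \<in> B \<one>" using W_B[OF g _ y w(1)] g by simp
      then obtain c where c: "y * w = c \<cdot>\<^sub>m 1\<^sub>m t" using scalar by blast
      have "y = y * (w * x)" using w yc by simp
      also have "\<dots> = y * w * x" by (rule assoc_mult_mat[OF yc w(2) xc, symmetric])
      also have "\<dots> = c \<cdot>\<^sub>m x" unfolding c using mult_smult_assoc_mat[OF one_carrier_mat xc] xc by simp
      finally show ?thesis by blast
    qed
    then show ?thesis using x by blast
  qed
  then show ?thesis using dim_le_1[OF sub] by blast
qed

end

context graded_frame
begin

sublocale division: graded_division G t B
proof -
  interpret B: graded_mats t t "carrier_mat t t" "carrier G" B by (rule B_graded)
  show "graded_division G t B"
    by unfold_locales (use t_pos B_B B_invertible in auto)
qed

section \<open>The change of basis adapted to the flag\<close>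

lemma flag_mono: "k < m \<Longrightarrow> flag k \<subseteq> flag (Suc k)"
  using s_less[of k] by (fastforce simp: flag_def pattern_mat_def)

lemma flag_0: "flag 0 = {0\<^sub>m N t}"
  by (auto simp: flag_def pattern_mat_def s_0 intro!: eq_matI)

text \<open>The columns of \<open>V\<close> are adapted to the flag of column spaces, so that \<open>V\<close> lies in the algebra.\<close>

lemma adapted_matrix:
  obtains \<rho> Y \<gamma> V V' where
    "\<And>k. k \<le> m \<Longrightarrow> \<rho> k * t = s k"
    "frame.hom_family (\<rho> m) Y \<gamma>" "frame.free_family (\<rho> m) Y" "V = hcat N t (\<rho> m) Y"
    "V \<in> C" "V' \<in> C" "V * V' = 1\<^sub>m N" "V' * V = 1\<^sub>m N"
proof -
  obtain \<rho> Y \<gamma> where \<rho>: "\<rho> 0 = 0" "\<forall>k<m. \<rho> k \<le> \<rho> (Suc k)" "frame.hom_family (\<rho> m) Y \<gamma>"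
    "\<forall>k\<le>m. frame.free_family (\<rho> k) Y \<and> (\<forall>i<\<rho> k. Y i \<in> flag k) \<and> flag k \<subseteq> frame.spanned (\<rho> k) Y"
    using frame.adapted_basis[of m flag, OF flag_graded flag_mono flag_0] by blast
  have mono: "\<rho> k \<le> \<rho> m" if "k \<le> m" for k
    using that by (induction rule: inc_induct) (use \<rho>(2) order_trans in blast)+
  have Yc: "Y i \<in> carrier_mat N t" if "i < \<rho> m" for i
    using frame.hom_family_carrier[OF \<rho>(3) that] .
  have Yflag: "Y i $$ (p, q) = 0" if "k \<le> m" "i < \<rho> k" "p < N" "q < t" "s k \<le> p" for k i p q
    using \<rho>(4) that pattern_matD(2)[of "Y i" N t _ p q] by (fastforce simp: flag_def)
  let ?V = "\<lambda>k. hcat N t (\<rho> k) Y"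
  have inj: "v = 0\<^sub>v (\<rho> k * t)" if "k \<le> m" "v \<in> carrier_vec (\<rho> k * t)" "?V k *\<^sub>v v = 0\<^sub>v N" for k v
    using frame.hcat_inject[of "\<rho> k" Y v] Yc mono[OF that(1)] \<rho>(4) that by auto
  have low: "?V k $$ (i, j) = 0" if "k \<le> m" "i < N" "s k \<le> i" "j < \<rho> k * t" for k i j
  proof -
    have "0 < t" by (rule t_pos)
    then show ?thesis
      using that Yflag[of k "j div t" i "j mod t"] by (simp add: hcat_def less_mult_imp_div_less)
  qed
  have unit: "\<exists>u\<in>carrier_vec (\<rho> k * t). \<forall>i<N. (\<Sum>q<\<rho> k * t. ?V k $$ (i, q) * u $ q) = (if i = j then 1 else 0)"
    if k: "k \<le> m" and j: "j < s k" for k j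
  proof -
    \<comment> \<open>All \<open>t\<close> columns are the unit vector at \<open>j\<close>, which
      puts \<open>E\<close> into \<open>flag k\<close>; the first columns of its coefficients form
      the vector \<open>u\<close>.\<close>
    define E :: "'k mat" where "E = mat N t (\<lambda>(i, _). if i = j then 1 else 0)"
    have "E \<in> flag k" using j by (auto simp: E_def flag_def pattern_mat_def)
    then have "E \<in> frame.spanned (\<rho> k) Y" using \<rho>(4) k by blast
    then obtain c where c: "c \<in> frame.coeffs (\<rho> k)" "E = frame.comb (\<rho> k) Y c"
      unfolding frame.spanned_def by blast
    define u where "u = vec (\<rho> k * t) (\<lambda>q. c (q div t) $$ (q mod t, 0))"
    have "(\<Sum>q<\<rho> k * t. ?V k $$ (i, q) * u $ q) = (if i = j then 1 else 0)" if i: "i < N" for i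
    proof -
      have "(\<Sum>q<\<rho> k * t. ?V k $$ (i, q) * u $ q) =
          (\<Sum>l<\<rho> k. \<Sum>a<t. Y l $$ (i, a) * c l $$ (a, 0))"
        unfolding sum_blocks using i by (intro sum.cong) (auto simp: hcat_index u_def mult_add_less_mult)
      also have "\<dots> = (\<Sum>l<\<rho> k. (Y l * c l) $$ (i, 0))"
      proof (intro sum.cong refl)
        fix l assume l: "l \<in> {..<\<rho> k}"
        then have "Y l \<in> carrier_mat N t" "c l \<in> carrier_mat t t"
          using Yc[of l] mono[OF k] c(1) by (auto simp: frame.coeffs_def)
        from times_mat_index[OF this i t_pos]
        show "(\<Sum>a<t. Y l $$ (i, a) * c l $$ (a, 0)) = (Y l * c l) $$ (i, 0)" by simp
      qed
      also have "\<dots> = E $$ (i, 0)" unfolding c(2) frame.comb_def using i t_pos by simp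
      finally show ?thesis using i t_pos by (simp add: E_def)
    qed
    then show ?thesis by (intro bexI[of _ u]) (auto simp: u_def)
  qed
  have dim: "\<rho> k * t = s k" if k: "k \<le> m" for k
  proof (rule antisym)
    show "\<rho> k * t \<le> s k"
    proof (rule ccontr)
      assume "\<not> \<rho> k * t \<le> s k"
      \<comment> \<open>The first \<open>\<rho> k\<close> block columns vanish from row
        \<open>s k\<close> on, so cutting them to the top \<open>s k\<close> rows does not enlarge
        the kernel.\<close>
      define T where "T = mat (s k) (\<rho> k * t) (\<lambda>(i, j). ?V k $$ (i, j))"
      obtain v where v: "v \<in> carrier_vec (\<rho> k * t)" "v \<noteq> 0\<^sub>v (\<rho> k * t)" "T *\<^sub>v v = 0\<^sub>v (s k)"
        using wide_matrix_kernel[of T "s k" "\<rho> k * t"] \<open>\<not> \<rho> k * t \<le> s k\<close> by (auto simp: T_def)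
      have "?V k *\<^sub>v v = 0\<^sub>v N"
      proof (rule eq_vecI)
        fix i assume "i < dim_vec (0\<^sub>v N :: 'k vec)"
        then have i: "i < N" by simp
        have e: "(?V k *\<^sub>v v) $ i = (\<Sum>q<\<rho> k * t. ?V k $$ (i, q) * v $ q)"
          using i v(1) by (simp add: scalar_prod_def atLeast0LessThan hcat_def)
        show "(?V k *\<^sub>v v) $ i = 0\<^sub>v N $ i"
        proof (cases "i < s k")
          case True
          then have "(T *\<^sub>v v) $ i = (\<Sum>q<\<rho> k * t. ?V k $$ (i, q) * v $ q)"
            using v(1) by (simp add: scalar_prod_def atLeast0LessThan T_def)
          then show ?thesis using e v(3) True i by simp
        next
          case False
          then show ?thesis unfolding e using low[OF k i] i by (simp add: sum.neutral)
        qed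
      qed (auto simp: hcat_def)
      then show False using inj[OF k v(1)] v(2) by simp
    qed
    show "s k \<le> \<rho> k * t"
    proof (rule ccontr)
      assume less: "\<not> s k \<le> \<rho> k * t"
      have "\<forall>j\<in>{..<s k}. \<exists>u. u \<in> carrier_vec (\<rho> k * t) \<and>
          (\<forall>i<N. (\<Sum>q<\<rho> k * t. ?V k $$ (i, q) * u $ q) = (if i = j then 1 else 0))"
        using unit[OF k] by blast
      from bchoice[OF this] obtain u where u: "\<And>j i. j < s k \<Longrightarrow> i < N \<Longrightarrow>
          (\<Sum>q<\<rho> k * t. ?V k $$ (i, q) * u j $ q) = (if i = j then 1 else 0)"
        by blast
      \<comment> \<open>The columns of \<open>D\<close> are preimages of the first
        \<open>s k\<close> unit vectors, so applying the block columns to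
        \<open>D *\<^sub>v v\<close> returns \<open>v\<close>; a kernel vector of \<open>D\<close>
        is therefore zero.\<close>
      define D where "D = mat (\<rho> k * t) (s k) (\<lambda>(q, j). u j $ q)"
      obtain v where v: "v \<in> carrier_vec (s k)" "v \<noteq> 0\<^sub>v (s k)" "D *\<^sub>v v = 0\<^sub>v (\<rho> k * t)"
        using wide_matrix_kernel[of D "\<rho> k * t" "s k"] less by (auto simp: D_def)
      have "v $ i = 0" if i: "i < s k" for i
      proof -
        have iN: "i < N" using i s_le_N[OF k] by simp
        have "v $ i = (\<Sum>j<s k. (if i = j then 1 else 0) * v $ j)"
          using i by (simp add: if_distrib[of "\<lambda>x. x * _"] cong: if_cong)
        also have "\<dots> = (\<Sum>j<s k. (\<Sum>q<\<rho> k * t. ?V k $$ (i, q) * u j $ q) * v $ j)"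
          using u[OF _ iN] by (intro sum.cong) auto
        also have "\<dots> = (\<Sum>q<\<rho> k * t. ?V k $$ (i, q) * (\<Sum>j<s k. u j $ q * v $ j))"
          by (simp add: sum_distrib_left sum_distrib_right mult.assoc) (rule sum.swap)
        also have "\<dots> = (\<Sum>q<\<rho> k * t. ?V k $$ (i, q) * (D *\<^sub>v v) $ q)"
          using v(1) by (intro sum.cong) (auto simp: D_def scalar_prod_def atLeast0LessThan)
        also have "\<dots> = 0" unfolding v(3) by (intro sum.neutral) auto
        finally show ?thesis .
      qed
      then show False using v by (metis carrier_vecD eq_vecI index_zero_vec)
    qed
  qed
  define V where "V = ?V m"
  have nt: "\<rho> m * t = N" using dim s_m by simp
  have Vc: "V \<in> carrier_mat N N" using hcat_carrier[of N t "\<rho> m" Y] by (simp add: V_def nt)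
  have "det V \<noteq> 0"
    using det_0_iff_vec_prod_zero_field[OF Vc] inj[of m] nt by (auto simp: V_def)
  then obtain V' where V': "V' \<in> carrier_mat N N" "V * V' = 1\<^sub>m N" "V' * V = 1\<^sub>m N"
    using det_nonzero_inverse[OF Vc] by blast
  have VV: "V $$ (i, q) = ?V k $$ (i, q)" if "k \<le> m" "i < N" "q < \<rho> k * t" for k i q
  proof -
    have "q < \<rho> m * t" using that(3) mult_le_mono1[OF mono[OF that(1)], of t] by linarith
    then show ?thesis using that by (simp add: V_def hcat_def)
  qed
  have "V \<in> C"
  proof (rule pattern_matI[OF Vc])
    fix i j assume ij: "i < N" "j < N" "\<not> flag_rel m s i j"
    then obtain k where k: "k \<le> m" "j < s k" "s k \<le> i" by (auto simp: flag_rel_def not_less)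
    then show "V $$ (i, j) = 0" using VV[of k i j] low[of k i j] dim[of k] ij by simp
  qed
  moreover have "V' \<in> C"
  proof (rule pattern_matI[OF V'(1)])
    fix i j assume ij: "i < N" "j < N" "\<not> flag_rel m s i j"
    then obtain k where k: "k \<le> m" "j < s k" "s k \<le> i" by (auto simp: flag_rel_def not_less)
    obtain u where u: "\<And>l. l < N \<Longrightarrow> (\<Sum>q<s k. ?V k $$ (l, q) * u $ q) = (if l = j then 1 else 0)"
      using unit[OF k(1,2)] dim[OF k(1)] by auto
    \<comment> \<open>Column \<open>j\<close> of \<open>V'\<close> is the unique preimage of the
      unit vector at \<open>j\<close> under \<open>V\<close>. Since a preimage supported on the
      first \<open>s k\<close> coordinates exists, that column vanishes in row
      \<open>i \<ge> s k\<close>.\<close>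
    define x where "x = vec N (\<lambda>q. if q < s k then u $ q else 0)"
    have x: "x \<in> carrier_vec N" by (simp add: x_def)
    have "V *\<^sub>v x = unit_vec N j"
    proof (rule eq_vecI)
      fix l assume "l < dim_vec (unit_vec N j :: 'k vec)"
      then have l: "l < N" by simp
      have "(V *\<^sub>v x) $ l = (\<Sum>q<N. V $$ (l, q) * x $ q)"
        using l Vc x by (auto simp: scalar_prod_def atLeast0LessThan intro!: sum.cong)
      also have "\<dots> = (\<Sum>q<s k. V $$ (l, q) * x $ q)"
        using s_le_N[OF k(1)] by (intro sum.mono_neutral_right) (auto simp: x_def)
      also have "\<dots> = (\<Sum>q<s k. ?V k $$ (l, q) * u $ q)"
        using VV[OF k(1) l] s_le_N[OF k(1)] dim[OF k(1)] by (intro sum.cong) (auto simp: x_def)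
      finally show "(V *\<^sub>v x) $ l = unit_vec N j $ l" using u[OF l] l ij by simp
    qed (use Vc in auto)
    then have "V' *\<^sub>v unit_vec N j = V' *\<^sub>v (V *\<^sub>v x)" by simp
    also have "\<dots> = x" using assoc_mult_mat_vec[OF V'(1) Vc x] V'(3) x by simp
    finally have "(V' *\<^sub>v unit_vec N j) $ i = 0" using ij k by (simp add: x_def)
    then show "V' $$ (i, j) = 0" using ij V'(1) by simp
  qed
  ultimately show ?thesis
    using that[OF dim \<rho>(3) _ V_def _ _ V'(2,3)] \<rho>(4) by auto
qed

end

context graded_frame
begin

text \<open>Block column \<open>j\<close> of \<open>V * M = a * V\<close>, where \<open>M\<close> is
  the conjugate, expresses \<open>a * Y j\<close> through the basis with the blocks of
  \<open>M\<close> as coefficients. The left side has degree \<open>g \<otimes> \<gamma> j\<close>,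
  so the coefficient of \<open>Y i\<close> must supply what is missing from
  \<open>\<gamma> i\<close>.\<close>

lemma conjugate_homogeneous_blocks:
  assumes hom: "frame.hom_family n Y \<gamma>" and free: "frame.free_family n Y" and nt: "n * t = N"
    and V: "V = hcat N t n Y" and V': "V' \<in> carrier_mat N N" "V * V' = 1\<^sub>m N"
    and g: "g \<in> carrier G" and a: "a \<in> A g" and ij: "i < n" "j < n"
  shows "subblock t (V' * a * V) i j \<in> B (inv (\<gamma> i) \<otimes> (g \<otimes> \<gamma> j))"
proof -
  have Vc: "V \<in> carrier_mat N N" using hcat_carrier[of N t n Y] by (simp add: V nt)
  have ac: "a \<in> carrier_mat N N" using S_carrier[OF g a] .
  have Yc: "\<And>i. i < n \<Longrightarrow> Y i \<in> carrier_mat N t" using frame.hom_family_carrier[OF hom] .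
  define M where "M = V' * a * V"
  have Mc: "M \<in> carrier_mat N N" unfolding M_def using V'(1) ac Vc by auto
  have VM: "V * M = a * V"
  proof -
    have "V * M = V * V' * (a * V)" unfolding M_def using V'(1) ac Vc by (simp add: mult_assoc_dim)
    then show ?thesis using V'(2) ac Vc by simp
  qed
  define D where "D = mat N t (\<lambda>(p, q). M $$ (p, j * t + q))"
  have Dc: "D \<in> carrier_mat (n * t) t" by (simp add: D_def nt)
  have jq: "j * t + q < N" if "q < t" for q using mult_add_less_mult[OF ij(2) that] nt by simp
  have "V * D = a * Y j"
  proof (rule eq_matI)
    fix p q assume "p < dim_row (a * Y j)" "q < dim_col (a * Y j)"
    then have pq: "p < N" "q < t" using ac Yc[OF ij(2)] by auto
    have "(V * D) $$ (p, q) = (\<Sum>k<N. V $$ (p, k) * D $$ (k, q))"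
      using Vc Dc pq nt by (intro times_mat_index) auto
    also have "\<dots> = (\<Sum>k<N. V $$ (p, k) * M $$ (k, j * t + q))"
      using pq by (intro sum.cong) (auto simp: D_def)
    also have "\<dots> = (V * M) $$ (p, j * t + q)"
      using times_mat_index[OF Vc Mc pq(1) jq[OF pq(2)]] by simp
    also have "\<dots> = (\<Sum>k<N. a $$ (p, k) * V $$ (k, j * t + q))"
      unfolding VM by (rule times_mat_index[OF ac Vc pq(1) jq[OF pq(2)]])
    also have "\<dots> = (\<Sum>k<N. a $$ (p, k) * Y j $$ (k, q))"
      using ij pq by (intro sum.cong) (auto simp: V hcat_index)
    also have "\<dots> = (a * Y j) $$ (p, q)"
      using times_mat_index[OF ac Yc[OF ij(2)] pq] by simp
    finally show "(V * D) $$ (p, q) = (a * Y j) $$ (p, q)" .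
  qed (use Vc ac Yc[OF ij(2)] in \<open>auto simp: D_def\<close>)
  then have comb: "frame.comb n Y (vblock t D) = a * Y j"
    using frame.hcat_comb[OF Dc Yc] by (simp add: V)
  have c: "vblock t D \<in> frame.coeffs n" using vblock_carrier[OF Dc] by (simp add: frame.coeffs_def)
  have "a * Y j \<in> W (g \<otimes> \<gamma> j)"
    using A_W[OF g _ a] frame.hom_familyD[OF hom ij(2)] by blast
  then have "vblock t D i \<in> B (inv (\<gamma> i) \<otimes> (g \<otimes> \<gamma> j))"
    using frame.homogeneous_comb_coeffs[OF hom free c _ _ ij(1), of "g \<otimes> \<gamma> j"] comb g
      frame.hom_familyD(1)[OF hom ij(2)] by simp
  moreover have "vblock t D i = subblock t M i j"
    using mult_add_less_mult[OF ij(1)] nt by (intro eq_matI) (auto simp: vblock_def subblock_def D_def)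
  ultimately show ?thesis by (simp add: M_def)
qed

end

theorem corollary1:
  fixes G :: "('g, 'c) monoid_scheme"
    and ds :: "nat list"
    and \<A> :: "'g \<Rightarrow> 'k :: {alg_closed_field, field_char_0} mat set"
  assumes "comm_group G"
    and "ds \<noteq> []" and "\<forall>d\<in>set ds. 0 < d"
    and "is_grading G (UT_alg ds) \<A>"
  shows "\<exists>t ps H gs (\<B> :: 'g \<Rightarrow> 'k mat set) f.
    0 < t \<and> (\<forall>p\<in>set ps. 0 < p) \<and> ds = map (\<lambda>p. p * t) ps \<and>
    subgroup H G \<and>
    length gs = sum_list ps \<and> set gs \<subseteq> carrier G \<and>
    is_fine_grading (G\<lparr>carrier := H\<rparr>) (full_mat_alg t) \<B> \<and>
    grading_support (G\<lparr>carrier := H\<rparr>) (full_mat_alg t) \<B> = H \<and>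
    graded_iso G (UT_alg ds) \<A> (UT_tensor ps t) (UT_tensor_grading G ps gs t H \<B>) f"
proof -
  let ?N = "sum_list ds" and ?m = "length ds" and ?s = "block_start ds"
  let ?U = "UT ds :: 'k mat set"
  interpret G: comm_group G by fact
  have U: "?U = pattern_mat ?N ?N (flag_rel ?m ?s)" by (rule UT_pattern)
  have Uc: "?U \<subseteq> carrier_mat ?N ?N" by (auto simp: UT_def)
  have grading: "is_grading G (full_mat_alg ?N\<lparr>carrier := ?U\<rparr>) \<A>"
    using assms(4) by (simp add: UT_alg_def)
  have gm: "graded_mats ?N ?N (pattern_mat ?N ?N (flag_rel ?m ?s)) (carrier G) \<A>"
    using graded_mats_of_grading[OF G.group_axioms Uc grading] unfolding U .
  interpret A: graded_mats ?N ?N "pattern_mat ?N ?N (flag_rel ?m ?s)" "carrier G" \<A> by (rule gm)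
  interpret flag: graded_flag_alg G ?N ?m ?s \<A>
  proof
    show "x * y \<in> \<A> (g \<otimes>\<^bsub>G\<^esub> h)"
      if "g \<in> carrier G" "h \<in> carrier G" "x \<in> \<A> g" "y \<in> \<A> h" for g h x y
      using grading_mult[OF grading that] .
    show "0 < ?m" using assms(2) by simp
    show "?s k < ?s (Suc k)" if "k < ?m" for k
      using that assms(3) by (simp add: block_start_Suc)
  qed (auto simp: flag_rel_def)
  obtain t Q P where "graded_frame G ?N ?m ?s \<A> t Q P" using flag.frame_exists by blast
  then interpret fr: graded_frame G ?N ?m ?s \<A> t Q P .
  obtain \<rho> Y \<gamma> V V' where basis: "\<And>k. k \<le> ?m \<Longrightarrow> \<rho> k * t = ?s k"
    "fr.frame.hom_family (\<rho> ?m) Y \<gamma>" "fr.frame.free_family (\<rho> ?m) Y" "V = hcat ?N t (\<rho> ?m) Y"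
    "V \<in> flag.C" "V' \<in> flag.C" "V * V' = 1\<^sub>m ?N" "V' * V = 1\<^sub>m ?N"
    by (rule fr.adapted_matrix, rule that)
  have t: "0 < t" by (rule fr.t_pos)
  define n where "n = \<rho> ?m"
  have nt: "n * t = ?N" using basis(1)[of ?m] by (simp add: n_def)
  have \<rho>_less: "\<rho> k < \<rho> (Suc k)" if "k < ?m" for k
  proof -
    have "\<rho> k * t < \<rho> (Suc k) * t" using basis(1)[of k] basis(1)[of "Suc k"] flag.s_less[OF that] that by simp
    then show ?thesis using t by simp
  qed
  \<comment> \<open>The sizes come from the basis: \<open>\<rho> k * t\<close> is the boundary of
    \<open>ds\<close> before block \<open>k\<close>, so this counts the basis members that belong to
    block \<open>k\<close>.\<close>
  define ps where "ps = map (\<lambda>k. \<rho> (Suc k) - \<rho> k) [0..<?m]"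
  have ps_pos: "\<forall>p\<in>set ps. 0 < p" using \<rho>_less by (auto simp: ps_def)
  have ds: "ds = map (\<lambda>p. p * t) ps"
  proof (rule nth_equalityI)
    fix k assume k: "k < length ds"
    then have "ds ! k = \<rho> (Suc k) * t - \<rho> k * t"
      using basis(1)[of k] basis(1)[of "Suc k"] block_start_Suc[OF k] by simp
    then show "ds ! k = map (\<lambda>p. p * t) ps ! k" using k by (simp add: ps_def diff_mult_distrib)
  qed (simp add: ps_def)
  have len: "length ps = ?m" by (simp add: ps_def)
  have n: "sum_list ps = n"
  proof -
    have "?N = sum_list ps * t"
      using block_start_map_mult[of t ps ?m] block_start_length[of ds] block_start_length[of ps] len ds by metis
    then show ?thesis using nt t by simp
  qed
  \<comment> \<open>The tuple consists of the degrees of the homogeneous basis, one for each block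
    column of \<open>V\<close>.\<close>
  define gs where "gs = map \<gamma> [0..<n]"
  have \<gamma>: "\<gamma> i \<in> carrier G" if "i < n" for i
    using fr.frame.hom_familyD(1)[OF basis(2)] that by (simp add: n_def)
  have gs: "length gs = sum_list ps" "set gs \<subseteq> carrier G" using \<gamma> by (auto simp: gs_def n)
  define H where "H = fr.division.support"
  have H: "subgroup H G" unfolding H_def by (rule fr.division.support_subgroup)
  have HG: "H \<subseteq> carrier G" by (rule subgroup.subset[OF H])
  have fine: "is_fine_grading (G\<lparr>carrier := H\<rparr>) (full_mat_alg t) fr.B"
  proof -
    have "is_grading (G\<lparr>carrier := H\<rparr>) (full_mat_alg t) fr.B"
    proof (rule grading_of_graded_mats[OF fr.B_graded HG])
      show "fr.B g = {0\<^sub>m t t}" if "g \<in> carrier G" "g \<notin> H" for g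
        using that by (simp add: H_def fr.division.support_def)
      show "x * y \<in> fr.B (g \<otimes>\<^bsub>G\<^esub> h)" if "g \<in> H" "h \<in> H" "x \<in> fr.B g" "y \<in> fr.B h" for g h x y
        using fr.B_B that HG by blast
    qed
    then show ?thesis
      using fr.division.component_dim_le_1[OF char_matrix_singular[OF _ t]] HG
      by (auto simp: is_fine_grading_def)
  qed
  have supp: "grading_support (G\<lparr>carrier := H\<rparr>) (full_mat_alg t) fr.B = H"
    using HG by (auto simp: grading_support_def module_mat_simps H_def fr.division.support_def)
  define f where "f a = V' * a * V" for a
  have Vc: "V \<in> carrier_mat ?N ?N" "V' \<in> carrier_mat ?N ?N"
    using basis(5,6) A.C_carrier by blast+
  note Vd = carrier_matD[OF Vc(1)] carrier_matD[OF Vc(2)]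
  have fU: "f a \<in> ?U" if "a \<in> ?U" for a
    unfolding f_def U using that basis(5,6) by (intro flag.pattern_mult) (auto simp: U)
  have f_mult: "f (a * b) = f a * f b" if "a \<in> ?U" "b \<in> ?U" for a b
  proof -
    have ab: "dim_row a = ?N" "dim_col a = ?N" "dim_row b = ?N" "dim_col b = ?N"
      using that Uc by auto
    have "f a * f b = V' * a * (V * V') * (b * V)"
      unfolding f_def using ab Vd by (simp add: mult_assoc_dim)
    also have "V' * a * (V * V') = V' * a"
      unfolding basis(7) using ab Vd by (intro right_mult_one_mat) (auto intro: carrier_matI)
    also have "V' * a * (b * V) = f (a * b)"
      unfolding f_def using ab Vd by (simp add: mult_assoc_dim)
    finally show ?thesis ..
  qed
  have f_add: "f (a + b) = f a + f b" if "a \<in> ?U" "b \<in> ?U" for a b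
  proof -
    have ab: "a \<in> carrier_mat ?N ?N" "b \<in> carrier_mat ?N ?N" using that Uc by blast+
    show ?thesis
      unfolding f_def mult_add_distrib_mat[OF Vc(2) ab]
      by (rule add_mult_distrib_mat[OF mult_carrier_mat[OF Vc(2) ab(1)] mult_carrier_mat[OF Vc(2) ab(2)] Vc(1)])
  qed
  have f_smult: "f (c \<cdot>\<^sub>m a) = c \<cdot>\<^sub>m f a" if "a \<in> ?U" for a c
  proof -
    have a: "a \<in> carrier_mat ?N ?N" using that Uc by blast
    show ?thesis
      unfolding f_def mult_smult_distrib[OF Vc(2) a]
      by (rule mult_smult_assoc_mat[OF mult_carrier_mat[OF Vc(2) a] Vc(1)])
  qed
  have f_one: "f (1\<^sub>m ?N) = 1\<^sub>m ?N" unfolding f_def using Vc basis(8) by simp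
  have f_bij: "bij_betw f ?U ?U"
  proof (rule bij_betwI[where g = "\<lambda>a. V * a * V'"])
    show "f \<in> ?U \<rightarrow> ?U" using fU by blast
    show "(\<lambda>a. V * a * V') \<in> ?U \<rightarrow> ?U"
      unfolding U using basis(5,6) by (auto intro!: flag.pattern_mult)
    fix a assume "a \<in> ?U"
    then have a: "a \<in> carrier_mat ?N ?N" "dim_row a = ?N" "dim_col a = ?N" using Uc by auto
    have "V * f a * V' = V * V' * a * (V * V')"
      unfolding f_def using a Vd by (simp add: mult_assoc_dim)
    then show "V * f a * V' = a" unfolding basis(7) using a by simp
    have "f (V * a * V') = V' * V * a * (V' * V)"
      unfolding f_def using a Vd by (simp add: mult_assoc_dim)
    then show "f (V * a * V') = a" unfolding basis(8) using a by simp
  qed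
  \<comment> \<open>Both algebras consist of the same matrices, so \<open>f\<close> is an
    automorphism of the ungraded algebra and only degrees remain to be compared.\<close>
  have T_carrier: "carrier (UT_tensor ps t) = ?U" using UT_tensor_carrier[OF t, of ps] ds by simp
  have T: "UT_tensor ps t = (full_mat_alg ?N)\<lparr>carrier := ?U\<rparr>"
    using T_carrier n nt by (simp add: UT_tensor_def)
  have f_graded: "f a \<in> UT_tensor_grading G ps gs t H fr.B g" if g: "g \<in> carrier G" and a: "a \<in> \<A> g" for g a
    unfolding UT_tensor_grading_def n
  proof (rule in_span_by_blocks)
    have fa: "f a \<in> ?U" using fU A.S_in_C[OF g a] U by simp
    then show "f a \<in> carrier_mat (n * t) (n * t)" using Uc nt by auto
    show "{kron (matrix_unit n i j) b |i j h b. i < n \<and> j < n \<and> matrix_unit n i j \<in> (UT ps :: 'k mat set) \<and>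
        h \<in> H \<and> b \<in> fr.B h \<and> gs ! i \<otimes>\<^bsub>G\<^esub> h \<otimes>\<^bsub>G\<^esub> inv\<^bsub>G\<^esub> (gs ! j) = g} \<subseteq> carrier_mat (n * t) (n * t)"
      using HG mat_subspaceD(1)[OF fr.B_subspace] by (auto intro!: kron_carrier)
    fix i j assume ij: "i < n" "j < n" and nz: "subblock t (f a) i j \<noteq> 0\<^sub>m t t"
    let ?h = "inv\<^bsub>G\<^esub> (\<gamma> i) \<otimes>\<^bsub>G\<^esub> (g \<otimes>\<^bsub>G\<^esub> \<gamma> j)"
    have h: "?h \<in> carrier G" using \<gamma> ij g by simp
    have b: "subblock t (f a) i j \<in> fr.B ?h"
      unfolding f_def
      using fr.conjugate_homogeneous_blocks[OF basis(2,3) _ basis(4) Vc(2) basis(7) g a] ij nt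
      by (simp add: n_def)
    \<comment> \<open>A nonzero block is itself the witness that its degree belongs to the
      support.\<close>
    have hH: "?h \<in> H" unfolding H_def by (rule fr.division.supportI[OF h b nz])
    have deg: "gs ! i \<otimes>\<^bsub>G\<^esub> ?h \<otimes>\<^bsub>G\<^esub> inv\<^bsub>G\<^esub> (gs ! j) = g"
    proof -
      have "\<gamma> i \<otimes>\<^bsub>G\<^esub> ?h = g \<otimes>\<^bsub>G\<^esub> \<gamma> j"
        using \<gamma> ij g by (simp add: G.m_assoc[symmetric])
      then show ?thesis using \<gamma> ij g by (simp add: gs_def G.m_assoc)
    qed
    \<comment> \<open>A position forbidden in the small pattern stands for a whole
      \<open>t \<times> t\<close> block of forbidden positions, on which \<open>f a\<close> would
      vanish.\<close>
    have "flag_rel (length ps) (block_start ps) i j"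
    proof (rule ccontr)
      assume nf: "\<not> flag_rel (length ps) (block_start ps) i j"
      have "f a $$ (i * t + p, j * t + q) = 0" if pq: "p < t" "q < t" for p q
      proof (rule pattern_matD(2)[OF fa[unfolded U]])
        have "?s = (\<lambda>k. block_start ps k * t)" using block_start_map_mult[of t ps] ds by auto
        then show "\<not> flag_rel ?m ?s (i * t + p) (j * t + q)"
          using nf pq t len by (simp add: flag_rel_blocks)
        show "i * t + p < ?N" "j * t + q < ?N" using mult_add_less_mult ij pq nt by metis+
      qed
      then have "subblock t (f a) i j = 0\<^sub>m t t" by (intro eq_matI) (auto simp: subblock_def)
      then show False using nz by simp
    qed
    then have "(matrix_unit n i j :: 'k mat) \<in> UT ps" using matrix_unit_UT[of i ps j] ij n by simp
    then show "kron (matrix_unit n i j) (subblock t (f a) i j) \<in>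
        {kron (matrix_unit n i j) b |i j h b. i < n \<and> j < n \<and> matrix_unit n i j \<in> (UT ps :: 'k mat set) \<and>
        h \<in> H \<and> b \<in> fr.B h \<and> gs ! i \<otimes>\<^bsub>G\<^esub> h \<otimes>\<^bsub>G\<^esub> inv\<^bsub>G\<^esub> (gs ! j) = g}"
      using ij hH b deg by blast
  qed
  have iso: "graded_iso G (UT_alg ds) \<A> (UT_tensor ps t) (UT_tensor_grading G ps gs t H fr.B) f"
    unfolding graded_iso_def
  proof (intro conjI ballI)
    show "f \<in> Ring.ring_hom (UT_alg ds) (UT_tensor ps t)"
      by (rule ring_hom_memI) (simp_all add: T UT_alg_def module_mat_simps fU f_mult f_add f_one)
    show "f \<in> LinearCombinations.module_hom class_ring (UT_alg ds) (UT_tensor ps t)"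
      by (auto simp: LinearCombinations.module_hom_def T UT_alg_def module_mat_simps fU f_add f_smult)
    show "bij_betw f (carrier (UT_alg ds)) (carrier (UT_tensor ps t))"
      using f_bij by (simp add: T UT_alg_def)
    show "f ` \<A> g \<subseteq> UT_tensor_grading G ps gs t H fr.B g" if "g \<in> carrier G" for g
      using f_graded[OF that] by blast
  qed
  show ?thesis
    using t ps_pos ds H gs fine supp iso by blast
qed

end
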